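(* Let $X_n$ denote the star graph with $n$ leaves. Then the FI-modules $[n]\mapsto H_1(\mathrm{Conf}_2(X_n);\mathbb{Q})$ and $[n]\mapsto H_1(\mathrm{UConf}_2(X_n);\mathbb{Q})$ are multiplicity stable no later than $n = 4$.
   Context: The star graph $X_n$ is the tree with a single internal vertex joined by an edge to each of $n$ leaves labeled $1,\dots,n$, regarded as a 1-dimensional CW complex. An injection $[n]\hookrightarrow[m]$, where $[n]=\{1,\dots,n\}$, induces an embedding $X_n\hookrightarrow X_m$ (fixing the internal vertex and mapping leaves via the injection), hence maps on configuration spaces and homology; in particular $S_n$ acts on each. $\mathrm{Conf}_2(G)=\{(x_1,x_2)\in G^2 : x_1\neq x_2\}$ and $\mathrm{UConf}_2(G)=\mathrm{Conf}_2(G)/S_2$. FI is the category of finite sets and injections; an FI-module is a functor $V$ from FI to finite-dimensional $\mathbb{Q}$-vector spaces, and $V_n=V([n])$ is an $S_n$-representation. For a partition $\lambda=(\lambda_1,\dots,\lambda_r)$ and $n\ge|\lambda|+\lambda_1$, $\mathrm{Sp}_n(\lambda)$ is the Specht module over $\mathbb{Q}$ of the partition $(n-|\lambda|,\lambda_1,\dots,\lambda_r)$ of $n$. "Multiplicity stable no later than $n=N$" means: there are a finite set $\Lambda$ of partitions and integers $m_\lambda\geq0$ ($\lambda\in\Lambda$) such that for all $n\geq N$, $V_n\cong\bigoplus_{\lambda\in\Lambda}\mathrm{Sp}_n(\lambda)^{\oplus m_\lambda}$ as $S_n$-representations. *)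

theory Defs
  imports
    "HOL-Homology.Homology"
    "HOL-Algebra.Module"
    "HOL-Combinatorics.Permutations"
begin

section \<open>Vector spaces over the rationals\<close>

definition rat_field :: "rat ring"
  where "rat_field =
    \<lparr>carrier = UNIV, monoid.mult = (*), one = 1, zero = 0, add = (+)\<rparr>"

lemma field_rat_field: "field rat_field"
proof -
  have "\<exists>y. x + y = 0" for x :: rat
    by (rule exI[of _ "- x"]) simp
  moreover have "x \<noteq> 0 \<Longrightarrow> \<exists>y. x * y = 1" for x :: rat
    by (rule exI[of _ "inverse x"]) simp
  ultimately show ?thesis
    unfolding rat_field_def
    by unfold_locales (auto simp: algebra_simps Units_def)
qed

type_synonym 'v rat_space = "(rat, 'v) module"

definition linear_maps :: "'v rat_space \<Rightarrow> 'w rat_space \<Rightarrow> ('v \<Rightarrow> 'w) set"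
  where "linear_maps V W =
    {h \<in> carrier V \<rightarrow> carrier W.
      (\<forall>x\<in>carrier V. \<forall>y\<in>carrier V. h (x \<oplus>\<^bsub>V\<^esub> y) = h x \<oplus>\<^bsub>W\<^esub> h y) \<and>
      (\<forall>c. \<forall>x\<in>carrier V. h (c \<odot>\<^bsub>V\<^esub> x) = c \<odot>\<^bsub>W\<^esub> h x)}"

definition finite_dimensional :: "'v rat_space \<Rightarrow> bool"
  where "finite_dimensional V \<longleftrightarrow>
    (\<exists>B. finite B \<and> B \<subseteq> carrier V \<and>
      (\<forall>v\<in>carrier V. \<exists>c. v = (\<Oplus>\<^bsub>V\<^esub>b\<in>B. c b \<odot>\<^bsub>V\<^esub> b)))"

text \<open>The direct product of the family, which for finite index sets is the direct sum. Here and
  below, the record fields \<open>mult\<close> and \<open>one\<close>, which a module inherits from the ring record, carry no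
  meaning.\<close>

definition finite_direct_sum :: "'i set \<Rightarrow> ('i \<Rightarrow> 'v rat_space) \<Rightarrow> ('i \<Rightarrow> 'v) rat_space"
  where "finite_direct_sum I V =
    \<lparr>carrier = (\<Pi>\<^sub>E i\<in>I. carrier (V i)), monoid.mult = undefined, one = undefined,
     zero = (\<lambda>i\<in>I. \<zero>\<^bsub>V i\<^esub>),
     add = (\<lambda>x y. \<lambda>i\<in>I. x i \<oplus>\<^bsub>V i\<^esub> y i),
     smult = (\<lambda>c x. \<lambda>i\<in>I. c \<odot>\<^bsub>V i\<^esub> x i)\<rparr>"

subsection \<open>Free vector spaces and their subquotients\<close>

text \<open>The free rational vector space on a type is the type of finitely supported functions.\<close>

definition rat_scale :: "rat \<Rightarrow> ('a \<Rightarrow>\<^sub>0 rat) \<Rightarrow> ('a \<Rightarrow>\<^sub>0 rat)"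
  where "rat_scale c = Poly_Mapping.map ((*) c)"

lemma lookup_rat_scale: "Poly_Mapping.lookup (rat_scale c v) x = c * Poly_Mapping.lookup v x"
  by (simp add: rat_scale_def Poly_Mapping.map.rep_eq when_def)

interpretation rat_free: vector_space "rat_scale :: rat \<Rightarrow> ('a \<Rightarrow>\<^sub>0 rat) \<Rightarrow> ('a \<Rightarrow>\<^sub>0 rat)"
  by unfold_locales
    (auto intro!: poly_mapping_eqI simp: lookup_rat_scale lookup_add algebra_simps)

definition linear_extension :: "('a \<Rightarrow> ('b \<Rightarrow>\<^sub>0 rat)) \<Rightarrow> ('a \<Rightarrow>\<^sub>0 rat) \<Rightarrow> ('b \<Rightarrow>\<^sub>0 rat)"
  where "linear_extension g v =
    (\<Sum>x\<in>Poly_Mapping.keys v. rat_scale (Poly_Mapping.lookup v x) (g x))"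

definition subspace_of_free :: "('a \<Rightarrow>\<^sub>0 rat) set \<Rightarrow> ('a \<Rightarrow>\<^sub>0 rat) rat_space"
  where "subspace_of_free S =
    \<lparr>carrier = S, monoid.mult = undefined, one = undefined,
     zero = 0, add = (+), smult = rat_scale\<rparr>"

definition coset :: "('a \<Rightarrow>\<^sub>0 rat) set \<Rightarrow> ('a \<Rightarrow>\<^sub>0 rat) \<Rightarrow> ('a \<Rightarrow>\<^sub>0 rat) set"
  where "coset B z = (\<lambda>b. z + b) ` B"

text \<open>In the scalar multiplication, adding \<open>B\<close> matters only for the scalar 0.\<close>

definition quotient_of_free ::
    "('a \<Rightarrow>\<^sub>0 rat) set \<Rightarrow> ('a \<Rightarrow>\<^sub>0 rat) set \<Rightarrow> ('a \<Rightarrow>\<^sub>0 rat) set rat_space"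
  where "quotient_of_free Z B =
    \<lparr>carrier = coset B ` Z, monoid.mult = undefined, one = undefined,
     zero = B,
     add = (\<lambda>C D. {x + y | x y. x \<in> C \<and> y \<in> D}),
     smult = (\<lambda>c C. {rat_scale c x + b | x b. x \<in> C \<and> b \<in> B})\<rparr>"


section \<open>Singular homology with rational coefficients\<close>

text \<open>The library's singular chains have integer coefficients; the following repeats its
  definitions with rational coefficients, on top of its singular simplices.\<close>

type_synonym 'a rat_chain = "((nat \<Rightarrow> real) \<Rightarrow> 'a) \<Rightarrow>\<^sub>0 rat"

definition rat_chains :: "nat \<Rightarrow> 'a topology \<Rightarrow> 'a rat_chain set"
  where "rat_chains p X = {c. Poly_Mapping.keys c \<subseteq> singular_simplex_set p X}"

definition rat_boundary :: "nat \<Rightarrow> 'a rat_chain \<Rightarrow> 'a rat_chain"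
  where "rat_boundary p =
    (if p = 0 then (\<lambda>c. 0)
     else linear_extension (\<lambda>s. \<Sum>k\<le>p. Poly_Mapping.single (singular_face p k s) ((-1) ^ k)))"

definition rat_cycles :: "nat \<Rightarrow> 'a topology \<Rightarrow> 'a rat_chain set"
  where "rat_cycles p X = {c \<in> rat_chains p X. rat_boundary p c = 0}"

definition rat_boundaries :: "nat \<Rightarrow> 'a topology \<Rightarrow> 'a rat_chain set"
  where "rat_boundaries p X = rat_boundary (Suc p) ` rat_chains (Suc p) X"

definition rat_homology :: "nat \<Rightarrow> 'a topology \<Rightarrow> 'a rat_chain set rat_space"
  where "rat_homology p X = quotient_of_free (rat_cycles p X) (rat_boundaries p X)"

definition rat_chain_map :: "nat \<Rightarrow> ('a \<Rightarrow> 'b) \<Rightarrow> 'a rat_chain \<Rightarrow> 'b rat_chain"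
  where "rat_chain_map p g = linear_extension (\<lambda>s. Poly_Mapping.single (simplex_map p g s) 1)"

text \<open>The map on \<open>p\<close>-th homology induced by a continuous map \<open>g\<close> from some space to \<open>Y\<close>: the class
  of a cycle \<open>z\<close> goes to the class of its image.\<close>

definition rat_homology_map ::
    "nat \<Rightarrow> 'b topology \<Rightarrow> ('a \<Rightarrow> 'b) \<Rightarrow> 'a rat_chain set \<Rightarrow> 'b rat_chain set"
  where "rat_homology_map p Y g C =
    {rat_chain_map p g z + b | z b. z \<in> C \<and> b \<in> rat_boundaries p Y}"


section \<open>Configuration spaces of two points\<close>

definition Conf2 :: "'a topology \<Rightarrow> ('a \<times> 'a) topology"
  where "Conf2 X = subtopology (prod_topology X X) {(x, y). x \<noteq> y}"

definition quotient_topology :: "'a topology \<Rightarrow> ('a \<Rightarrow> 'b) \<Rightarrow> 'b topology"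
  where "quotient_topology X q =
    topology (\<lambda>U. U \<subseteq> q ` topspace X \<and> openin X {x \<in> topspace X. q x \<in> U})"

lemma openin_quotient_topology:
  "openin (quotient_topology X q) U \<longleftrightarrow>
    U \<subseteq> q ` topspace X \<and> openin X {x \<in> topspace X. q x \<in> U}"
proof -
  have "istopology (\<lambda>U. U \<subseteq> q ` topspace X \<and> openin X {x \<in> topspace X. q x \<in> U})"
    unfolding istopology_def
  proof (intro conjI allI impI)
    fix S T
    assume "S \<subseteq> q ` topspace X \<and> openin X {x \<in> topspace X. q x \<in> S}"
      and "T \<subseteq> q ` topspace X \<and> openin X {x \<in> topspace X. q x \<in> T}"
    moreover have "{x \<in> topspace X. q x \<in> S \<inter> T} =
        {x \<in> topspace X. q x \<in> S} \<inter> {x \<in> topspace X. q x \<in> T}"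
      by blast
    ultimately show "S \<inter> T \<subseteq> q ` topspace X" "openin X {x \<in> topspace X. q x \<in> S \<inter> T}"
      by auto
  next
    fix K
    assume K: "\<forall>S\<in>K. S \<subseteq> q ` topspace X \<and> openin X {x \<in> topspace X. q x \<in> S}"
    then show "\<Union>K \<subseteq> q ` topspace X"
      by blast
    have "{x \<in> topspace X. q x \<in> \<Union>K} = (\<Union>S\<in>K. {x \<in> topspace X. q x \<in> S})"
      by blast
    with K show "openin X {x \<in> topspace X. q x \<in> \<Union>K}"
      by auto
  qed
  then show ?thesis
    by (simp add: quotient_topology_def topology_inverse')
qed

lemma topspace_quotient_topology: "topspace (quotient_topology X q) = q ` topspace X"
proof -
  have "{x \<in> topspace X. q x \<in> q ` topspace X} = topspace X"
    by blast
  then have "openin (quotient_topology X q) (q ` topspace X)"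
    by (simp add: openin_quotient_topology)
  then show ?thesis
    by (meson openin_quotient_topology openin_subset openin_topspace subset_antisym)
qed

lemma quotient_map_quotient_topology: "quotient_map X (quotient_topology X q) q"
  by (auto simp: quotient_map_def topspace_quotient_topology openin_quotient_topology)

text \<open>The points of the unordered configuration space are the orbits of the symmetric group on two
  letters, whose nontrivial element swaps the two coordinates.\<close>

definition swap_orbit :: "'a \<times> 'a \<Rightarrow> ('a \<times> 'a) set"
  where "swap_orbit p = {p, prod.swap p}"

definition UConf2 :: "'a topology \<Rightarrow> ('a \<times> 'a) set topology"
  where "UConf2 X = quotient_topology (Conf2 X) swap_orbit"

definition Conf2_map :: "('a \<Rightarrow> 'b) \<Rightarrow> 'a \<times> 'a \<Rightarrow> 'b \<times> 'b"
  where "Conf2_map g = map_prod g g"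

definition UConf2_map :: "('a \<Rightarrow> 'b) \<Rightarrow> ('a \<times> 'a) set \<Rightarrow> ('b \<times> 'b) set"
  where "UConf2_map g P = Conf2_map g ` P"


section \<open>Star graphs\<close>

text \<open>The star graph with leaves \<open>1, \<dots>, n\<close>, realised as the union of the segments from the origin
  (the internal vertex) to the standard basis vectors (the leaves). It lies in a
  finite-dimensional coordinate subspace and is a finite union of compact segments, so the subspace
  topology is the topology of the CW complex.\<close>

definition star_point :: "nat \<Rightarrow> real \<Rightarrow> nat \<Rightarrow> real"
  where "star_point i t = (\<lambda>j. if j = i then t else 0)"

definition star :: "nat \<Rightarrow> (nat \<Rightarrow> real) topology"
  where "star n = top_of_set (insert (\<lambda>_. 0) {star_point i t | i t. i \<in> {1..n} \<and> t \<in> {0..1}})"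

text \<open>The embedding induced by an injection \<open>f\<close> from \<open>{1..m}\<close>: it maps \<open>star_point i t\<close> to
  \<open>star_point (f i) t\<close>, and each of the sums has at most one term.\<close>

definition star_map :: "nat \<Rightarrow> (nat \<Rightarrow> nat) \<Rightarrow> (nat \<Rightarrow> real) \<Rightarrow> nat \<Rightarrow> real"
  where "star_map m f x = (\<lambda>j. \<Sum>i\<in>{i\<in>{1..m}. f i = j}. x i)"

lemma star_map_zero: "star_map m f (\<lambda>_. 0) = (\<lambda>_. 0)"
  by (simp add: star_map_def)

lemma star_map_star_point:
  assumes "i \<in> {1..m}"
  shows "star_map m f (star_point i t) = star_point (f i) t"
  using assms by (auto simp: star_map_def star_point_def fun_eq_iff)


section \<open>FI-modules\<close>

text \<open>FI-modules are taken on the skeleton of FI with objects \<open>{1..n}\<close>. Its morphisms are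
  extensional functions, so that a hom-set is exactly the set of injections.\<close>

definition FI_hom :: "nat \<Rightarrow> nat \<Rightarrow> (nat \<Rightarrow> nat) set"
  where "FI_hom m n = {f \<in> {1..m} \<rightarrow>\<^sub>E {1..n}. inj_on f {1..m}}"

locale FI_module =
  fixes V :: "nat \<Rightarrow> 'v rat_space"
    and V_map :: "nat \<Rightarrow> nat \<Rightarrow> (nat \<Rightarrow> nat) \<Rightarrow> 'v \<Rightarrow> 'v"
  assumes vector_space: "Module.module rat_field (V n)"
    and finite_dimensional: "finite_dimensional (V n)"
    and map_linear: "f \<in> FI_hom m n \<Longrightarrow> V_map m n f \<in> linear_maps (V m) (V n)"
    and map_id: "v \<in> carrier (V n) \<Longrightarrow> V_map n n (\<lambda>i\<in>{1..n}. i) v = v"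
    and map_comp: "\<lbrakk>f \<in> FI_hom l m; g \<in> FI_hom m n; v \<in> carrier (V l)\<rbrakk> \<Longrightarrow>
      V_map l n (compose {1..l} g f) v = V_map m n g (V_map l m f v)"

text \<open>Isomorphism of representations of the symmetric group on \<open>{1..n}\<close>, each given by its space and
  the action of the permutations.\<close>

definition isomorphic_reps ::
    "nat \<Rightarrow> 'v rat_space \<Rightarrow> ((nat \<Rightarrow> nat) \<Rightarrow> 'v \<Rightarrow> 'v) \<Rightarrow>
      'w rat_space \<Rightarrow> ((nat \<Rightarrow> nat) \<Rightarrow> 'w \<Rightarrow> 'w) \<Rightarrow> bool"
  where "isomorphic_reps n V \<rho> W \<tau> \<longleftrightarrow>
    (\<exists>h\<in>linear_maps V W. bij_betw h (carrier V) (carrier W) \<and>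
      (\<forall>\<sigma>. \<sigma> permutes {1..n} \<longrightarrow> (\<forall>v\<in>carrier V. h (\<rho> \<sigma> v) = \<tau> \<sigma> (h v))))"


section \<open>Specht modules\<close>

definition is_partition :: "nat list \<Rightarrow> bool"
  where "is_partition \<nu> \<longleftrightarrow> sorted_wrt (\<ge>) \<nu> \<and> 0 \<notin> set \<nu>"

definition young_diagram :: "nat list \<Rightarrow> (nat \<times> nat) set"
  where "young_diagram \<mu> = {(i, j). i < length \<mu> \<and> j < \<mu> ! i}"

type_synonym tableau = "nat \<times> nat \<Rightarrow> nat"

definition tableaux :: "nat list \<Rightarrow> tableau set"
  where "tableaux \<mu> =
    {t \<in> extensional (young_diagram \<mu>). bij_betw t (young_diagram \<mu>) {1..sum_list \<mu>}}"

text \<open>A tabloid, that is, a tableau up to permutations within the rows, is represented by the family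
  of the sets of entries of its rows.\<close>

type_synonym tabloid = "nat \<Rightarrow> nat set"

definition tabloid_of :: "nat list \<Rightarrow> tableau \<Rightarrow> tabloid"
  where "tabloid_of \<mu> t = (\<lambda>i. {t (i, j) | j. (i, j) \<in> young_diagram \<mu>})"

definition permute_tabloid :: "(nat \<Rightarrow> nat) \<Rightarrow> tabloid \<Rightarrow> tabloid"
  where "permute_tabloid \<sigma> T = (\<lambda>i. \<sigma> ` T i)"

definition column :: "nat list \<Rightarrow> tableau \<Rightarrow> nat \<Rightarrow> nat set"
  where "column \<mu> t j = {t (i, j) | i. (i, j) \<in> young_diagram \<mu>}"

definition column_stabilizer :: "nat list \<Rightarrow> tableau \<Rightarrow> (nat \<Rightarrow> nat) set"
  where "column_stabilizer \<mu> t =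
    {\<sigma>. \<sigma> permutes {1..sum_list \<mu>} \<and> (\<forall>j. \<sigma> ` column \<mu> t j = column \<mu> t j)}"

definition polytabloid :: "nat list \<Rightarrow> tableau \<Rightarrow> (tabloid \<Rightarrow>\<^sub>0 rat)"
  where "polytabloid \<mu> t =
    (\<Sum>\<sigma>\<in>column_stabilizer \<mu> t.
      Poly_Mapping.single (permute_tabloid \<sigma> (tabloid_of \<mu> t)) (of_int (sign \<sigma>)))"

definition Specht :: "nat list \<Rightarrow> (tabloid \<Rightarrow>\<^sub>0 rat) rat_space"
  where "Specht \<mu> = subspace_of_free (rat_free.span (polytabloid \<mu> ` tableaux \<mu>))"

definition Specht_action :: "(nat \<Rightarrow> nat) \<Rightarrow> (tabloid \<Rightarrow>\<^sub>0 rat) \<Rightarrow> (tabloid \<Rightarrow>\<^sub>0 rat)"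
  where "Specht_action \<sigma> = linear_extension (\<lambda>T. Poly_Mapping.single (permute_tabloid \<sigma> T) 1)"

text \<open>The partition \<open>(n - |\<nu>|, \<nu>\<^sub>1, \<dots>, \<nu>\<^sub>r)\<close> of \<open>n\<close>, which is defined when \<open>n \<ge> |\<nu>| + \<nu>\<^sub>1\<close>; for the
  empty partition, \<open>\<nu>\<^sub>1\<close> is 0.\<close>

definition paddable :: "nat \<Rightarrow> nat list \<Rightarrow> bool"
  where "paddable n \<nu> \<longleftrightarrow> sum_list \<nu> + (case \<nu> of [] \<Rightarrow> 0 | l # _ \<Rightarrow> l) \<le> n"

definition padded_partition :: "nat \<Rightarrow> nat list \<Rightarrow> nat list"
  where "padded_partition n \<nu> = (n - sum_list \<nu>) # \<nu>"

text \<open>The direct sum over \<open>\<nu> \<in> \<Lambda>\<close> of \<open>m \<nu>\<close> copies of the Specht module of the padded partition; the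
  summands are indexed by the pairs of some \<open>\<nu> \<in> \<Lambda>\<close> and the number of the copy.\<close>

definition copies :: "nat list set \<Rightarrow> (nat list \<Rightarrow> nat) \<Rightarrow> (nat list \<times> nat) set"
  where "copies \<Lambda> m = (SIGMA \<nu>:\<Lambda>. {..<m \<nu>})"

definition Specht_sum ::
    "nat \<Rightarrow> nat list set \<Rightarrow> (nat list \<Rightarrow> nat) \<Rightarrow> (nat list \<times> nat \<Rightarrow> (tabloid \<Rightarrow>\<^sub>0 rat)) rat_space"
  where "Specht_sum n \<Lambda> m =
    finite_direct_sum (copies \<Lambda> m) (\<lambda>(\<nu>, k). Specht (padded_partition n \<nu>))"

definition Specht_sum_action ::
    "nat list set \<Rightarrow> (nat list \<Rightarrow> nat) \<Rightarrow> (nat \<Rightarrow> nat) \<Rightarrow>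
      (nat list \<times> nat \<Rightarrow> (tabloid \<Rightarrow>\<^sub>0 rat)) \<Rightarrow> (nat list \<times> nat \<Rightarrow> (tabloid \<Rightarrow>\<^sub>0 rat))"
  where "Specht_sum_action \<Lambda> m \<sigma> x = (\<lambda>i\<in>copies \<Lambda> m. Specht_action \<sigma> (x i))"

definition multiplicity_stable_from ::
    "(nat \<Rightarrow> 'v rat_space) \<Rightarrow> (nat \<Rightarrow> nat \<Rightarrow> (nat \<Rightarrow> nat) \<Rightarrow> 'v \<Rightarrow> 'v) \<Rightarrow> nat \<Rightarrow> bool"
  where "multiplicity_stable_from V V_map N \<longleftrightarrow>
    (\<exists>\<Lambda> m. finite \<Lambda> \<and> (\<forall>\<nu>\<in>\<Lambda>. is_partition \<nu>) \<and>
      (\<forall>n\<ge>N. (\<forall>\<nu>\<in>\<Lambda>. paddable n \<nu>) \<and>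
        isomorphic_reps n
          (V n) (\<lambda>\<sigma>. V_map n n (restrict \<sigma> {1..n}))
          (Specht_sum n \<Lambda> m) (Specht_sum_action \<Lambda> m)))"


section \<open>The homology of configuration spaces of stars\<close>

definition H1_Conf2_star :: "nat \<Rightarrow> ((nat \<Rightarrow> real) \<times> (nat \<Rightarrow> real)) rat_chain set rat_space"
  where "H1_Conf2_star n = rat_homology 1 (Conf2 (star n))"

definition H1_Conf2_star_map ::
    "nat \<Rightarrow> nat \<Rightarrow> (nat \<Rightarrow> nat) \<Rightarrow> ((nat \<Rightarrow> real) \<times> (nat \<Rightarrow> real)) rat_chain set \<Rightarrow>
      ((nat \<Rightarrow> real) \<times> (nat \<Rightarrow> real)) rat_chain set"
  where "H1_Conf2_star_map m n f =
    rat_homology_map 1 (Conf2 (star n)) (Conf2_map (star_map m f))"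

definition H1_UConf2_star :: "nat \<Rightarrow> ((nat \<Rightarrow> real) \<times> (nat \<Rightarrow> real)) set rat_chain set rat_space"
  where "H1_UConf2_star n = rat_homology 1 (UConf2 (star n))"

definition H1_UConf2_star_map ::
    "nat \<Rightarrow> nat \<Rightarrow> (nat \<Rightarrow> nat) \<Rightarrow> ((nat \<Rightarrow> real) \<times> (nat \<Rightarrow> real)) set rat_chain set \<Rightarrow>
      ((nat \<Rightarrow> real) \<times> (nat \<Rightarrow> real)) set rat_chain set"
  where "H1_UConf2_star_map m n f =
    rat_homology_map 1 (UConf2 (star n)) (UConf2_map (star_map m f))"

end

theory Submission
  imports Defs
begin

text \<open>A space covered by two open sets \<open>U\<close> and \<open>V\<close> such that \<open>U\<close>, \<open>V\<close> and \<open>U \<inter> V\<close> contract onto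
  discrete sets behaves like a graph, with a vertex for each component of \<open>U\<close> or \<open>V\<close> and an edge for each
  component of \<open>U \<inter> V\<close>: its first homology is the space of edge weights with sum zero at every vertex.
  The weights of a class are found by writing a representative as \<open>u + v\<close> with \<open>u\<close> in \<open>U\<close> and
  \<open>v\<close> in \<open>V\<close> and counting the points of \<open>\<partial>u\<close> in each component of \<open>U \<inter> V\<close>.

  Of two distinct points on a star, the second lies off the centre with the first not between it and
  its leaf, or else the same holds with the two points exchanged. These two open
  conditions turn the ordered configuration space into the bipartite graph with an edge for each pair
  \<open>i \<noteq> j\<close> of legs, so that \<open>H\<^sub>1\<close> consists of the matrices with zero diagonal and vanishing row and column
  sums. The unordered configuration space is the complete graph on the legs (a vertex: one
  point is farther out than the other, on a given leg; the middle of an edge: the points lie on two given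
  legs), and \<open>H\<^sub>1\<close> consists of the antisymmetric such matrices. The symmetric matrices are spanned by
  4-cycles, which are the polytabloids of shape \<open>(n - 2, 2)\<close>; the antisymmetric ones are spanned by
  triangles, which are the polytabloids of shape \<open>(n - 2, 1, 1)\<close>.\<close>

text \<open>The topological input (homotopy invariance, iterated subdivision, small simplices) is
  applied to integral chains: every rational chain is a multiple of an integral one, and all
  operators involved are linear. The weights of a class are its image under the connecting
  homomorphism of the Mayer-Vietoris sequence, which is injective because \<open>H_1\<close> of both
  pieces vanishes. In the unordered case, contracting sets of unordered pairs directly would be
  awkward. Instead, each piece is the image of an open set of ordered pairs that meets every swap
  orbit at most once; there the orbit map is a homeomorphism onto its image, and straight-line
  motions of ordered pairs do the work. The price is that the two pieces choose representatives
  differently, by distance from the centre and by the numbering of the legs, and that the second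
  choice is not invariant under permutations. The bound 4 comes from the shape
  \<open>(n - 2, 2)\<close>: it is a partition only for \<open>n \<ge> 4\<close>, and a 4-cycle
  needs four legs. On at most three legs a symmetric flow is zero.\<close>

abbreviation "keys \<equiv> Poly_Mapping.keys"
abbreviation "lookup \<equiv> Poly_Mapping.lookup"
abbreviation "single \<equiv> Poly_Mapping.single"
abbreviation "rat_linear \<equiv> Vector_Spaces.linear rat_scale rat_scale"

section \<open>Linear algebra in free rational vector spaces\<close>

lemma rat_scale_simps [simp]:
  "rat_scale 0 v = 0" "rat_scale 1 v = v"
  by (auto intro!: poly_mapping_eqI simp: lookup_rat_scale)

lemma rat_scale_single [simp]:
  "rat_scale c (single x d) = single x (c * d)"
  by (auto intro!: poly_mapping_eqI simp: lookup_rat_scale lookup_single when_def)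

lemma keys_rat_scale: "keys (rat_scale c v) \<subseteq> keys v"
  by (auto simp: in_keys_iff lookup_rat_scale)

lemma keys_rat_scale_eq: "c \<noteq> 0 \<Longrightarrow> keys (rat_scale c v) = keys v"
  by (auto simp: in_keys_iff lookup_rat_scale)

lemma subspace_keys: "rat_free.subspace {f. keys f \<subseteq> A}"
  unfolding rat_free.subspace_def
proof (intro conjI ballI allI)
  fix x y :: "'a \<Rightarrow>\<^sub>0 rat" and c
  assume x: "x \<in> {f. keys f \<subseteq> A}"
  then show "rat_scale c x \<in> {f. keys f \<subseteq> A}"
    using keys_rat_scale[of c x] by auto
  assume "y \<in> {f. keys f \<subseteq> A}"
  with x show "x + y \<in> {f. keys f \<subseteq> A}"
    using keys_add[of x y] by auto
qed simp

lemma linear_extension_superset: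
  assumes "finite A" "keys v \<subseteq> A"
  shows "linear_extension g v = (\<Sum>x\<in>A. rat_scale (lookup v x) (g x))"
  unfolding linear_extension_def
  by (rule sum.mono_neutral_left) (use assms in \<open>auto simp: in_keys_iff\<close>)

lemma linear_extension_single [simp]:
  "linear_extension g (single x c) = rat_scale c (g x)"
  by (cases "c = 0") (simp_all add: linear_extension_def)

lemma linear_extension_add:
  "linear_extension g (v + w) = linear_extension g v + linear_extension g w"
proof -
  let ?A = "keys v \<union> keys w"
  have "linear_extension g u = (\<Sum>x\<in>?A. rat_scale (lookup u x) (g x))"
    if "u \<in> {v, w, v + w}" for u
    using that keys_add[of v w] by (intro linear_extension_superset) auto
  then show ?thesis
    by (simp add: lookup_add rat_free.scale_left_distrib sum.distrib)
qed

lemma linear_extension_scale: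
  "linear_extension g (rat_scale c v) = rat_scale c (linear_extension g v)"
proof -
  have "linear_extension g (rat_scale c v) =
      (\<Sum>x\<in>keys v. rat_scale (lookup (rat_scale c v) x) (g x))"
    using keys_rat_scale[of c v] by (intro linear_extension_superset) auto
  then show ?thesis
    by (simp add: linear_extension_def lookup_rat_scale rat_free.scale_sum_right)
qed

interpretation linear_extension:
  Vector_Spaces.linear rat_scale rat_scale "linear_extension g" for g :: "'a \<Rightarrow> ('b \<Rightarrow>\<^sub>0 rat)"
  by unfold_locales (simp_all add: linear_extension_add linear_extension_scale)

lemma linear_extension_cong:
  "(\<And>x. x \<in> keys v \<Longrightarrow> g x = h x) \<Longrightarrow> linear_extension g v = linear_extension h v"
  by (simp add: linear_extension_def)

lemma linear_extension_of_single [simp]: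
  "linear_extension (\<lambda>x. single x 1) v = v"
proof (rule poly_mapping_eqI)
  fix k
  show "lookup (linear_extension (\<lambda>x. single x 1) v) k =
      lookup v k"
    by (auto simp: linear_extension_def lookup_sum lookup_single when_def in_keys_iff)
qed

lemma linear_extension_linear:
  assumes "rat_linear h"
  shows "h (linear_extension g v) = linear_extension (h \<circ> g) v"
proof -
  interpret h: Vector_Spaces.linear rat_scale rat_scale h
    by (rule assms)
  show ?thesis
    by (simp add: linear_extension_def h.sum h.scale)
qed

lemmas linear_extension_compose =
  linear_extension_linear[OF linear_extension.linear_axioms]

lemma keys_linear_extension:
  "keys (linear_extension g v) \<subseteq> (\<Union>x\<in>keys v. keys (g x))"
proof -
  have "keys (linear_extension g v) \<subseteq>
      (\<Union>x\<in>keys v. keys (rat_scale (lookup v x) (g x)))"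
    unfolding linear_extension_def by (rule keys_sum)
  then show ?thesis
    using keys_rat_scale[of "lookup v x" "g x" for x]
    by (meson SUP_subset_mono order_refl order_trans)
qed

subsection \<open>Pushforward along a map of bases\<close>

text \<open>Induced chain maps, counting points by component, row and column sums of matrices, and
  the actions of permutations are all instances.\<close>

definition push :: "('a \<Rightarrow> 'b) \<Rightarrow> ('a \<Rightarrow>\<^sub>0 rat) \<Rightarrow> ('b \<Rightarrow>\<^sub>0 rat)"
  where "push g = linear_extension (\<lambda>x. single (g x) 1)"

interpretation push: Vector_Spaces.linear rat_scale rat_scale "push g" for g :: "'a \<Rightarrow> 'b"
  unfolding push_def by (rule linear_extension.linear_axioms)

lemma push_single [simp]: "push g (single x c) = single (g x) c"
  by (simp add: push_def)

lemma push_compose: "push h (push g v) = push (h \<circ> g) v"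
  by (simp add: push_def linear_extension_compose comp_def)

lemma push_cong: "(\<And>x. x \<in> keys v \<Longrightarrow> g x = h x) \<Longrightarrow> push g v = push h v"
  unfolding push_def by (rule linear_extension_cong) simp

lemma push_id: "(\<And>x. x \<in> keys v \<Longrightarrow> g x = x) \<Longrightarrow> push g v = v"
  using push_cong[of v g "\<lambda>x. x"] by (simp add: push_def)

lemma lookup_push:
  "lookup (push g v) y = (\<Sum>x\<in>{x \<in> keys v. g x = y}. lookup v x)"
  by (simp add: push_def linear_extension_def lookup_sum lookup_single when_def
      if_distrib sum.If_cases Int_def cong: if_cong)

lemma lookup_push_superset:
  assumes "finite A" "keys v \<subseteq> A"
  shows "lookup (push g v) y = (\<Sum>x\<in>{x \<in> A. g x = y}. lookup v x)"
  unfolding lookup_push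
  by (rule sum.mono_neutral_left) (use assms in \<open>auto simp: in_keys_iff\<close>)

lemma keys_push: "keys (push g v) \<subseteq> g ` keys v"
  unfolding push_def using keys_linear_extension[of "\<lambda>x. single (g x) 1" v] by auto

text \<open>Pushing forward along the inverse of \<open>g\<close> on \<open>A\<close> undoes
  \<open>push g\<close>.\<close>

lemma push_inj_on:
  assumes "inj_on g A" "keys v \<subseteq> A" "keys w \<subseteq> A" "push g v = push g w"
  shows "v = w"
proof -
  have "push (the_inv_into A g) (push g u) = u" if "keys u \<subseteq> A" for u
    unfolding push_compose by (rule push_id) (use that assms(1) in \<open>auto simp: the_inv_into_f_f\<close>)
  then show ?thesis
    using assms by metis
qed

lemma rat_chain_map_eq_push: "rat_chain_map p g = push (simplex_map p g)"
  by (simp add: rat_chain_map_def push_def)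

subsection \<open>Rational chains as multiples of integral chains\<close>

definition rat_of_frag :: "('a \<Rightarrow>\<^sub>0 int) \<Rightarrow> ('a \<Rightarrow>\<^sub>0 rat)"
  where "rat_of_frag = Poly_Mapping.map of_int"

lemma lookup_rat_of_frag [simp]:
  "lookup (rat_of_frag c) x = of_int (lookup c x)"
  by (simp add: rat_of_frag_def Poly_Mapping.map.rep_eq when_def)

lemma keys_rat_of_frag [simp]: "keys (rat_of_frag c) = keys c"
  by (auto simp: in_keys_iff)

lemma rat_of_frag_simps [simp]:
  "rat_of_frag 0 = 0"
  "rat_of_frag (frag_of x) = single x 1"
  "rat_of_frag (a + b) = rat_of_frag a + rat_of_frag b"
  "rat_of_frag (a - b) = rat_of_frag a - rat_of_frag b"
  "rat_of_frag (- a) = - rat_of_frag a"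
  "rat_of_frag (frag_cmul k a) = rat_scale (of_int k) (rat_of_frag a)"
  by (auto intro!: poly_mapping_eqI
      simp: lookup_add lookup_minus lookup_rat_scale lookup_single when_def)

lemma rat_of_frag_eq_iff [simp]: "rat_of_frag a = rat_of_frag b \<longleftrightarrow> a = b"
  by (simp add: poly_mapping_eq_iff fun_eq_iff)

lemma rat_of_frag_sum: "rat_of_frag (sum f I) = (\<Sum>i\<in>I. rat_of_frag (f i))"
  by (induction I rule: infinite_finite_induct) auto

lemma rat_of_frag_extend:
  "rat_of_frag (frag_extend g c) = linear_extension (\<lambda>x. rat_of_frag (g x)) (rat_of_frag c)"
  by (simp add: frag_extend_def linear_extension_def rat_of_frag_sum)

lemma rat_of_frag_chain_map: "rat_of_frag (chain_map p g c) = rat_chain_map p g (rat_of_frag c)"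
  by (simp add: chain_map_def rat_chain_map_def rat_of_frag_extend)

lemma rat_of_frag_boundary: "rat_of_frag (chain_boundary p c) = rat_boundary p (rat_of_frag c)"
  by (simp add: chain_boundary_def rat_boundary_def rat_of_frag_extend rat_of_frag_sum)

lemma rat_of_frag_in_rat_chains [simp]: "rat_of_frag c \<in> rat_chains p X \<longleftrightarrow> singular_chain p X c"
  by (simp add: rat_chains_def singular_chain_def)

text \<open>The product of the denominators of the finitely many nonzero coefficients serves as
  \<open>N\<close>.\<close>

lemma clear_denominators:
  obtains N :: int and d where "N \<noteq> 0" "rat_scale (of_int N) c = rat_of_frag d"
    "keys d = keys c"
proof -
  define den where "den x = snd (quotient_of (lookup c x))" for x
  define N where "N = (\<Prod>x\<in>keys c. den x)"
  have den: "den x > 0" for x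
    by (simp add: den_def quotient_of_denom_pos')
  have N: "N \<noteq> 0"
    using den by (simp add: N_def prod_zero_iff less_imp_neq[symmetric])
  have int: "\<exists>k. of_int N * lookup c x = of_int k" for x
  proof (cases "x \<in> keys c")
    case True
    define m where "m = fst (quotient_of (lookup c x))"
    have "lookup c x = of_int m / of_int (den x)"
      unfolding m_def den_def by (rule quotient_of_div) simp
    moreover obtain r where "N = den x * r"
      using True unfolding N_def by (metis finite_keys prod.remove)
    ultimately have "of_int N * lookup c x = of_int (r * m)"
      using den[of x] by simp
    then show ?thesis ..
  next
    case False
    then show ?thesis
      by (auto simp: in_keys_iff intro: exI[of _ 0])
  qed
  \<comment> \<open>The products are integers by \<open>int\<close>; the floor only changes their
    type.\<close>
  define d where "d = (\<Sum>x\<in>keys c.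
      frag_cmul \<lfloor>of_int N * lookup c x\<rfloor> (frag_of x))"
  have "rat_scale (of_int N) c = rat_of_frag d"
  proof (rule poly_mapping_eqI)
    fix x
    have "lookup (rat_of_frag d) x =
        (if x \<in> keys c then of_int \<lfloor>of_int N * lookup c x\<rfloor> else 0)"
      by (simp add: d_def lookup_sum lookup_single when_def if_distrib cong: if_cong)
    also have "\<dots> = of_int N * lookup c x"
      using int[of x] by (auto simp: in_keys_iff)
    finally show "lookup (rat_scale (of_int N) c) x =
        lookup (rat_of_frag d) x"
      by (simp add: lookup_rat_scale)
  qed
  moreover from this have "keys d = keys c"
    using N by (metis keys_rat_of_frag keys_rat_scale_eq of_int_eq_0_iff)
  ultimately show thesis
    using that N by blast
qed

text \<open>The means of transferring facts about integral chains: the factor \<open>q\<close> can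
  be pulled out of boundaries and chain maps, and division by it is possible.\<close>

lemma rat_chain_cases:
  assumes "c \<in> rat_chains p X"
  obtains q d where "q \<noteq> 0" "c = rat_scale q (rat_of_frag d)" "singular_chain p X d"
proof -
  obtain N d where N: "N \<noteq> 0" "rat_scale (of_int N) c = rat_of_frag d"
    "keys d = keys c"
    by (rule clear_denominators)
  show thesis
  proof
    show "inverse (of_int N) \<noteq> (0 :: rat)"
      using N by simp
    show "c = rat_scale (inverse (of_int N)) (rat_of_frag d)"
      using N(1) by (simp flip: N(2))
    show "singular_chain p X d"
      using assms N(3) by (simp add: rat_chains_def singular_chain_def)
  qed
qed

section \<open>The rational singular chain complex\<close>

lemma subspace_rat_chains: "rat_free.subspace (rat_chains p X)"
  unfolding rat_chains_def by (rule subspace_keys)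

lemma rat_boundary_linear: "rat_linear (rat_boundary p)"
proof (cases "p = 0")
  case True
  show ?thesis
    unfolding rat_boundary_def by unfold_locales (simp_all add: True)
next
  case False
  then show ?thesis
    by (simp add: rat_boundary_def linear_extension.linear_axioms)
qed

interpretation rat_boundary: Vector_Spaces.linear rat_scale rat_scale "rat_boundary p"
  by (rule rat_boundary_linear)

interpretation rat_chain_map: Vector_Spaces.linear rat_scale rat_scale "rat_chain_map p g" for g
  unfolding rat_chain_map_eq_push by (rule push.linear_axioms)

lemma rat_chains_subtopology: "rat_chains p (subtopology X S) \<subseteq> rat_chains p X"
  by (auto simp: rat_chains_def singular_simplex_subtopology)

lemma rat_chains_Int:
  "rat_chains p (subtopology X S) \<inter> rat_chains p (subtopology X T) = rat_chains p (subtopology X (S \<inter> T))"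
  by (force simp: rat_chains_def singular_simplex_subtopology)

lemma rat_boundary_in_rat_chains:
  assumes "c \<in> rat_chains p X"
  shows "rat_boundary p c \<in> rat_chains (p - Suc 0) X"
  using assms
proof (rule rat_chain_cases)
  fix q d
  assume "c = rat_scale q (rat_of_frag d)" "singular_chain p X d"
  then show ?thesis
    by (simp add: rat_boundary.scale rat_free.subspace_scale[OF subspace_rat_chains]
        singular_chain_boundary flip: rat_of_frag_boundary)
qed

lemma rat_boundary_boundary:
  assumes "c \<in> rat_chains (Suc p) X"
  shows "rat_boundary p (rat_boundary (Suc p) c) = 0"
  using assms
proof (rule rat_chain_cases)
  fix q d
  assume "c = rat_scale q (rat_of_frag d)" "singular_chain (Suc p) X d"
  then show ?thesis
    using chain_boundary_boundary[of "Suc p" X d]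
    by (simp add: rat_boundary.scale flip: rat_of_frag_boundary)
qed

lemma rat_boundary_chain_map:
  assumes "c \<in> rat_chains p X"
  shows "rat_boundary p (rat_chain_map p g c) = rat_chain_map (p - Suc 0) g (rat_boundary p c)"
  using assms
proof (rule rat_chain_cases)
  fix q d
  assume "c = rat_scale q (rat_of_frag d)" "singular_chain p X d"
  then show ?thesis
    using chain_boundary_chain_map[of p X d g]
    by (simp add: rat_boundary.scale rat_chain_map.scale
        flip: rat_of_frag_boundary rat_of_frag_chain_map)
qed

lemma rat_chain_map_in_rat_chains:
  assumes "c \<in> rat_chains p X" "continuous_map X Y g"
  shows "rat_chain_map p g c \<in> rat_chains p Y"
  using keys_push[of "simplex_map p g" c] assms singular_simplex_simplex_map
  by (fastforce simp: rat_chains_def rat_chain_map_eq_push)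

lemma rat_chain_map_cong:
  assumes "c \<in> rat_chains p X" "\<And>x. x \<in> topspace X \<Longrightarrow> f x = g x"
  shows "rat_chain_map p f c = rat_chain_map p g c"
  unfolding rat_chain_map_eq_push
  by (rule push_cong) (use assms in \<open>auto simp: rat_chains_def intro: simplex_map_eq\<close>)

lemma rat_chain_map_ident:
  assumes "c \<in> rat_chains p X" "\<And>x. x \<in> topspace X \<Longrightarrow> g x = x"
  shows "rat_chain_map p g c = c"
  unfolding rat_chain_map_eq_push
  by (rule push_id) (use assms in \<open>auto simp: rat_chains_def intro: simplex_map_id_gen\<close>)

lemma rat_chain_map_compose:
  "rat_chain_map p h (rat_chain_map p g c) = rat_chain_map p (h \<circ> g) c"
  by (simp add: rat_chain_map_eq_push push_compose simplex_map_compose)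

text \<open>Homotopic maps induce the same map on integral homology. The bounding chain found for an
  integral multiple of \<open>c\<close> is scaled back.\<close>

lemma rat_chain_map_homotopic:
  assumes "homotopic_with (\<lambda>_. True) X Y f g" "c \<in> rat_cycles p X"
  shows "\<exists>d\<in>rat_chains (Suc p) Y. rat_chain_map p f c - rat_chain_map p g c = rat_boundary (Suc p) d"
proof -
  have "c \<in> rat_chains p X"
    using assms by (simp add: rat_cycles_def)
  then obtain q d where q: "q \<noteq> 0" "c = rat_scale q (rat_of_frag d)" "singular_chain p X d"
    by (rule rat_chain_cases)
  have "rat_of_frag (chain_boundary p d) = rat_of_frag 0"
    using assms q by (simp add: rat_cycles_def rat_boundary.scale rat_of_frag_boundary)
  then have "chain_boundary p d = 0"
    by (simp only: rat_of_frag_eq_iff)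
  then have "singular_relcycle p X {} d"
    using q by (simp add: singular_cycle)
  then have "homologous_rel p Y {} (chain_map p f d) (chain_map p g d)"
    using assms(1) by (intro homotopic_imp_homologous_rel_chain_maps) auto
  then obtain e where "singular_chain (Suc p) Y e"
    "chain_boundary (Suc p) e = chain_map p f d - chain_map p g d"
    by (auto simp: homologous_rel_def singular_boundary)
  then have "rat_scale q (rat_of_frag e) \<in> rat_chains (Suc p) Y"
    "rat_chain_map p f c - rat_chain_map p g c = rat_boundary (Suc p) (rat_scale q (rat_of_frag e))"
    by (simp_all add: q rat_boundary.scale rat_chain_map.scale
        rat_free.subspace_scale[OF subspace_rat_chains] rat_free.scale_right_diff_distrib
        flip: rat_of_frag_boundary rat_of_frag_chain_map)
  then show ?thesis
    by blast
qed

subsection \<open>Subquotients of free spaces as modules\<close>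

lemma rat_field_simps [simp]:
  "carrier rat_field = UNIV" "x \<otimes>\<^bsub>rat_field\<^esub> y = x * y" "x \<oplus>\<^bsub>rat_field\<^esub> y = x + y"
  "\<one>\<^bsub>rat_field\<^esub> = 1" "\<zero>\<^bsub>rat_field\<^esub> = 0"
  by (simp_all add: rat_field_def)

lemma mem_coset_iff: "x \<in> coset B z \<longleftrightarrow> x - z \<in> B"
  unfolding coset_def image_iff by (metis add_diff_cancel_left' add.commute diff_add_cancel)

lemma coset_self: "rat_free.subspace B \<Longrightarrow> z \<in> coset B z"
  by (simp add: mem_coset_iff rat_free.subspace_0)

lemma coset_eq_iff:
  assumes "rat_free.subspace B"
  shows "coset B x = coset B y \<longleftrightarrow> x - y \<in> B"
proof
  show "x - y \<in> B" if "coset B x = coset B y"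
    using coset_self[OF assms, of x] that by (simp add: mem_coset_iff)
  assume *: "x - y \<in> B"
  show "coset B x = coset B y"
  proof (rule Set.set_eqI)
    fix z
    have "z - y = (z - x) + (x - y)" "z - x = (z - y) - (x - y)"
      by simp_all
    then show "z \<in> coset B x \<longleftrightarrow> z \<in> coset B y"
      unfolding mem_coset_iff
      using * rat_free.subspace_add[OF assms] rat_free.subspace_diff[OF assms] by metis
  qed
qed

lemma coset_zero: "coset B 0 = B"
  by (simp add: coset_def)

lemma coset_sum:
  assumes "rat_free.subspace B"
  shows "{x + y | x y. x \<in> coset B z \<and> y \<in> coset B w} = coset B (z + w)"
proof (intro Set.set_eqI iffI)
  fix x assume "x \<in> {x + y | x y. x \<in> coset B z \<and> y \<in> coset B w}"
  then obtain a b where "a \<in> B" "b \<in> B" "x = (z + a) + (w + b)"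
    by (auto simp: coset_def)
  then have "x = (z + w) + (a + b)" "a + b \<in> B"
    using rat_free.subspace_add[OF assms] by (simp_all add: algebra_simps)
  then show "x \<in> coset B (z + w)"
    by (auto simp: coset_def)
next
  fix x assume "x \<in> coset B (z + w)"
  then obtain b where "b \<in> B" "x = (z + b) + w"
    by (auto simp: coset_def algebra_simps)
  then show "x \<in> {x + y | x y. x \<in> coset B z \<and> y \<in> coset B w}"
    using coset_self[OF assms, of w] by (auto simp: coset_def)
qed

text \<open>The image of \<open>B\<close> is absorbed by the added \<open>B'\<close>. Taking for
  \<open>h\<close> an induced chain map or multiplication by a scalar (0 included) shows that the
  operations on quotients can be computed on representatives.\<close>

lemma coset_image_sum:
  assumes "rat_free.subspace B" "rat_free.subspace B'" "rat_linear h" "h ` B \<subseteq> B'"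
  shows "{h x + b | x b. x \<in> coset B z \<and> b \<in> B'} = coset B' (h z)"
proof (intro Set.set_eqI iffI)
  interpret h: Vector_Spaces.linear rat_scale rat_scale h
    by (rule assms)
  {
    fix x assume "x \<in> {h x + b | x b. x \<in> coset B z \<and> b \<in> B'}"
    then obtain a b where "a \<in> B" "b \<in> B'" "x = h (z + a) + b"
      by (auto simp: coset_def)
    then have "x = h z + (h a + b)" "h a + b \<in> B'"
      using rat_free.subspace_add[OF assms(2)] assms(4) by (auto simp: h.add)
    then show "x \<in> coset B' (h z)"
      by (auto simp: coset_def)
  next
    fix x assume "x \<in> coset B' (h z)"
    then show "x \<in> {h x + b | x b. x \<in> coset B z \<and> b \<in> B'}"
      using coset_self[OF assms(1), of z] by (auto simp: coset_def)
  }
qed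

lemma coset_scale:
  assumes "rat_free.subspace B"
  shows "{rat_scale c x + b | x b. x \<in> coset B z \<and> b \<in> B} = coset B (rat_scale c z)"
  using assms rat_free.subspace_scale[OF assms]
  by (intro coset_image_sum rat_free.linear_scale_self) auto

lemma quotient_of_free_simps:
  assumes "rat_free.subspace B"
  shows "carrier (quotient_of_free Z B) = coset B ` Z"
    "\<zero>\<^bsub>quotient_of_free Z B\<^esub> = coset B 0"
    "coset B z \<oplus>\<^bsub>quotient_of_free Z B\<^esub> coset B w = coset B (z + w)"
    "c \<odot>\<^bsub>quotient_of_free Z B\<^esub> coset B z = coset B (rat_scale c z)"
  by (simp_all add: quotient_of_free_def coset_zero coset_sum coset_scale assms)

lemma module_quotient_of_free:
  assumes Z: "rat_free.subspace Z" and B: "rat_free.subspace B"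
  shows "Module.module rat_field (quotient_of_free Z B)"
proof (rule moduleI)
  show "cring rat_field"
    using field_rat_field by (simp add: field.axioms(1) domain.axioms(1))
  note simps = quotient_of_free_simps[OF B, where Z = Z]
  note closed = rat_free.subspace_0[OF Z] rat_free.subspace_add[OF Z] rat_free.subspace_scale[OF Z]
    rat_free.subspace_neg[OF Z]
  show "abelian_group (quotient_of_free Z B)"
  proof (rule abelian_groupI)
    fix x assume "x \<in> carrier (quotient_of_free Z B)"
    then obtain z where z: "z \<in> Z" "x = coset B z"
      by (auto simp: simps)
    then show "\<exists>y\<in>carrier (quotient_of_free Z B). y \<oplus>\<^bsub>quotient_of_free Z B\<^esub> x = \<zero>\<^bsub>quotient_of_free Z B\<^esub>"
      by (intro bexI[of _ "coset B (- z)"]) (auto simp: simps closed)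
  qed (use closed in \<open>auto simp: simps add_ac\<close>)
qed (use rat_free.subspace_scale[OF Z] in
    \<open>auto simp: quotient_of_free_simps[OF B] rat_free.scale_left_distrib rat_free.scale_right_distrib\<close>)

lemma subspace_of_free_simps [simp]:
  "carrier (subspace_of_free S) = S" "x \<oplus>\<^bsub>subspace_of_free S\<^esub> y = x + y"
  "c \<odot>\<^bsub>subspace_of_free S\<^esub> x = rat_scale c x" "\<zero>\<^bsub>subspace_of_free S\<^esub> = 0"
  by (simp_all add: subspace_of_free_def)

lemma linear_mapsD:
  assumes "h \<in> linear_maps V W" "x \<in> carrier V"
  shows "h x \<in> carrier W"
    "y \<in> carrier V \<Longrightarrow> h (x \<oplus>\<^bsub>V\<^esub> y) = h x \<oplus>\<^bsub>W\<^esub> h y"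
    "h (c \<odot>\<^bsub>V\<^esub> x) = c \<odot>\<^bsub>W\<^esub> h x"
  using assms by (auto simp: linear_maps_def)

text \<open>The image of \<open>\<phi>\<close> lies in the span of the finitely many unit vectors
  indexed by \<open>A\<close>, so it has a finite basis; the preimages of that basis span
  \<open>V\<close>.\<close>

lemma finite_dimensional_if_inj:
  assumes "Module.module rat_field V"
    and \<phi>: "\<phi> \<in> linear_maps V (subspace_of_free S)" and inj: "inj_on \<phi> (carrier V)"
    and A: "finite A" "\<And>v. v \<in> carrier V \<Longrightarrow> keys (\<phi> v) \<subseteq> A"
  shows "finite_dimensional V"
proof -
  interpret V: Module.module rat_field V
    by (rule assms)
  note lin = linear_mapsD[OF \<phi>, simplified]
  have zero: "\<phi> \<zero>\<^bsub>V\<^esub> = 0"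
    using lin(2)[of "\<zero>\<^bsub>V\<^esub>" "\<zero>\<^bsub>V\<^esub>"] by simp
  define W where "W = \<phi> ` carrier V"
  have "rat_free.subspace W"
    unfolding rat_free.subspace_def
  proof (intro conjI ballI allI)
    show "0 \<in> W"
      using zero unfolding W_def by (metis V.zero_closed image_eqI)
    show "x + y \<in> W" if "x \<in> W" "y \<in> W" for x y
    proof -
      obtain v w where "v \<in> carrier V" "w \<in> carrier V" "x = \<phi> v" "y = \<phi> w"
        using \<open>x \<in> W\<close> \<open>y \<in> W\<close> by (auto simp: W_def)
      then have "x + y = \<phi> (v \<oplus>\<^bsub>V\<^esub> w)" "v \<oplus>\<^bsub>V\<^esub> w \<in> carrier V"
        by (simp_all add: lin)
      then show ?thesis
        by (auto simp: W_def)
    qed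
    show "rat_scale c x \<in> W" if "x \<in> W" for c x
    proof -
      obtain v where "v \<in> carrier V" "x = \<phi> v"
        using \<open>x \<in> W\<close> by (auto simp: W_def)
      then have "rat_scale c x = \<phi> (c \<odot>\<^bsub>V\<^esub> v)" "c \<odot>\<^bsub>V\<^esub> v \<in> carrier V"
        by (simp_all add: lin V.smult_closed)
      then show ?thesis
        by (auto simp: W_def)
    qed
  qed
  obtain B where B: "B \<subseteq> W" "rat_free.independent B" "W \<subseteq> rat_free.span B"
    by (rule rat_free.maximal_independent_subset)
  have "v \<in> rat_free.span ((\<lambda>a. single a 1) ` A)" if "v \<in> W" for v
  proof -
    have "keys v \<subseteq> A"
      using that A by (auto simp: W_def)
    then have "v = (\<Sum>a\<in>A. rat_scale (lookup v a) (single a 1))"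
      using linear_extension_superset[OF A(1), of v "\<lambda>a. single a 1"] by simp
    moreover have "(\<Sum>a\<in>A. rat_scale (k a) (single a 1)) \<in>
        rat_free.span ((\<lambda>a. single a 1) ` A)" for k
      by (rule rat_free.span_sum, rule rat_free.span_scale, rule rat_free.span_base, rule imageI)
    ultimately show ?thesis
      by metis
  qed
  then have "B \<subseteq> rat_free.span ((\<lambda>a. single a 1) ` A)"
    using B(1) by (meson subsetD subsetI)
  then have "finite B"
    using rat_free.independent_span_bound[OF finite_imageI[OF A(1)] B(2)] by blast
  define B' where "B' = inv_into (carrier V) \<phi> ` B"
  have "\<phi> ` B' = B"
    unfolding B'_def using B(1) by (intro image_inv_into_cancel[of _ _ W]) (simp_all add: W_def)
  moreover have "B' \<subseteq> carrier V"
    unfolding B'_def using B(1) by (auto simp: W_def intro!: inv_into_into)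
  ultimately have B': "finite B'" "B' \<subseteq> carrier V" "bij_betw \<phi> B' B"
    using \<open>finite B\<close> inj by (auto simp: B'_def bij_betw_def intro: inj_on_subset)
  \<comment> \<open>Linear combinations in the record \<open>V\<close> turn into ordinary sums under
    \<open>\<phi>\<close>, so coefficients can be found in the image.\<close>
  have sum: "\<phi> (\<Oplus>\<^bsub>V\<^esub>b\<in>F. c b \<odot>\<^bsub>V\<^esub> b) = (\<Sum>b\<in>F. rat_scale (c b) (\<phi> b))"
    if "finite F" "F \<subseteq> carrier V" for c F
    using that
  proof (induction F)
    case (insert b F)
    have "(\<lambda>b. c b \<odot>\<^bsub>V\<^esub> b) \<in> F \<rightarrow> carrier V" "c b \<odot>\<^bsub>V\<^esub> b \<in> carrier V"
      using insert.prems by (auto intro!: V.smult_closed)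
    then show ?case
      using insert by (simp add: V.finsum_insert lin V.finsum_closed)
  qed (simp add: zero)
  have "\<exists>c. v = (\<Oplus>\<^bsub>V\<^esub>b\<in>B'. c b \<odot>\<^bsub>V\<^esub> b)" if "v \<in> carrier V" for v
  proof -
    have "\<phi> v \<in> rat_free.span B"
      using that B by (auto simp: W_def)
    then obtain r where r: "\<phi> v = (\<Sum>b\<in>B. rat_scale (r b) b)"
      using rat_free.span_finite[OF \<open>finite B\<close>] by auto
    also have "\<dots> = (\<Sum>b\<in>B'. rat_scale (r (\<phi> b)) (\<phi> b))"
      by (rule sum.reindex_bij_betw[OF B'(3), symmetric])
    also have "\<dots> = \<phi> (\<Oplus>\<^bsub>V\<^esub>b\<in>B'. r (\<phi> b) \<odot>\<^bsub>V\<^esub> b)"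
      using B' by (intro sum[symmetric]) auto
    finally have "\<phi> v = \<phi> (\<Oplus>\<^bsub>V\<^esub>b\<in>B'. r (\<phi> b) \<odot>\<^bsub>V\<^esub> b)" .
    moreover have "(\<Oplus>\<^bsub>V\<^esub>b\<in>B'. r (\<phi> b) \<odot>\<^bsub>V\<^esub> b) \<in> carrier V"
      using B' by (intro V.finsum_closed) (auto intro!: V.smult_closed)
    ultimately show ?thesis
      using inj that by (metis inj_onD)
  qed
  then show ?thesis
    unfolding finite_dimensional_def using B' by blast
qed

subsection \<open>Functoriality of rational homology\<close>

lemma subspace_rat_cycles: "rat_free.subspace (rat_cycles p X)"
  using subspace_rat_chains[of p X]
  by (auto simp: rat_free.subspace_def rat_cycles_def rat_boundary.add rat_boundary.scale
      rat_boundary.zero)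

lemma subspace_rat_boundaries: "rat_free.subspace (rat_boundaries p X)"
  unfolding rat_boundaries_def by (rule rat_boundary.subspace_image[OF subspace_rat_chains])

lemma rat_boundaries_subset_rat_cycles: "rat_boundaries p X \<subseteq> rat_cycles p X"
  using rat_boundary_in_rat_chains[of _ "Suc p" X] rat_boundary_boundary[of _ p X]
  by (auto simp: rat_boundaries_def rat_cycles_def)

lemma rat_homology_simps:
  "carrier (rat_homology p X) = coset (rat_boundaries p X) ` rat_cycles p X"
  "coset (rat_boundaries p X) z \<oplus>\<^bsub>rat_homology p X\<^esub> coset (rat_boundaries p X) w =
    coset (rat_boundaries p X) (z + w)"
  "c \<odot>\<^bsub>rat_homology p X\<^esub> coset (rat_boundaries p X) z = coset (rat_boundaries p X) (rat_scale c z)"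
  unfolding rat_homology_def by (simp_all add: quotient_of_free_simps subspace_rat_boundaries)

lemmas rat_class_eq_iff = coset_eq_iff[OF subspace_rat_boundaries]

lemma module_rat_homology: "Module.module rat_field (rat_homology p X)"
  unfolding rat_homology_def
  by (rule module_quotient_of_free[OF subspace_rat_cycles subspace_rat_boundaries])

lemma rat_homology_map_coset:
  assumes "continuous_map X Y g"
  shows "rat_homology_map p Y g (coset (rat_boundaries p X) z) =
    coset (rat_boundaries p Y) (rat_chain_map p g z)"
  unfolding rat_homology_map_def
proof (rule coset_image_sum[OF subspace_rat_boundaries subspace_rat_boundaries
      rat_chain_map.linear_axioms])
  show "rat_chain_map p g ` rat_boundaries p X \<subseteq> rat_boundaries p Y"
    using rat_boundary_chain_map[of _ "Suc p" X g] rat_chain_map_in_rat_chains[OF _ assms]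
    by (force simp: rat_boundaries_def)
qed

lemma rat_chain_map_in_rat_cycles:
  assumes "continuous_map X Y g" "z \<in> rat_cycles p X"
  shows "rat_chain_map p g z \<in> rat_cycles p Y"
  using assms rat_boundary_chain_map[of z p X g] rat_chain_map_in_rat_chains[of z p X Y g]
  by (simp add: rat_cycles_def rat_chain_map.zero)

lemma rat_homology_map_linear:
  assumes "continuous_map X Y g"
  shows "rat_homology_map p Y g \<in> linear_maps (rat_homology p X) (rat_homology p Y)"
  unfolding linear_maps_def
  using rat_chain_map_in_rat_cycles[OF assms]
  by (auto simp: rat_homology_simps rat_homology_map_coset[OF assms] rat_chain_map.add rat_chain_map.scale)

lemma compose_FI_hom:
  assumes "f \<in> FI_hom l m" "g \<in> FI_hom m n"
  shows "compose {1..l} g f \<in> FI_hom l n"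
proof -
  have f: "f \<in> {1..l} \<rightarrow> {1..m}" "inj_on f {1..l}" and g: "g \<in> {1..m} \<rightarrow> {1..n}" "inj_on g {1..m}"
    using assms by (simp_all add: FI_hom_def PiE_def)
  have "inj_on (compose {1..l} g f) {1..l} \<longleftrightarrow> inj_on (g \<circ> f) {1..l}"
    by (rule inj_on_cong) (simp add: compose_def)
  also have "\<dots>"
    using f g by (intro comp_inj_on) (auto intro: inj_on_subset)
  finally have "inj_on (compose {1..l} g f) {1..l}" .
  moreover have "compose {1..l} g f \<in> {1..l} \<rightarrow> {1..n}"
    using f g by (intro funcset_compose)
  ultimately show ?thesis
    by (simp add: FI_hom_def PiE_def compose_extensional)
qed

text \<open>The laws for \<open>F\<close> are asked only on points of the spaces, because
  \<open>star_map\<close> for the identity erases coordinates outside \<open>{1..n}\<close>. This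
  suffices since simplices of chains take their values in the spaces.\<close>

lemma FI_module_rat_homology:
  assumes cont: "\<And>m n f. f \<in> FI_hom m n \<Longrightarrow> continuous_map (X m) (X n) (F m f)"
    and id: "\<And>n x. x \<in> topspace (X n) \<Longrightarrow> F n (\<lambda>i\<in>{1..n}. i) x = x"
    and comp: "\<And>l m n f g x. \<lbrakk>f \<in> FI_hom l m; g \<in> FI_hom m n; x \<in> topspace (X l)\<rbrakk> \<Longrightarrow>
      F l (compose {1..l} g f) x = F m g (F l f x)"
    and fin: "\<And>n. finite_dimensional (rat_homology p (X n))"
  shows "FI_module (\<lambda>n. rat_homology p (X n)) (\<lambda>m n f. rat_homology_map p (X n) (F m f))"
proof (rule FI_module.intro)
  fix n show "Module.module rat_field (rat_homology p (X n))"
    by (rule module_rat_homology)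
  show "finite_dimensional (rat_homology p (X n))"
    by (rule fin)
  have "(\<lambda>i\<in>{1..n}. i) \<in> FI_hom n n"
    by (auto simp: FI_hom_def inj_on_def)
  fix v assume "v \<in> carrier (rat_homology p (X n))"
  then obtain z where z: "z \<in> rat_cycles p (X n)" "v = coset (rat_boundaries p (X n)) z"
    by (auto simp: rat_homology_simps)
  have "rat_chain_map p (F n (\<lambda>i\<in>{1..n}. i)) z = z"
    using z id by (intro rat_chain_map_ident) (auto simp: rat_cycles_def)
  then show "rat_homology_map p (X n) (F n (\<lambda>i\<in>{1..n}. i)) v = v"
    using rat_homology_map_coset[OF cont[OF \<open>_ \<in> FI_hom n n\<close>]] z by simp
next
  fix m n f assume "f \<in> FI_hom m n"
  then show "rat_homology_map p (X n) (F m f) \<in> linear_maps (rat_homology p (X m)) (rat_homology p (X n))"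
    by (intro rat_homology_map_linear cont)
next
  fix l m n f g v
  assume f: "f \<in> FI_hom l m" and g: "g \<in> FI_hom m n" and "v \<in> carrier (rat_homology p (X l))"
  then obtain z where z: "z \<in> rat_cycles p (X l)" "v = coset (rat_boundaries p (X l)) z"
    by (auto simp: rat_homology_simps)
  have gf: "compose {1..l} g f \<in> FI_hom l n"
    by (rule compose_FI_hom[OF f g])
  have "rat_chain_map p (F l (compose {1..l} g f)) z = rat_chain_map p (F m g \<circ> F l f) z"
    using z comp[OF f g] by (intro rat_chain_map_cong) (auto simp: rat_cycles_def)
  then show "rat_homology_map p (X n) (F l (compose {1..l} g f)) v =
      rat_homology_map p (X n) (F m g) (rat_homology_map p (X m) (F l f) v)"
    using z by (simp del: One_nat_def add: rat_homology_map_coset[OF cont[OF gf]] rat_homology_map_coset[OF cont[OF f]]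
        rat_homology_map_coset[OF cont[OF g]] rat_chain_map_compose)
qed

subsection \<open>Spaces that contract onto a discrete set\<close>

text \<open>A vertex common to the standard simplices of all dimensions, at which the component of a
  simplex is read off.\<close>

definition zero_vertex :: "nat \<Rightarrow> real"
  where "zero_vertex = (\<lambda>j. if j = 0 then 1 else 0)"

lemma zero_vertex_in_standard_simplex [simp]: "zero_vertex \<in> standard_simplex p"
  by (simp add: zero_vertex_def)

lemma standard_simplex_0_eq: "standard_simplex 0 = {zero_vertex}"
  by (simp add: zero_vertex_def standard_simplex_0)

text \<open>On 0-chains this is the augmentation taken separately on every component, that is, the
  class in \<open>H_0\<close> when \<open>l\<close> names the components.\<close>

definition component_sum :: "('a \<Rightarrow> 'e) \<Rightarrow> 'a rat_chain \<Rightarrow> ('e \<Rightarrow>\<^sub>0 rat)"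
  where "component_sum l = push (\<lambda>s. l (s zero_vertex))"

interpretation component_sum: Vector_Spaces.linear rat_scale rat_scale "component_sum l" for l
  unfolding component_sum_def by (rule push.linear_axioms)

definition const_simplex :: "nat \<Rightarrow> 'a \<Rightarrow> (nat \<Rightarrow> real) \<Rightarrow> 'a"
  where "const_simplex p x = (\<lambda>_\<in>standard_simplex p. x)"

lemma singular_simplex_const_simplex: "x \<in> topspace X \<Longrightarrow> singular_simplex p X (const_simplex p x)"
  by (simp add: singular_simplex_def const_simplex_def)

lemma singular_face_const_simplex:
  "1 \<le> p \<Longrightarrow> k \<le> p \<Longrightarrow> singular_face p k (const_simplex p x) = const_simplex (p - Suc 0) x"
  by (auto simp: singular_face_def const_simplex_def simplical_face_in_standard_simplex fun_eq_iff
      restrict_def)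

text \<open>The three faces of a constant 2-simplex coincide and have the signs +, -, +. So a
  constant path bounds.\<close>

lemma rat_boundary_const_simplex:
  "rat_boundary (Suc (Suc 0)) (single (const_simplex (Suc (Suc 0)) x) 1) =
    single (const_simplex (Suc 0) x) 1"
  by (simp add: rat_boundary_def singular_face_const_simplex flip: single_add)

text \<open>The sets of points with a common label are open and contract to one point each;
  \<open>b\<close> selects that point, and \<open>label_base\<close> shows that it carries the right
  label.\<close>

definition contracts_to_discrete :: "'a topology \<Rightarrow> ('a \<Rightarrow> 'e) \<Rightarrow> ('e \<Rightarrow> 'a) \<Rightarrow> bool"
  where "contracts_to_discrete Y l b \<longleftrightarrow>
    continuous_map Y (discrete_topology UNIV) l \<and> homotopic_with (\<lambda>_. True) Y Y id (b \<circ> l)"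

text \<open>The standard simplex is connected, and a connected subset of a discrete space has at
  most one point.\<close>

lemma locally_constant_on_simplex:
  assumes "singular_simplex p Y s" "continuous_map Y (discrete_topology UNIV) l"
    and "x \<in> standard_simplex p" "y \<in> standard_simplex p"
  shows "l (s x) = l (s y)"
proof -
  have "continuous_map (subtopology (powertop_real UNIV) (standard_simplex p)) (discrete_topology UNIV) (l \<circ> s)"
    using assms by (auto simp: singular_simplex_def intro: continuous_map_compose)
  moreover have "connectedin (subtopology (powertop_real UNIV) (standard_simplex p)) (standard_simplex p)"
    using connectedin_standard_simplex by (simp add: connectedin_subtopology)
  ultimately have "connectedin (discrete_topology UNIV) ((l \<circ> s) ` standard_simplex p)"
    by (rule connectedin_continuous_map_image)
  then show ?thesis
    using assms by (auto simp: connectedin_discrete_topology)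
qed

context
  fixes Y :: "'a topology" and l :: "'a \<Rightarrow> 'e" and b :: "'e \<Rightarrow> 'a"
  assumes contracts: "contracts_to_discrete Y l b"
begin

lemma locally_constant: "continuous_map Y (discrete_topology UNIV) l"
  using contracts by (simp add: contracts_to_discrete_def)

lemma base_in_topspace: "x \<in> topspace Y \<Longrightarrow> b (l x) \<in> topspace Y"
  using contracts homotopic_with_imp_continuous_maps[of "\<lambda>_. True" Y Y id "b \<circ> l"]
  by (auto simp: contracts_to_discrete_def continuous_map_def)

text \<open>Both ends of a path have the same label and enter with opposite signs.\<close>

lemma component_sum_boundary:
  assumes "c \<in> rat_chains (Suc 0) Y"
  shows "component_sum l (rat_boundary (Suc 0) c) = 0"
proof -
  define face where
    "face s = (\<Sum>k\<le>Suc 0. single (singular_face (Suc 0) k s) ((-1) ^ k) :: 'a rat_chain)"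
    for s
  have "component_sum l (rat_boundary (Suc 0) c) = linear_extension (component_sum l \<circ> face) c"
    by (simp add: rat_boundary_def face_def[abs_def] linear_extension_linear[OF component_sum.linear_axioms])
  also have "\<dots> = linear_extension (\<lambda>_. 0) c"
  proof (rule linear_extension_cong)
    fix s assume "s \<in> keys c"
    then have s: "singular_simplex (Suc 0) Y s"
      using assms by (auto simp: rat_chains_def)
    have "l (singular_face (Suc 0) k s zero_vertex) = l (s zero_vertex)" if "k \<le> Suc 0" for k
      unfolding singular_face_def
      using simplical_face_in_standard_simplex[of "Suc 0" k zero_vertex] that
      by (auto intro: locally_constant_on_simplex[OF s locally_constant])
    then show "(component_sum l \<circ> face) s = 0"
      by (simp add: face_def component_sum_def push.add push.neg flip: single_add)
  qed
  finally show ?thesis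
    by (simp add: linear_extension_def)
qed

lemma rat_homotopic_to_base:
  assumes "c \<in> rat_cycles p Y"
  shows "c - rat_chain_map p (b \<circ> l) c \<in> rat_boundaries p Y"
  using rat_chain_map_homotopic[of Y Y id "b \<circ> l" c p] contracts assms rat_chain_map_ident[of c p Y id]
  by (auto simp: contracts_to_discrete_def rat_boundaries_def rat_cycles_def)

text \<open>The chain is homologous to its image under \<open>b \<circ> l\<close>, which depends
  only on \<open>component_sum l c\<close>.\<close>

lemma rat_boundaries_0I:
  assumes "c \<in> rat_chains 0 Y" "component_sum l c = 0"
  shows "c \<in> rat_boundaries 0 Y"
proof -
  have "rat_chain_map 0 (b \<circ> l) c = push (\<lambda>e. const_simplex 0 (b e)) (component_sum l c)"
    unfolding component_sum_def push_compose rat_chain_map_eq_push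
    by (rule push_cong) (auto simp: simplex_map_def const_simplex_def standard_simplex_0_eq)
  also have "\<dots> = 0"
    by (simp add: assms push.zero)
  finally show ?thesis
    using rat_homotopic_to_base[of c 0] assms by (simp add: rat_cycles_def rat_boundary_def)
qed

text \<open>The cycle is homologous to its image under \<open>b \<circ> l\<close>. That image
  consists of constant paths, and these bound constant 2-simplices.\<close>

lemma rat_boundaries_1I:
  assumes "c \<in> rat_cycles (Suc 0) Y"
  shows "c \<in> rat_boundaries (Suc 0) Y"
proof -
  define d where "d = push (\<lambda>s. const_simplex (Suc (Suc 0)) (b (l (s zero_vertex)))) c"
  have c: "keys c \<subseteq> singular_simplex_set (Suc 0) Y"
    using assms by (simp add: rat_cycles_def rat_chains_def)
  have "s zero_vertex \<in> topspace Y" if "singular_simplex (Suc 0) Y s" for s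
    using that by (auto simp: singular_simplex_def continuous_map_def Pi_iff)
  then have "singular_simplex p Y (const_simplex p (b (l (s zero_vertex))))"
    if "singular_simplex (Suc 0) Y s" for p s
    using that by (intro singular_simplex_const_simplex base_in_topspace)
  then have "(\<lambda>s. const_simplex (Suc (Suc 0)) (b (l (s zero_vertex)))) ` keys c \<subseteq>
      singular_simplex_set (Suc (Suc 0)) Y"
    using c by auto
  then have "d \<in> rat_chains (Suc (Suc 0)) Y"
    by (simp add: rat_chains_def d_def order_trans[OF keys_push])
  have "rat_chain_map (Suc 0) (b \<circ> l) c = push (\<lambda>s. const_simplex (Suc 0) (b (l (s zero_vertex)))) c"
    unfolding rat_chain_map_eq_push
  proof (rule push_cong)
    fix s assume "s \<in> keys c"
    then have "singular_simplex (Suc 0) Y s"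
      using c by auto
    then have "l (s x) = l (s zero_vertex)" if "x \<in> standard_simplex (Suc 0)" for x
      using that by (intro locally_constant_on_simplex[OF _ locally_constant]) auto
    then show "simplex_map (Suc 0) (b \<circ> l) s = const_simplex (Suc 0) (b (l (s zero_vertex)))"
      unfolding simplex_map_def const_simplex_def by (intro restrict_ext) (metis comp_apply)
  qed
  also have "\<dots> = rat_boundary (Suc (Suc 0)) d"
    unfolding d_def push_def linear_extension_linear[OF rat_boundary.linear_axioms] comp_def
      rat_boundary_const_simplex ..
  also have "\<dots> \<in> rat_boundaries (Suc 0) Y"
    using \<open>d \<in> _\<close> by (auto simp: rat_boundaries_def)
  finally show ?thesis
    using rat_homotopic_to_base[OF assms] rat_free.subspace_add[OF subspace_rat_boundaries] by fastforce
qed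

text \<open>The points \<open>x\<close> and \<open>b (l x)\<close> are homologous as 0-cycles, and
  \<open>component_sum l\<close> vanishes on boundaries.\<close>

lemma label_base:
  assumes "x \<in> topspace Y"
  shows "l (b (l x)) = l x"
proof -
  let ?c = "single (const_simplex 0 x) 1"
  have "?c \<in> rat_cycles 0 Y"
    using assms by (simp add: rat_cycles_def rat_chains_def rat_boundary_def singular_simplex_const_simplex)
  then obtain d where d: "d \<in> rat_chains (Suc 0) Y" "?c - rat_chain_map 0 (b \<circ> l) ?c = rat_boundary (Suc 0) d"
    using rat_homotopic_to_base by (force simp: rat_boundaries_def)
  then have "component_sum l (?c - rat_chain_map 0 (b \<circ> l) ?c) = 0"
    by (simp add: component_sum_boundary)
  then have "single (l x) (1::rat) = single (l (b (l x))) 1"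
    by (simp add: component_sum_def push.diff rat_chain_map_eq_push simplex_map_def const_simplex_def)
  then show ?thesis
    by (metis lookup_single_eq lookup_single_not_eq zero_neq_one)
qed

end

subsection \<open>Small chains\<close>

lemma keys_in_cover:
  assumes "singular_chain p X c" "\<And>f. f \<in> keys c \<Longrightarrow> \<exists>W\<in>{U, V}. f \<in> standard_simplex p \<rightarrow> W"
  obtains d e where "singular_chain p (subtopology X U) d" "singular_chain p (subtopology X V) e" "c = d + e"
proof -
  have "keys c \<subseteq> singular_simplex_set p (subtopology X U) \<union> singular_simplex_set p (subtopology X V)"
    using assms by (fastforce simp: singular_chain_def singular_simplex_subtopology Pi_iff)
  then show thesis
    by (rule frag_split) (use that in \<open>auto simp: singular_chain_def\<close>)
qed

lemma
  assumes "singular_chain p X c"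
  shows singular_chain_subdivision_power: "singular_chain p X ((singular_subdivision p ^^ n) c)"
    and chain_boundary_subdivision_power: "chain_boundary p ((singular_subdivision p ^^ n) c) =
      (singular_subdivision (p - Suc 0) ^^ n) (chain_boundary p c)"
proof -
  show *: "singular_chain p X ((singular_subdivision p ^^ n) c)" for n
    by (induction n) (simp_all add: assms singular_chain_singular_subdivision)
  show "chain_boundary p ((singular_subdivision p ^^ n) c) =
      (singular_subdivision (p - Suc 0) ^^ n) (chain_boundary p c)"
    by (induction n) (simp_all add: chain_boundary_singular_subdivision[OF *])
qed

lemma singular_subdivision_power_add:
  "(singular_subdivision p ^^ n) (a + b) = (singular_subdivision p ^^ n) a + (singular_subdivision p ^^ n) b"
  by (induction n) (simp_all add: singular_subdivision_add)

text \<open>After subdivision, \<open>w\<close> splits into a part in \<open>U\<close> and a part in \<open>V\<close>. The subdivided \<open>u\<close> minus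
  the boundary of the former equals the boundary of the latter minus the subdivided \<open>v\<close>, hence lies
  in both sets.\<close>

lemma boundary_of_small_sum:
  assumes "openin X U" "openin X V" "topspace X \<subseteq> U \<union> V"
    and u: "singular_chain (Suc 0) (subtopology X U) u"
    and v: "singular_chain (Suc 0) (subtopology X V) v"
    and w: "singular_chain (Suc (Suc 0)) X w" "chain_boundary (Suc (Suc 0)) w = u + v"
  shows "\<exists>a. singular_chain (Suc 0) (subtopology X (U \<inter> V)) a \<and>
    chain_boundary (Suc 0) a = chain_boundary (Suc 0) u"
proof -
  let ?S = "\<lambda>p n. singular_subdivision p ^^ n"
  \<comment> \<open>After \<open>n\<close> subdivisions every simplex of \<open>w\<close> lies in
    \<open>U\<close> or in \<open>V\<close>.\<close>
  obtain n where n: "\<And>m f. \<lbrakk>n \<le> m; f \<in> keys (?S (Suc (Suc 0)) m w)\<rbrakk>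
      \<Longrightarrow> \<exists>W \<in> {U, V}. f \<in> standard_simplex (Suc (Suc 0)) \<rightarrow> W"
    by (rule sufficient_iterated_singular_subdivision_exists[of "{U, V}" X "Suc (Suc 0)" w])
      (use assms in auto)
  obtain wu wv where wu: "singular_chain (Suc (Suc 0)) (subtopology X U) wu"
    and wv: "singular_chain (Suc (Suc 0)) (subtopology X V) wv"
    and sum: "?S (Suc (Suc 0)) n w = wu + wv"
    by (rule keys_in_cover[OF singular_chain_subdivision_power[OF w(1)] n[OF order_refl]])
  have eq: "?S (Suc 0) n u + ?S (Suc 0) n v = chain_boundary (Suc (Suc 0)) wu + chain_boundary (Suc (Suc 0)) wv"
    using chain_boundary_subdivision_power[OF w(1), of n] w(2) sum
    by (simp add: singular_subdivision_power_add chain_boundary_add)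
  define a where "a = ?S (Suc 0) n u - chain_boundary (Suc (Suc 0)) wu"
  have "singular_chain (Suc 0) (subtopology X U) a"
    unfolding a_def
    by (rule singular_chain_diff[OF singular_chain_subdivision_power[OF u] singular_chain_boundary_alt[OF wu]])
  moreover have "a = chain_boundary (Suc (Suc 0)) wv - ?S (Suc 0) n v"
    using eq by (simp add: a_def algebra_simps)
  then have "singular_chain (Suc 0) (subtopology X V) a"
    using singular_chain_diff[OF singular_chain_boundary_alt[OF wv] singular_chain_subdivision_power[OF v]]
    by simp
  ultimately have "singular_chain (Suc 0) (subtopology X (U \<inter> V)) a"
    by (auto simp: singular_chain_subtopology)
  \<comment> \<open>Subdivision leaves 0-chains alone, so subdividing \<open>u\<close> does not
    change its boundary.\<close>
  have "?S 0 n c = c" if "singular_chain 0 X c" for c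
    using that by (induction n) (simp_all add: singular_subdivision_zero)
  moreover have "singular_chain (Suc 0) X u"
    using u by (simp add: singular_chain_subtopology)
  ultimately have "chain_boundary (Suc 0) a = chain_boundary (Suc 0) u"
    using chain_boundary_boundary[OF wu] chain_boundary_subdivision_power[OF u, of n]
      singular_chain_boundary_alt[of 0 X u]
    by (simp add: a_def chain_boundary_diff)
  then show ?thesis
    using \<open>singular_chain (Suc 0) (subtopology X (U \<inter> V)) a\<close> by blast
qed

lemma clear_common_denominator:
  fixes a :: "'a \<Rightarrow>\<^sub>0 rat" and b :: "'b \<Rightarrow>\<^sub>0 rat"
  obtains N :: int and a' b' where "N \<noteq> 0" "rat_scale (of_int N) a = rat_of_frag a'"
    "keys a' = keys a" "rat_scale (of_int N) b = rat_of_frag b'"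
    "keys b' = keys b"
proof -
  obtain N a' where a: "N \<noteq> 0" "rat_scale (of_int N) a = rat_of_frag a'"
    by (rule clear_denominators)
  obtain M b' where b: "M \<noteq> 0" "rat_scale (of_int M) b = rat_of_frag b'"
    by (rule clear_denominators)
  have *: "rat_scale (of_int (N * M)) a = rat_of_frag (frag_cmul M a')"
    "rat_scale (of_int (N * M)) b = rat_of_frag (frag_cmul N b')"
    by (simp_all add: a(2)[symmetric] b(2)[symmetric] mult.commute)
  have "N * M \<noteq> 0"
    using a b by simp
  then show thesis
    using that[OF _ *(1) _ *(2)] * by (metis keys_rat_of_frag keys_rat_scale_eq of_int_eq_0_iff)
qed

text \<open>This makes the connecting homomorphism well defined: the boundary of the part in
  \<open>U\<close> is already trivial in the homology of \<open>U \<inter> V\<close>.\<close>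

lemma rat_boundary_of_small_sum:
  assumes cover: "openin X U" "openin X V" "topspace X \<subseteq> U \<union> V"
    and u: "u \<in> rat_chains (Suc 0) (subtopology X U)"
    and v: "v \<in> rat_chains (Suc 0) (subtopology X V)"
    and uv: "u + v \<in> rat_boundaries (Suc 0) X"
  shows "\<exists>a\<in>rat_chains (Suc 0) (subtopology X (U \<inter> V)). rat_boundary (Suc 0) a = rat_boundary (Suc 0) u"
proof -
  obtain w where w: "w \<in> rat_chains (Suc (Suc 0)) X" "rat_boundary (Suc (Suc 0)) w = u + v"
    using uv by (auto simp: rat_boundaries_def)
  obtain N u' w' where N: "N \<noteq> 0"
    and u': "rat_scale (of_int N) u = rat_of_frag u'" "keys u' = keys u"
    and w': "rat_scale (of_int N) w = rat_of_frag w'" "keys w' = keys w"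
    by (rule clear_common_denominator)
  \<comment> \<open>Only \<open>u\<close> and \<open>w\<close> need a common denominator: the
    multiple of \<open>v\<close> is then a difference of integral chains.\<close>
  define v' where "v' = chain_boundary (Suc (Suc 0)) w' - u'"
  have v': "rat_of_frag v' = rat_scale (of_int N) v"
    using w(2) by (simp add: v'_def rat_of_frag_boundary rat_boundary.scale rat_free.scale_right_distrib
        flip: w' u')
  then have "keys v' = keys v"
    using N by (metis keys_rat_of_frag keys_rat_scale_eq of_int_eq_0_iff)
  then have "\<exists>a. singular_chain (Suc 0) (subtopology X (U \<inter> V)) a \<and>
      chain_boundary (Suc 0) a = chain_boundary (Suc 0) u'"
    using u v w u' w'
    by (intro boundary_of_small_sum[OF cover, of u' v' w'])
      (auto simp: singular_chain_def rat_chains_def v'_def)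
  then obtain a where a: "singular_chain (Suc 0) (subtopology X (U \<inter> V)) a"
    "chain_boundary (Suc 0) a = chain_boundary (Suc 0) u'"
    by blast
  have "rat_boundary (Suc 0) (rat_scale (inverse (of_int N)) (rat_of_frag a)) =
      rat_scale (inverse (of_int N)) (rat_boundary (Suc 0) (rat_of_frag u'))"
    using a(2) by (simp add: rat_boundary.scale flip: rat_of_frag_boundary)
  also have "\<dots> = rat_boundary (Suc 0) u"
    using N by (simp add: rat_boundary.scale flip: u'(1))
  finally show ?thesis
    using a(1) rat_free.subspace_scale[OF subspace_rat_chains] by (metis rat_of_frag_in_rat_chains)
qed

text \<open>The small simplices theorem for an integral multiple of \<open>z\<close>, scaled
  back.\<close>

lemma small_homologous_rat_cycle:
  assumes cover: "openin X U" "openin X V" "topspace X \<subseteq> U \<union> V"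
    and z: "z \<in> rat_cycles (Suc 0) X"
  shows "\<exists>u\<in>rat_chains (Suc 0) (subtopology X U). \<exists>v\<in>rat_chains (Suc 0) (subtopology X V).
    z - (u + v) \<in> rat_boundaries (Suc 0) X"
proof -
  have "z \<in> rat_chains (Suc 0) X"
    using z by (simp add: rat_cycles_def)
  then obtain q d where q: "q \<noteq> 0" "z = rat_scale q (rat_of_frag d)" "singular_chain (Suc 0) X d"
    by (rule rat_chain_cases)
  have "rat_of_frag (chain_boundary (Suc 0) d) = rat_of_frag 0"
    using z q by (simp add: rat_cycles_def rat_boundary.scale rat_of_frag_boundary)
  then have "singular_relcycle (Suc 0) X {} d"
    using q by (simp add: singular_cycle del: rat_of_frag_simps(1) flip: rat_of_frag_eq_iff)
  obtain c where c: "singular_relcycle (Suc 0) X {} c" "homologous_rel (Suc 0) X {} d c"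
    "\<And>f. f \<in> keys c \<Longrightarrow> \<exists>W\<in>{U, V}. f \<in> standard_simplex (Suc 0) \<rightarrow> W"
    by (rule small_homologous_rel_relcycle_exists[where \<C> = "{U, V}", OF _ _ \<open>singular_relcycle (Suc 0) X {} d\<close>]) (use cover in auto)
  have "singular_chain (Suc 0) X c"
    using c by (simp add: singular_cycle)
  then obtain u v where uv: "singular_chain (Suc 0) (subtopology X U) u"
    "singular_chain (Suc 0) (subtopology X V) v" "c = u + v"
    by (rule keys_in_cover[OF _ c(3)])
  obtain e where e: "singular_chain (Suc (Suc 0)) X e" "chain_boundary (Suc (Suc 0)) e = d - c"
    using c(2) by (auto simp: homologous_rel_def singular_boundary)
  note scale = rat_free.subspace_scale[OF subspace_rat_chains, of _ _ _ q]
  show ?thesis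
  proof (intro bexI)
    show "rat_scale q (rat_of_frag u) \<in> rat_chains (Suc 0) (subtopology X U)"
      "rat_scale q (rat_of_frag v) \<in> rat_chains (Suc 0) (subtopology X V)"
      using uv by (auto intro!: scale)
    have "z - (rat_scale q (rat_of_frag u) + rat_scale q (rat_of_frag v)) =
        rat_scale q (rat_of_frag (d - c))"
      by (simp add: q uv rat_free.scale_right_distrib rat_free.scale_right_diff_distrib)
    also have "\<dots> = rat_boundary (Suc (Suc 0)) (rat_scale q (rat_of_frag e))"
      by (simp add: rat_boundary.scale rat_of_frag_boundary flip: e(2))
    finally show "z - (rat_scale q (rat_of_frag u) + rat_scale q (rat_of_frag v)) \<in> rat_boundaries (Suc 0) X"
      using e(1) by (auto simp: rat_boundaries_def intro!: scale)
  qed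
qed

subsection \<open>The first homology of a cover by contractible pieces\<close>

text \<open>The types \<open>'p\<close> and \<open>'q\<close> name the two kinds of vertices and
  \<open>'e\<close> the edges; \<pi>u and \<pi>v send an edge to its ends. The labels are compared
  only at points of \<open>X\<close> in both pieces, as they are arbitrary elsewhere.\<close>

locale mayer_vietoris =
  fixes X :: "'a topology" and U V :: "'a set"
    and lu :: "'a \<Rightarrow> 'p" and bu and lv :: "'a \<Rightarrow> 'q" and bv and lw :: "'a \<Rightarrow> 'e" and bw
    and \<pi>u :: "'e \<Rightarrow> 'p" and \<pi>v :: "'e \<Rightarrow> 'q"
  assumes open_cover: "openin X U" "openin X V" "topspace X \<subseteq> U \<union> V"
    and contracts_U: "contracts_to_discrete (subtopology X U) lu bu"
    and contracts_V: "contracts_to_discrete (subtopology X V) lv bv"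
    and contracts_W: "contracts_to_discrete (subtopology X (U \<inter> V)) lw bw"
    and labels: "\<And>x. \<lbrakk>x \<in> topspace X; x \<in> U; x \<in> V\<rbrakk> \<Longrightarrow> lu x = \<pi>u (lw x) \<and> lv x = \<pi>v (lw x)"
begin

abbreviation "chains1 S \<equiv> rat_chains (Suc 0) (subtopology X S)"
abbreviation "cls \<equiv> coset (rat_boundaries (Suc 0) X)"

text \<open>The kernel of the map from \<open>H_0\<close> of \<open>U \<inter> V\<close> to the sum
  of the \<open>H_0\<close> of \<open>U\<close> and of \<open>V\<close>. Only labels of actual
  points may carry weight.\<close>

definition flows :: "('e \<Rightarrow>\<^sub>0 rat) set"
  where "flows = {f. keys f \<subseteq> lw ` (topspace X \<inter> U \<inter> V) \<and> push \<pi>u f = 0 \<and> push \<pi>v f = 0}"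

text \<open>The connecting homomorphism. Existence of \<open>u\<close> and \<open>v\<close> is
  \<open>carrierE\<close>, and independence of their choice is \<open>flow_eq\<close>.\<close>

definition flow :: "'a rat_chain set \<Rightarrow> ('e \<Rightarrow>\<^sub>0 rat)"
  where "flow C = (THE f. \<exists>u\<in>chains1 U.
    \<exists>v\<in>chains1 V. u + v \<in> C \<and> f = component_sum lw (rat_boundary (Suc 0) u))"

text \<open>Two decompositions of representatives differ by a sum of the same kind that bounds.
  Hence \<open>\<partial>u' - \<partial>u\<close> bounds in \<open>U \<inter> V\<close>, where
  \<open>component_sum lw\<close> annihilates boundaries.\<close>

lemma flow_eq:
  assumes u: "u \<in> chains1 U" and v: "v \<in> chains1 V"
  shows "flow (cls (u + v)) = component_sum lw (rat_boundary (Suc 0) u)"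
  unfolding flow_def
proof (rule the_equality)
  show "\<exists>u'\<in>chains1 U. \<exists>v'\<in>chains1 V.
    u' + v' \<in> cls (u + v) \<and> component_sum lw (rat_boundary (Suc 0) u) = component_sum lw (rat_boundary (Suc 0) u')"
    using assms coset_self[OF subspace_rat_boundaries] by blast
next
  fix f
  assume "\<exists>u'\<in>chains1 U. \<exists>v'\<in>chains1 V.
    u' + v' \<in> cls (u + v) \<and> f = component_sum lw (rat_boundary (Suc 0) u')"
  then obtain u' v' where u': "u' \<in> chains1 U"
    and v': "v' \<in> chains1 V"
    and "u' + v' \<in> cls (u + v)" and f: "f = component_sum lw (rat_boundary (Suc 0) u')"
    by blast
  then have "(u' - u) + (v' - v) \<in> rat_boundaries (Suc 0) X"
    by (simp add: mem_coset_iff algebra_simps)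
  then obtain a where a: "a \<in> chains1 (U \<inter> V)"
    "rat_boundary (Suc 0) a = rat_boundary (Suc 0) (u' - u)"
    using rat_boundary_of_small_sum[OF open_cover, of "u' - u" "v' - v"]
      rat_free.subspace_diff[OF subspace_rat_chains] u v u' v' by metis
  have "component_sum lw (rat_boundary (Suc 0) (u' - u)) = 0"
    using component_sum_boundary[OF contracts_W a(1)] a(2) by simp
  then show "f = component_sum lw (rat_boundary (Suc 0) u)"
    by (simp add: f rat_boundary.diff component_sum.diff)
qed

text \<open>For a cycle \<open>u + v\<close> the boundaries of the two parts cancel, so each of them
  is supported in \<open>U\<close> as well as in \<open>V\<close>.\<close>

lemma carrierE:
  assumes "C \<in> carrier (rat_homology (Suc 0) X)"
  obtains u v where "u \<in> chains1 U" "v \<in> chains1 V"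
    "C = cls (u + v)" "u + v \<in> rat_cycles (Suc 0) X"
    "rat_boundary (Suc 0) u = - rat_boundary (Suc 0) v"
    "rat_boundary (Suc 0) u \<in> rat_chains 0 (subtopology X (U \<inter> V))"
proof -
  obtain z where z: "z \<in> rat_cycles (Suc 0) X" "C = cls z"
    using assms by (auto simp: rat_homology_simps)
  then obtain u v where uv: "u \<in> chains1 U"
    "v \<in> chains1 V" "z - (u + v) \<in> rat_boundaries (Suc 0) X"
    using small_homologous_rat_cycle[OF open_cover] by metis
  have "z - (z - (u + v)) \<in> rat_cycles (Suc 0) X"
    by (rule rat_free.subspace_diff[OF subspace_rat_cycles z(1) subsetD[OF rat_boundaries_subset_rat_cycles uv(3)]])
  then have cyc: "u + v \<in> rat_cycles (Suc 0) X"
    by (simp add: add.commute)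
  then have eq: "rat_boundary (Suc 0) u = - rat_boundary (Suc 0) v"
    by (simp add: rat_cycles_def rat_boundary.add eq_neg_iff_add_eq_0)
  have "rat_boundary (Suc 0) u \<in> rat_chains 0 (subtopology X U)"
    "- rat_boundary (Suc 0) v \<in> rat_chains 0 (subtopology X V)"
    using rat_boundary_in_rat_chains[OF uv(1)] rat_boundary_in_rat_chains[OF uv(2)]
      rat_free.subspace_neg[OF subspace_rat_chains] by simp_all
  then have "rat_boundary (Suc 0) u \<in> rat_chains 0 (subtopology X (U \<inter> V))"
    unfolding eq by (metis IntI rat_chains_Int)
  then show thesis
    using that uv z cyc eq rat_class_eq_iff by metis
qed

lemma component_sum_Int:
  assumes "c \<in> rat_chains 0 (subtopology X (U \<inter> V))"
  shows "component_sum lu c = push \<pi>u (component_sum lw c)"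
    and "component_sum lv c = push \<pi>v (component_sum lw c)"
    and "keys (component_sum lw c) \<subseteq> lw ` (topspace X \<inter> U \<inter> V)"
proof -
  have *: "s zero_vertex \<in> topspace X \<inter> U \<inter> V" if "s \<in> keys c" for s
  proof -
    have "singular_simplex 0 (subtopology X (U \<inter> V)) s"
      using assms that by (auto simp: rat_chains_def)
    then have "s \<in> standard_simplex 0 \<rightarrow> topspace (subtopology X (U \<inter> V))"
      by (simp add: singular_simplex_def continuous_map_def)
    then show ?thesis
      by (auto simp: Pi_iff)
  qed
  show "component_sum lu c = push \<pi>u (component_sum lw c)"
    "component_sum lv c = push \<pi>v (component_sum lw c)"
    unfolding component_sum_def push_compose by (rule push_cong, use * labels in auto)+
  show "keys (component_sum lw c) \<subseteq> lw ` (topspace X \<inter> U \<inter> V)"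
    unfolding component_sum_def using * by (intro order_trans[OF keys_push]) auto
qed

text \<open>The 0-chain \<open>\<partial>u\<close> bounds in \<open>U\<close>, and as
  \<open>-\<partial>v\<close> it bounds in \<open>V\<close>. So its sums vanish on every component
  of either piece.\<close>

lemma flow_in_flows:
  assumes "C \<in> carrier (rat_homology (Suc 0) X)"
  shows "flow C \<in> flows"
  using assms
proof (rule carrierE)
  fix u v
  assume u: "u \<in> chains1 U" and v: "v \<in> chains1 V"
    and C: "C = cls (u + v)" and uv: "rat_boundary (Suc 0) u = - rat_boundary (Suc 0) v"
    and W: "rat_boundary (Suc 0) u \<in> rat_chains 0 (subtopology X (U \<inter> V))"
  have "component_sum lu (rat_boundary (Suc 0) u) = 0"
    by (rule component_sum_boundary[OF contracts_U u])
  moreover have "component_sum lv (rat_boundary (Suc 0) u) = 0"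
    unfolding uv component_sum.neg component_sum_boundary[OF contracts_V v] by simp
  ultimately show ?thesis
    using component_sum_Int[OF W] by (simp add: flows_def C flow_eq[OF u v])
qed

lemma flow_linear: "flow \<in> linear_maps (rat_homology (Suc 0) X) (subspace_of_free flows)"
proof -
  have "flow (C \<oplus>\<^bsub>rat_homology (Suc 0) X\<^esub> D) = flow C + flow D"
    if C: "C \<in> carrier (rat_homology (Suc 0) X)" and D: "D \<in> carrier (rat_homology (Suc 0) X)" for C D
  proof -
    obtain u v where u: "u \<in> chains1 U"
      and v: "v \<in> chains1 V" and "C = cls (u + v)"
      using C by (rule carrierE)
    moreover obtain u' v' where u': "u' \<in> chains1 U"
      and v': "v' \<in> chains1 V" and "D = cls (u' + v')"
      using D by (rule carrierE)
    moreover have "u + u' \<in> chains1 U" "v + v' \<in> chains1 V"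
      using u u' v v' by (auto intro: rat_free.subspace_add[OF subspace_rat_chains])
    ultimately show ?thesis
      using flow_eq[of "u + u'" "v + v'"]
      by (simp add: rat_homology_simps flow_eq rat_boundary.add component_sum.add algebra_simps)
  qed
  moreover have "flow (c \<odot>\<^bsub>rat_homology (Suc 0) X\<^esub> C) = rat_scale c (flow C)"
    if C: "C \<in> carrier (rat_homology (Suc 0) X)" for c C
  proof -
    obtain u v where u: "u \<in> chains1 U"
      and v: "v \<in> chains1 V" and "C = cls (u + v)"
      using C by (rule carrierE)
    moreover have "rat_scale c u \<in> chains1 U"
      "rat_scale c v \<in> chains1 V"
      using u v by (auto intro: rat_free.subspace_scale[OF subspace_rat_chains])
    ultimately show ?thesis
      using flow_eq[of "rat_scale c u" "rat_scale c v"]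
      by (simp add: rat_homology_simps flow_eq rat_boundary.scale component_sum.scale rat_free.scale_right_distrib)
  qed
  ultimately show ?thesis
    using flow_in_flows by (auto simp: linear_maps_def)
qed

lemma rat_boundaries_1_subtopology:
  "rat_boundaries (Suc 0) (subtopology X S) \<subseteq> rat_boundaries (Suc 0) X"
  unfolding rat_boundaries_def using rat_chains_subtopology by blast

text \<open>Exactness of the Mayer-Vietoris sequence, together with the vanishing of
  \<open>H_1\<close> of \<open>U\<close> and \<open>V\<close>.\<close>

lemma flow_bij: "bij_betw flow (carrier (rat_homology (Suc 0) X)) flows"
proof (rule bij_betw_imageI)
  let ?H = "rat_homology (Suc 0) X"
  interpret H: Module.module rat_field ?H
    by (rule module_rat_homology)
  note lin = linear_mapsD[OF flow_linear, simplified]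
  have kernel: "C = cls 0" if "C \<in> carrier ?H" "flow C = 0" for C
    using that(1)
  proof (rule carrierE)
    fix u v
    assume u: "u \<in> chains1 U" and v: "v \<in> chains1 V"
      and C: "C = cls (u + v)" and uv: "rat_boundary (Suc 0) u = - rat_boundary (Suc 0) v"
      and W: "rat_boundary (Suc 0) u \<in> rat_chains 0 (subtopology X (U \<inter> V))"
    have "component_sum lw (rat_boundary (Suc 0) u) = 0"
      using that(2) by (simp add: C flow_eq[OF u v])
    \<comment> \<open>Shifting \<open>a\<close> from \<open>u\<close> to \<open>v\<close> makes both
      parts cycles, each in a piece in which 1-cycles bound.\<close>
    then obtain a where a: "a \<in> chains1 (U \<inter> V)"
      "rat_boundary (Suc 0) a = rat_boundary (Suc 0) u"
      using rat_boundaries_0I[OF contracts_W W] by (auto simp: rat_boundaries_def)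
    have "a \<in> chains1 U" "a \<in> chains1 V"
      using a(1) by (auto simp flip: rat_chains_Int)
    then have "u - a \<in> rat_cycles (Suc 0) (subtopology X U)" "v + a \<in> rat_cycles (Suc 0) (subtopology X V)"
      using a(2) u v uv rat_free.subspace_diff[OF subspace_rat_chains] rat_free.subspace_add[OF subspace_rat_chains]
      by (simp_all add: rat_cycles_def rat_boundary.diff rat_boundary.add)
    then have "u - a \<in> rat_boundaries (Suc 0) X" "v + a \<in> rat_boundaries (Suc 0) X"
      using rat_boundaries_1I[OF contracts_U] rat_boundaries_1I[OF contracts_V] rat_boundaries_1_subtopology
      by blast+
    then have "(u - a) + (v + a) \<in> rat_boundaries (Suc 0) X"
      by (rule rat_free.subspace_add[OF subspace_rat_boundaries])
    then show ?thesis
      by (simp add: C rat_class_eq_iff)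
  qed
  show "inj_on flow (carrier ?H)"
  proof (rule inj_onI)
    fix C D assume CD: "C \<in> carrier ?H" "D \<in> carrier ?H" "flow C = flow D"
    then obtain z w where zw: "z \<in> rat_cycles (Suc 0) X" "w \<in> rat_cycles (Suc 0) X" "C = cls z" "D = cls w"
      by (auto simp: rat_homology_simps)
    have "cls (z - w) = C \<oplus>\<^bsub>?H\<^esub> ((-1) \<odot>\<^bsub>?H\<^esub> D)"
      by (simp add: zw rat_homology_simps)
    moreover have "(-1) \<odot>\<^bsub>?H\<^esub> D \<in> carrier ?H"
      using CD by (simp add: H.smult_closed)
    ultimately have "flow (cls (z - w)) = 0"
      using CD by (simp add: lin)
    moreover have "cls (z - w) \<in> carrier ?H"
      using zw rat_free.subspace_diff[OF subspace_rat_cycles zw(1,2)] by (simp add: rat_homology_simps)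
    ultimately have "cls (z - w) = cls 0"
      by (rule kernel[rotated])
    then show "C = D"
      by (simp add: zw rat_class_eq_iff)
  qed
  have "\<exists>C\<in>carrier ?H. flow C = f" if f: "f \<in> flows" for f
  proof -
    \<comment> \<open>The weights are placed at the base points of the components of
      \<open>U \<inter> V\<close>. Zero sums at the vertices let \<open>c\<close> bound in
      \<open>U\<close> and in \<open>V\<close>, and the difference of the two bounding chains is the
      required cycle.\<close>
    define c where "c = push (\<lambda>e. const_simplex 0 (bw e)) f"
    have keys: "keys f \<subseteq> lw ` (topspace X \<inter> U \<inter> V)"
      using f by (simp add: flows_def)
    have base: "bw e \<in> topspace (subtopology X (U \<inter> V))" "lw (bw e) = e"
      if "e \<in> lw ` (topspace X \<inter> U \<inter> V)" for e
      using that base_in_topspace[OF contracts_W] label_base[OF contracts_W] by auto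
    have "(\<lambda>e. const_simplex 0 (bw e)) ` keys f \<subseteq>
        singular_simplex_set 0 (subtopology X (U \<inter> V))"
      using keys base(1) by (auto intro!: singular_simplex_const_simplex)
    then have c: "c \<in> rat_chains 0 (subtopology X (U \<inter> V))"
      by (simp add: rat_chains_def c_def order_trans[OF keys_push])
    have "component_sum lw c = push (\<lambda>e. lw (bw e)) f"
      by (simp add: component_sum_def c_def push_compose comp_def const_simplex_def)
    also have "\<dots> = f"
      using base(2) keys by (intro push_id) auto
    finally have sum: "component_sum lw c = f" .
    have "c \<in> rat_chains 0 (subtopology X U)" "c \<in> rat_chains 0 (subtopology X V)"
      using c by (auto simp flip: rat_chains_Int)
    moreover have "component_sum lu c = 0" "component_sum lv c = 0"
      using component_sum_Int[OF c] sum f by (simp_all add: flows_def)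
    ultimately obtain u v where u: "u \<in> chains1 U" "rat_boundary (Suc 0) u = c"
      and v: "v \<in> chains1 V" "rat_boundary (Suc 0) v = c"
      using rat_boundaries_0I[OF contracts_U] rat_boundaries_0I[OF contracts_V]
      by (fastforce simp: rat_boundaries_def)
    have v': "- v \<in> chains1 V"
      using v rat_free.subspace_neg[OF subspace_rat_chains] by blast
    have "u + (- v) \<in> rat_cycles (Suc 0) X"
      using u v v' rat_chains_subtopology rat_free.subspace_add[OF subspace_rat_chains, of u "Suc 0" X "- v"]
      by (auto simp: rat_cycles_def rat_boundary.diff subset_iff)
    then have "cls (u + (- v)) \<in> carrier ?H"
      by (auto simp: rat_homology_simps)
    moreover have "flow (cls (u + (- v))) = f"
      using flow_eq[OF u(1) v'] u(2) sum by simp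
    ultimately show ?thesis
      by blast
  qed
  then show "flow ` carrier ?H = flows"
    using flow_in_flows by auto
qed

text \<open>A map preserving \<open>U\<close> and \<open>V\<close> sends decomposed representatives
  to decomposed ones and commutes with the boundary. Self-maps are all that the permutation action
  calls for.\<close>

lemma flow_natural:
  assumes g: "continuous_map X X g" and "g \<in> U \<rightarrow> U" "g \<in> V \<rightarrow> V"
    and lw: "\<And>x. \<lbrakk>x \<in> topspace X; x \<in> U; x \<in> V\<rbrakk> \<Longrightarrow> lw (g x) = \<gamma> (lw x)"
    and C: "C \<in> carrier (rat_homology (Suc 0) X)"
  shows "flow (rat_homology_map (Suc 0) X g C) = push \<gamma> (flow C)"
  using C
proof (rule carrierE)
  fix u v
  assume u: "u \<in> chains1 U" and v: "v \<in> chains1 V"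
    and C: "C = cls (u + v)" and uv: "rat_boundary (Suc 0) u = - rat_boundary (Suc 0) v"
    and W: "rat_boundary (Suc 0) u \<in> rat_chains 0 (subtopology X (U \<inter> V))"
  have cont: "continuous_map (subtopology X S) (subtopology X S) g" if "g \<in> S \<rightarrow> S" for S
    using g that by (auto simp: continuous_map_in_subtopology continuous_map_from_subtopology Pi_iff)
  have gu: "rat_chain_map (Suc 0) g u \<in> chains1 U"
    and gv: "rat_chain_map (Suc 0) g v \<in> chains1 V"
    by (rule rat_chain_map_in_rat_chains[OF u cont[OF assms(2)]],
        rule rat_chain_map_in_rat_chains[OF v cont[OF assms(3)]])
  have "flow (rat_homology_map (Suc 0) X g C) = component_sum lw (rat_boundary (Suc 0) (rat_chain_map (Suc 0) g u))"
    unfolding C rat_homology_map_coset[OF g] rat_chain_map.add by (rule flow_eq[OF gu gv])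
  also have "\<dots> = component_sum lw (rat_chain_map 0 g (rat_boundary (Suc 0) u))"
    using rat_boundary_chain_map[OF u, of g] by simp
  also have "\<dots> = push \<gamma> (component_sum lw (rat_boundary (Suc 0) u))"
    unfolding component_sum_def rat_chain_map_eq_push push_compose
  proof (rule push_cong)
    fix s assume "s \<in> keys (rat_boundary (Suc 0) u)"
    then have "singular_simplex 0 (subtopology X (U \<inter> V)) s"
      using W by (auto simp: rat_chains_def)
    then have "s \<in> standard_simplex 0 \<rightarrow> topspace (subtopology X (U \<inter> V))"
      by (simp add: singular_simplex_def continuous_map_def)
    then show "((\<lambda>s. lw (s zero_vertex)) \<circ> simplex_map 0 g) s = (\<gamma> \<circ> (\<lambda>s. lw (s zero_vertex))) s"
      using lw[of "s zero_vertex"] by (auto simp: simplex_map_def Pi_iff)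
  qed
  finally show ?thesis
    by (simp add: C flow_eq[OF u v])
qed

end

subsection \<open>The configuration space of a star as a subspace\<close>

definition star_set :: "nat \<Rightarrow> (nat \<Rightarrow> real) set"
  where "star_set n = insert (\<lambda>_. 0) {star_point i t | i t. i \<in> {1..n} \<and> t \<in> {0..1}}"

type_synonym config = "(nat \<Rightarrow> real) \<times> (nat \<Rightarrow> real)"

definition configs :: "nat \<Rightarrow> config set"
  where "configs n = {(x, y). x \<in> star_set n \<and> y \<in> star_set n \<and> x \<noteq> y}"

lemma star_point_zero [simp]: "star_point i 0 = (\<lambda>_. 0)"
  by (auto simp: star_point_def)

lemma star_point_same [simp]: "star_point i t i = t"
  by (simp add: star_point_def)

lemma star_point_neq [simp]: "j \<noteq> i \<Longrightarrow> star_point i t j = 0"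
  by (simp add: star_point_def)

lemma star_point_eq_iff: "star_point i s = star_point j t \<longleftrightarrow> s = t \<and> (i = j \<or> s = 0)"
proof
  assume *: "star_point i s = star_point j t"
  show "s = t \<and> (i = j \<or> s = 0)"
    using fun_cong[OF *, of i] fun_cong[OF *, of j] by (auto simp: star_point_def split: if_splits)
qed auto

lemma Conf2_star: "Conf2 (star n) = top_of_set (configs n)"
proof -
  have "prod_topology (star n) (star n) = top_of_set (star_set n \<times> star_set n)"
    by (simp add: star_def star_set_def flip: subtopology_Times)
  then show ?thesis
    by (auto simp: Conf2_def subtopology_subtopology configs_def intro!: arg_cong[where f = top_of_set])
qed

lemma topspace_Conf2_star [simp]: "topspace (Conf2 (star n)) = configs n"
  by (simp add: Conf2_star)

lemma star_setE:
  assumes "x \<in> star_set n" "x \<noteq> (\<lambda>_. 0)"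
  obtains i t where "i \<in> {1..n}" "0 < t" "t \<le> 1" "x = star_point i t"
  using assms by (auto simp: star_set_def) (metis less_eq_real_def star_point_zero)

lemma star_set_zero [simp]: "(\<lambda>_. 0) \<in> star_set n"
  by (simp add: star_set_def)

lemma star_point_in_star_set [simp]: "\<lbrakk>i \<in> {1..n}; 0 \<le> t; t \<le> 1\<rbrakk> \<Longrightarrow> star_point i t \<in> star_set n"
  by (auto simp: star_set_def)

lemma star_set_nonneg: "x \<in> star_set n \<Longrightarrow> 0 \<le> x i"
  by (auto simp: star_set_def star_point_def)

text \<open>At the centre the value is arbitrary. On each region below, the labels apply
  \<open>leg\<close> only to points that are off the centre.\<close>

definition leg :: "(nat \<Rightarrow> real) \<Rightarrow> nat"
  where "leg x = (THE i. x i \<noteq> 0)"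

lemma leg_star_point [simp]: "t \<noteq> 0 \<Longrightarrow> leg (star_point i t) = i"
  unfolding leg_def by (rule the_equality) (auto simp: star_point_def split: if_splits)

lemma leg_eqI:
  assumes "x \<in> star_set n" "0 < x i"
  shows "leg x = i"
proof (rule star_setE[OF assms(1)])
  show "x \<noteq> (\<lambda>_. 0)"
    using assms by auto
  fix k t assume x: "x = star_point k t" "0 < t"
  then have "i = k"
    using assms(2) by (cases "i = k") auto
  then show ?thesis
    using x by simp
qed

abbreviation legs :: "(nat \<Rightarrow> real) \<times> (nat \<Rightarrow> real) \<Rightarrow> nat \<times> nat"
  where "legs \<equiv> \<lambda>(x, y). (leg x, leg y)"

text \<open>On the star at most one coordinate is nonzero, so this is the distance from the centre,
  in a form that is visibly continuous.\<close>

definition height :: "nat \<Rightarrow> (nat \<Rightarrow> real) \<Rightarrow> real"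
  where "height n x = (\<Sum>i\<in>{1..n}. x i)"

lemma height_star_point [simp]: "i \<in> {1..n} \<Longrightarrow> height n (star_point i t) = t"
  by (simp add: height_def star_point_def)

lemma height_zero [simp]: "height n (\<lambda>_. 0) = 0"
  by (simp add: height_def)

lemma continuous_on_config_coordinates [continuous_intros]:
  fixes S :: "config set"
  shows "continuous_on S (\<lambda>p. fst p i)" "continuous_on S (\<lambda>p. snd p i)"
  by (rule continuous_on_product_then_coordinatewise, intro continuous_intros)+

lemma continuous_on_config_height [continuous_intros]:
  fixes S :: "config set"
  shows "continuous_on S (\<lambda>p. height n (fst p))" "continuous_on S (\<lambda>p. height n (snd p))"
  unfolding height_def by (intro continuous_intros)+

subsection \<open>Contractible pieces of the configuration spaces\<close>

text \<open>In all uses the two end configurations have their first points on a common leg, and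
  likewise their second points, so the motion stays in the star.\<close>

definition segment_point :: "real \<Rightarrow> config \<Rightarrow> config \<Rightarrow> config"
  where "segment_point t p q =
    (\<lambda>i. (1 - t) * fst p i + t * fst q i, \<lambda>i. (1 - t) * snd p i + t * snd q i)"

lemma segment_point_0 [simp]: "segment_point 0 p q = p"
  and segment_point_1 [simp]: "segment_point 1 p q = q"
  by (simp_all add: segment_point_def)

lemma segment_point_swap: "segment_point t (prod.swap p) (prod.swap q) = prod.swap (segment_point t p q)"
  by (simp add: segment_point_def)

lemma segment_point_star:
  "segment_point t (star_point i r, star_point j s) (star_point i r', star_point j s') =
    (star_point i ((1 - t) * r + t * r'), star_point j ((1 - t) * s + t * s'))"
  by (auto simp: segment_point_def star_point_def fun_eq_iff)

lemma locally_constantI: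
  assumes "\<And>p. p \<in> D \<Longrightarrow> \<exists>G. open G \<and> p \<in> G \<and> (\<forall>q\<in>D \<inter> G. l q = l p)"
  shows "continuous_map (top_of_set D) (discrete_topology UNIV) l"
  unfolding continuous_map_def
proof (intro conjI allI impI)
  fix S
  show "openin (top_of_set D) {p \<in> topspace (top_of_set D). l p \<in> S}"
  proof (subst openin_subopen, intro ballI)
    fix p assume "p \<in> {p \<in> topspace (top_of_set D). l p \<in> S}"
    then have p: "p \<in> D" "l p \<in> S"
      by simp_all
    obtain G where "open G" "p \<in> G" and G: "\<forall>q\<in>D \<inter> G. l q = l p"
      using assms[OF p(1)] by blast
    moreover have "D \<inter> G \<subseteq> {p \<in> topspace (top_of_set D). l p \<in> S}"
    proof
      fix q assume "q \<in> D \<inter> G"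
      then have "l q = l p"
        using G by blast
      then show "q \<in> {p \<in> topspace (top_of_set D). l p \<in> S}"
        using p(2) \<open>q \<in> D \<inter> G\<close> by simp
    qed
    ultimately show "\<exists>T. openin (top_of_set D) T \<and> p \<in> T \<and> T \<subseteq> {p \<in> topspace (top_of_set D). l p \<in> S}"
      using p(1) openin_open_Int by blast
  qed
qed auto

text \<open>The neighbourhoods \<open>G\<close> are taken in the ambient space because they will be
  given by strict inequalities between coordinates.\<close>

definition linear_contraction :: "config set \<Rightarrow> (config \<Rightarrow> 'e) \<Rightarrow> ('e \<Rightarrow> config) \<Rightarrow> bool"
  where "linear_contraction D l b \<longleftrightarrow>
    (\<forall>p\<in>D. \<exists>G. open G \<and> p \<in> G \<and> (\<forall>q\<in>D \<inter> G. l q = l p)) \<and>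
    (\<forall>p\<in>D. \<forall>t\<in>{0..1}. segment_point t p (b (l p)) \<in> D)"

lemma linear_contraction_continuous_label:
  "linear_contraction D l b \<Longrightarrow> continuous_map (top_of_set D) (discrete_topology UNIV) l"
  by (intro locally_constantI) (simp add: linear_contraction_def)

lemma linear_contraction_continuous:
  assumes "linear_contraction D l b"
  shows "continuous_map (prod_topology (top_of_set {0..1}) (top_of_set D)) (top_of_set D)
    (\<lambda>(t, p). segment_point t p (b (l p)))"
proof -
  let ?P = "prod_topology (top_of_set {0..1::real}) (top_of_set D)"
  have P: "?P = top_of_set ({0..1} \<times> D)"
    by (simp flip: subtopology_Times)
  \<comment> \<open>The target of the motion depends on the configuration only through its locally
    constant label, so any real function of it is continuous.\<close>
  have "continuous_map ?P euclidean (\<lambda>z. g (l (snd z)) :: real)" for g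
  proof -
    have "continuous_map ?P euclidean (g \<circ> l \<circ> snd)"
      using linear_contraction_continuous_label[OF assms]
      by (intro continuous_map_compose[of _ "discrete_topology UNIV"] continuous_map_compose[of _ "top_of_set D"]
          continuous_map_snd) auto
    then show ?thesis
      by (simp add: comp_def)
  qed
  then have [continuous_intros]: "continuous_on ({0..1::real} \<times> D) (\<lambda>z. g (l (snd z)) :: real)" for g
    by (simp add: P)
  have "continuous_on ({0..1} \<times> D) (\<lambda>z. segment_point (fst z) (snd z) (b (l (snd z))))"
  proof -
    have [continuous_intros]: "continuous_on ({0..1::real} \<times> D) (\<lambda>z. fst (snd z) i)"
      "continuous_on ({0..1::real} \<times> D) (\<lambda>z. snd (snd z) i)" for i
      by (rule continuous_on_product_then_coordinatewise, intro continuous_intros)+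
    show ?thesis
      unfolding segment_point_def
      by (intro continuous_on_Pair continuous_on_coordinatewise_then_product; intro continuous_intros)
  qed
  moreover have "segment_point t p (b (l p)) \<in> D" if "t \<in> {0..1}" "p \<in> D" for t p
    using assms that by (simp add: linear_contraction_def)
  ultimately show ?thesis
    by (auto simp: P continuous_map_in_subtopology case_prod_unfold)
qed

lemma linear_contraction_contracts:
  assumes "linear_contraction D l b"
  shows "contracts_to_discrete (top_of_set D) l b"
  unfolding contracts_to_discrete_def homotopic_with_def
  using linear_contraction_continuous_label[OF assms] linear_contraction_continuous[OF assms]
  by (auto intro!: exI[of _ "\<lambda>(t, p). segment_point t p (b (l p))"])

section \<open>Regions of ordered configurations and their contractions\<close>

text \<open>Coordinates on the star are nonnegative, so \<open>j\<close> can only be the leg of the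
  second point. The existential form exhibits the region as relatively open.\<close>

definition second_outside :: "nat \<Rightarrow> config set"
  where "second_outside n = {(x, y) \<in> configs n. \<exists>j. x j < y j}"

definition first_outside :: "nat \<Rightarrow> config set"
  where "first_outside n = {(x, y) \<in> configs n. \<exists>j. y j < x j}"

definition different_legs :: "nat \<Rightarrow> config set"
  where "different_legs n = second_outside n \<inter> first_outside n"

lemma second_outsideE:
  assumes "(x, y) \<in> second_outside n"
  obtains i r j s where "i \<in> {1..n}" "j \<in> {1..n}" "0 \<le> r" "r \<le> 1" "0 < s" "s \<le> 1"
    "i = j \<Longrightarrow> r < s" "x = star_point i r" "y = star_point j s"
proof -
  obtain k where k: "x k < y k" and x: "x \<in> star_set n" and y: "y \<in> star_set n"
    using assms by (auto simp: second_outside_def configs_def)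
  have "0 < y k"
    using k star_set_nonneg[OF x, of k] by linarith
  then have "y \<noteq> (\<lambda>_. 0)"
    by auto
  then obtain j s where js: "j \<in> {1..n}" "0 < s" "s \<le> 1" "y = star_point j s"
    using star_setE[OF y] by blast
  have "k = j"
    using \<open>0 < y k\<close> js by (auto simp: star_point_def split: if_splits)
  show thesis
  proof (cases "x = (\<lambda>_. 0)")
    \<comment> \<open>The centre lies on every leg; it is written as the point with parameter 0 on
      leg \<open>j\<close>, consistently with \<open>r < s\<close>.\<close>
    case True
    then show thesis
      using js that[of j j 0 s] by simp
  next
    case False
    then obtain i r where "i \<in> {1..n}" "0 < r" "r \<le> 1" "x = star_point i r"
      using star_setE[OF x] by blast
    moreover from this have "r < s" if "i = j"
      using js k \<open>k = j\<close> that by simp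
    ultimately show thesis
      using js that[of i j r s] by simp
  qed
qed

lemma second_outsideI:
  assumes "i \<in> {1..n}" "j \<in> {1..n}" "0 \<le> r" "r \<le> 1" "0 < s" "s \<le> 1" "i = j \<Longrightarrow> r < s"
  shows "(star_point i r, star_point j s) \<in> second_outside n"
proof -
  have "star_point i r j < star_point j s j"
    using assms by (auto simp: star_point_def)
  moreover have "star_point i r \<noteq> star_point j s"
    using assms by (auto simp: star_point_eq_iff)
  moreover have "star_point i r \<in> star_set n" "star_point j s \<in> star_set n"
    using assms by simp_all
  ultimately show ?thesis
    unfolding second_outside_def configs_def by blast
qed

lemma swap_configs [simp]: "prod.swap p \<in> configs n \<longleftrightarrow> p \<in> configs n"
  by (auto simp: configs_def)

lemma swap_second_outside [simp]: "prod.swap p \<in> second_outside n \<longleftrightarrow> p \<in> first_outside n"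
  by (auto simp: second_outside_def first_outside_def configs_def)

lemma swap_first_outside [simp]: "prod.swap p \<in> first_outside n \<longleftrightarrow> p \<in> second_outside n"
  by (auto simp: second_outside_def first_outside_def configs_def)

lemma swap_different_legs [simp]: "prod.swap p \<in> different_legs n \<longleftrightarrow> p \<in> different_legs n"
  by (auto simp: different_legs_def)

lemma different_legsE:
  assumes "(x, y) \<in> different_legs n"
  obtains i r j s where "i \<in> {1..n}" "j \<in> {1..n}" "i \<noteq> j" "0 < r" "r \<le> 1" "0 < s" "s \<le> 1"
    "x = star_point i r" "y = star_point j s"
proof -
  obtain i r j s where *: "i \<in> {1..n}" "j \<in> {1..n}" "0 \<le> r" "r \<le> 1" "0 < s" "s \<le> 1"
    "i = j \<Longrightarrow> r < s" "x = star_point i r" "y = star_point j s"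
  proof -
    have "(x, y) \<in> second_outside n"
      using assms by (simp add: different_legs_def)
    then show thesis
      by (rule second_outsideE) (rule that)
  qed
  obtain k where "y k < x k"
    using assms by (auto simp: different_legs_def first_outside_def)
  then have "i \<noteq> j" "0 < r"
    using * by (auto simp: star_point_def split: if_splits)
  then show thesis
    using * that by blast
qed

lemma different_legsI:
  assumes "i \<in> {1..n}" "j \<in> {1..n}" "i \<noteq> j" "0 < r" "r \<le> 1" "0 < s" "s \<le> 1"
  shows "(star_point i r, star_point j s) \<in> different_legs n"
  using second_outsideI[of i n j r s] second_outsideI[of j n i s r] assms
    swap_second_outside[of "(star_point i r, star_point j s)" n]
  by (auto simp: different_legs_def)

lemma linear_contraction_swap:
  assumes "linear_contraction D l b"
  shows "linear_contraction (prod.swap -` D) (l \<circ> prod.swap) (prod.swap \<circ> b)"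
  unfolding linear_contraction_def
proof (intro conjI ballI)
  fix p :: config assume p: "p \<in> prod.swap -` D"
  then have "\<exists>G. open G \<and> prod.swap p \<in> G \<and> (\<forall>q\<in>D \<inter> G. l q = l (prod.swap p))"
    using assms unfolding linear_contraction_def vimage_eq by blast
  then obtain G where "open G" "prod.swap p \<in> G" "\<forall>q\<in>D \<inter> G. l q = l (prod.swap p)"
    by blast
  moreover from this have "open (prod.swap -` G)"
    by (intro open_vimage continuous_on_swap)
  ultimately show "\<exists>G. open G \<and> p \<in> G \<and> (\<forall>q\<in>(prod.swap -` D) \<inter> G. (l \<circ> prod.swap) q = (l \<circ> prod.swap) p)"
    by (intro exI[of _ "prod.swap -` G"]) auto
  fix t :: real assume "t \<in> {0..1}"
  then show "segment_point t p ((prod.swap \<circ> b) ((l \<circ> prod.swap) p)) \<in> prod.swap -` D"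
    using assms p segment_point_swap[of t "prod.swap p" "b (l (prod.swap p))"]
    by (auto simp: linear_contraction_def)
qed

text \<open>The first point runs to the centre and the second to its leaf, so on a common leg the
  second stays farther out.\<close>

lemma linear_contraction_second_outside:
  "linear_contraction (second_outside n) (\<lambda>(x, y). leg y) (\<lambda>j. (\<lambda>_. 0, star_point j 1))"
  unfolding linear_contraction_def
proof (intro conjI ballI)
  fix p assume p: "p \<in> second_outside n"
  then obtain i r j s where p_eq: "p = (star_point i r, star_point j s)"
    and *: "i \<in> {1..n}" "j \<in> {1..n}" "0 \<le> r" "r \<le> 1" "0 < s" "s \<le> 1" "i = j \<Longrightarrow> r < s"
    by (cases p) (blast elim: second_outsideE)
  \<comment> \<open>An inequality at coordinate \<open>j\<close> forces the second point onto leg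
    \<open>j\<close> and thus fixes the label.\<close>
  let ?G = "{q :: config. fst q j < snd q j}"
  have "(case q of (x, y) \<Rightarrow> leg y) = (case p of (x, y) \<Rightarrow> leg y)" if "q \<in> second_outside n \<inter> ?G" for q
    using that star_set_nonneg[of "fst q" n j] leg_eqI[of "snd q" n j] *(5)
    by (auto simp: second_outside_def configs_def p_eq)
  moreover have "open ?G"
    by (intro open_Collect_less continuous_intros)
  moreover have "p \<in> ?G"
    using * by (auto simp: p_eq star_point_def)
  ultimately show "\<exists>G. open G \<and> p \<in> G \<and> (\<forall>q\<in>second_outside n \<inter> G. (case q of (x, y) \<Rightarrow> leg y) = (case p of (x, y) \<Rightarrow> leg y))"
    by (intro exI[of _ ?G] conjI ballI)
  fix t :: real assume t: "t \<in> {0..1}"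
  have "segment_point t p (star_point i 0, star_point j 1) \<in> second_outside n"
    unfolding p_eq segment_point_star
  proof (rule second_outsideI)
    show s: "0 < (1 - t) * s + t * 1"
      using * t by (cases "t = 0") (auto intro: add_nonneg_pos)
    show "(1 - t) * s + t * 1 \<le> 1" "(1 - t) * r + t * 0 \<le> 1"
      using * t mult_left_mono[of s 1 "1 - t"] mult_left_mono[of r 1 "1 - t"] by auto
    show "(1 - t) * r + t * 0 < (1 - t) * s + t * 1" if "i = j"
      using * t that mult_left_mono[of r s "1 - t"] by (cases "t = 0") auto
  qed (use * t in auto)
  then show "segment_point t p (\<lambda>_. 0, star_point (case p of (x, y) \<Rightarrow> leg y) 1) \<in> second_outside n"
    using * by (simp add: p_eq)
qed

lemma linear_contraction_first_outside:
  "linear_contraction (first_outside n) (\<lambda>(x, y). leg x) (\<lambda>i. (star_point i 1, \<lambda>_. 0))"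
proof -
  have "prod.swap -` second_outside n = first_outside n"
    by (rule Set.set_eqI) (simp only: vimage_eq swap_second_outside)
  moreover have "(\<lambda>(x :: nat \<Rightarrow> real, y). leg y) \<circ> prod.swap = (\<lambda>(x, y). leg x)"
    "prod.swap \<circ> (\<lambda>j. (\<lambda>_ :: nat. 0 :: real, star_point j 1)) = (\<lambda>i. (star_point i 1, \<lambda>_. 0))"
    by auto
  ultimately show ?thesis
    using linear_contraction_swap[OF linear_contraction_second_outside[of n]] by (simp only:)
qed

lemma convex_le_1: "\<lbrakk>t \<in> {0..1}; r \<le> 1; r' \<le> 1\<rbrakk> \<Longrightarrow> (1 - t) * r + t * r' \<le> (1::real)"
  using convex_bound_le[of r 1 r' "1 - t" t] by auto

lemma convex_less: "\<lbrakk>t \<in> {0..1}; r < s; r' < s'\<rbrakk> \<Longrightarrow> (1 - t) * r + t * r' < (1 - t) * s + t * (s'::real)"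
  by (cases "t = 0") (auto intro!: add_le_less_mono mult_left_mono)

text \<open>Both points run to their leaves and cannot meet, being off the centre on different
  legs.\<close>

lemma linear_contraction_different_legs:
  "linear_contraction (different_legs n) legs (\<lambda>(i, j). (star_point i 1, star_point j 1))"
  unfolding linear_contraction_def
proof (intro conjI ballI)
  fix p assume p: "p \<in> different_legs n"
  then obtain i r j s where p_eq: "p = (star_point i r, star_point j s)"
    and *: "i \<in> {1..n}" "j \<in> {1..n}" "i \<noteq> j" "0 < r" "r \<le> 1" "0 < s" "s \<le> 1"
    by (cases p) (blast elim: different_legsE)
  let ?G = "{q :: config. 0 < fst q i} \<inter> {q. 0 < snd q j}"
  have "legs q = legs p"
    if "q \<in> different_legs n \<inter> ?G" for q
    using that leg_eqI[of "fst q" n i] leg_eqI[of "snd q" n j] *(4,6)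
    by (auto simp: different_legs_def second_outside_def configs_def p_eq)
  moreover have "open ?G"
    by (intro open_Int open_Collect_less continuous_intros)
  moreover have "p \<in> ?G"
    using * by (auto simp: p_eq)
  ultimately show "\<exists>G. open G \<and> p \<in> G \<and> (\<forall>q\<in>different_legs n \<inter> G.
      legs q = legs p)"
    by (intro exI[of _ ?G] conjI ballI)
  fix t :: real assume t: "t \<in> {0..1}"
  have "segment_point t p (star_point i 1, star_point j 1) \<in> different_legs n"
    unfolding p_eq segment_point_star
    using * t convex_less[OF t, of 0 r 0 1] convex_less[OF t, of 0 s 0 1]
    by (intro different_legsI convex_le_1) auto
  then show "segment_point t p (case legs p of (i, j) \<Rightarrow> (star_point i 1, star_point j 1))
      \<in> different_legs n"
    using * by (simp add: p_eq)
qed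

text \<open>For the unordered space: of two points at different distances from the centre, the
  farther one is listed second. No orbit contains two such lists.\<close>

definition second_higher :: "nat \<Rightarrow> config set"
  where "second_higher n = {(x, y) \<in> configs n. height n x < height n y}"

lemma second_higherE:
  assumes "p \<in> second_higher n"
  obtains i r j s where "i \<in> {1..n}" "j \<in> {1..n}" "0 \<le> r" "r < s" "s \<le> 1"
    "p = (star_point i r, star_point j s)"
proof -
  obtain x y where p: "p = (x, y)" and x: "x \<in> star_set n" and y: "y \<in> star_set n"
    and less: "height n x < height n y"
    using assms by (cases p) (auto simp: second_higher_def configs_def)
  have "0 \<le> height n x"
    unfolding height_def by (intro sum_nonneg star_set_nonneg[OF x])
  then have "y \<noteq> (\<lambda>_. 0)"
    using less by auto
  then obtain j s where js: "j \<in> {1..n}" "0 < s" "s \<le> 1" "y = star_point j s"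
    using star_setE[OF y] by blast
  show thesis
  proof (cases "x = (\<lambda>_. 0)")
    case True
    then show thesis
      using js p that[of j j 0 s] by simp
  next
    case False
    then obtain i r where "i \<in> {1..n}" "0 < r" "r \<le> 1" "x = star_point i r"
      using star_setE[OF x] by blast
    then show thesis
      using js p less that[of i j r s] by simp
  qed
qed

lemma second_higherI:
  assumes "i \<in> {1..n}" "j \<in> {1..n}" "0 \<le> r" "r < s" "s \<le> 1"
  shows "(star_point i r, star_point j s) \<in> second_higher n"
  using second_outsideI[of i n j r s] assms
  by (auto simp: second_higher_def second_outside_def)

lemma linear_contraction_second_higher:
  "linear_contraction (second_higher n) (\<lambda>(x, y). leg y) (\<lambda>j. (\<lambda>_. 0, star_point j 1))"
  unfolding linear_contraction_def
proof (intro conjI ballI)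
  fix p assume p: "p \<in> second_higher n"
  then obtain i r j s where p_eq: "p = (star_point i r, star_point j s)"
    and *: "i \<in> {1..n}" "j \<in> {1..n}" "0 \<le> r" "r < s" "s \<le> 1"
    by (rule second_higherE)
  let ?G = "{q :: config. 0 < snd q j}"
  have "(case q of (x, y) \<Rightarrow> leg y) = (case p of (x, y) \<Rightarrow> leg y)" if "q \<in> second_higher n \<inter> ?G" for q
    using that leg_eqI[of "snd q" n j] * by (auto simp: second_higher_def configs_def p_eq)
  moreover have "open ?G"
    by (intro open_Collect_less continuous_intros)
  moreover have "p \<in> ?G"
    using * by (auto simp: p_eq)
  ultimately show "\<exists>G. open G \<and> p \<in> G \<and> (\<forall>q\<in>second_higher n \<inter> G. (case q of (x, y) \<Rightarrow> leg y) = (case p of (x, y) \<Rightarrow> leg y))"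
    by (intro exI[of _ ?G] conjI ballI)
  fix t :: real assume t: "t \<in> {0..1}"
  have "segment_point t p (star_point i 0, star_point j 1) \<in> second_higher n"
    unfolding p_eq segment_point_star
    using * t convex_less[OF t, of r s 0 1]
    by (intro second_higherI convex_le_1) auto
  then show "segment_point t p (\<lambda>_. 0, star_point (case p of (x, y) \<Rightarrow> leg y) 1) \<in> second_higher n"
    using * by (simp add: p_eq)
qed

text \<open>Two leaves would have equal height, so the first point has to stop short of its leaf;
  1/2 is just some number strictly between 0 and 1.\<close>

lemma linear_contraction_second_higher_different_legs:
  "linear_contraction (second_higher n \<inter> different_legs n) legs
    (\<lambda>(i, j). (star_point i (1 / 2), star_point j 1))"
  unfolding linear_contraction_def
proof (intro conjI ballI)
  fix p assume p: "p \<in> second_higher n \<inter> different_legs n"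
  then obtain G where "open G" "p \<in> G" "\<forall>q\<in>different_legs n \<inter> G.
      legs q = legs p"
    using linear_contraction_different_legs[of n] unfolding linear_contraction_def by blast
  then show "\<exists>G. open G \<and> p \<in> G \<and> (\<forall>q\<in>second_higher n \<inter> different_legs n \<inter> G.
      legs q = legs p)"
    by (intro exI[of _ G]) blast
  fix t :: real assume t: "t \<in> {0..1}"
  obtain i r j s where p_eq: "p = (star_point i r, star_point j s)"
    and *: "i \<in> {1..n}" "j \<in> {1..n}" "i \<noteq> j" "0 < r" "r \<le> 1" "0 < s" "s \<le> 1"
    using p by (cases p) (blast elim: different_legsE)
  have "r < s"
    using p * by (simp add: p_eq second_higher_def)
  then have "segment_point t p (star_point i (1 / 2), star_point j 1) \<in> second_higher n \<inter> different_legs n"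
    unfolding p_eq segment_point_star
    using * t convex_less[OF t, of 0 r 0 "1 / 2"] convex_less[OF t, of 0 s 0 1] convex_less[OF t, of r s "1 / 2" 1]
    by (intro IntI different_legsI second_higherI convex_le_1) auto
  then show "segment_point t p (case legs p of
      (i, j) \<Rightarrow> (star_point i (1 / 2), star_point j 1)) \<in> second_higher n \<inter> different_legs n"
    using * by (simp add: p_eq)
qed

subsection \<open>The homology of the ordered configuration space\<close>

lemma open_height_less: "open {q :: config. height n (fst q) < height n (snd q)}"
  by (intro open_Collect_less continuous_intros)

lemma openin_configs:
  "openin (Conf2 (star n)) (second_outside n)" "openin (Conf2 (star n)) (first_outside n)"
  "openin (Conf2 (star n)) (different_legs n)" "openin (Conf2 (star n)) (second_higher n)"
proof -
  have eq: "second_outside n = configs n \<inter> (\<Union>j. {q. fst q j < snd q j})"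
    "first_outside n = configs n \<inter> (\<Union>j. {q. snd q j < fst q j})"
    "second_higher n = configs n \<inter> {q. height n (fst q) < height n (snd q)}"
    by (auto simp: second_outside_def first_outside_def second_higher_def)
  have "open (\<Union>j. {q :: config. fst q j < snd q j})" "open (\<Union>j. {q :: config. snd q j < fst q j})"
    by (intro open_UN ballI open_Collect_less continuous_intros)+
  then show "openin (Conf2 (star n)) (second_outside n)" "openin (Conf2 (star n)) (first_outside n)"
    "openin (Conf2 (star n)) (second_higher n)"
    unfolding eq Conf2_star by (auto intro!: openin_open_Int open_height_less)
  then show "openin (Conf2 (star n)) (different_legs n)"
    by (simp add: different_legs_def openin_Int)
qed

lemma subset_configs:
  "second_outside n \<subseteq> configs n" "first_outside n \<subseteq> configs n"
  "different_legs n \<subseteq> configs n" "second_higher n \<subseteq> configs n"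
  by (auto simp: different_legs_def second_outside_def first_outside_def second_higher_def)

lemma subtopology_Conf2_star: "D \<subseteq> configs n \<Longrightarrow> subtopology (Conf2 (star n)) D = top_of_set D"
  by (simp add: Conf2_star subtopology_subtopology Int_absorb1)

lemma configs_cover: "configs n \<subseteq> second_outside n \<union> first_outside n"
proof
  fix p assume p: "p \<in> configs n"
  then obtain j where "fst p j \<noteq> snd p j"
    by (cases p) (auto simp: configs_def)
  then show "p \<in> second_outside n \<union> first_outside n"
    using p by (cases p) (auto simp: second_outside_def first_outside_def neq_iff)
qed

definition off_diagonal :: "nat \<Rightarrow> (nat \<times> nat) set"
  where "off_diagonal n = {(i, j). i \<in> {1..n} \<and> j \<in> {1..n} \<and> i \<noteq> j}"

lemma finite_off_diagonal [simp]: "finite (off_diagonal n)"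
  by (rule finite_subset[of _ "{1..n} \<times> {1..n}"]) (auto simp: off_diagonal_def)

lemma leg_image_different_legs: "legs ` different_legs n = off_diagonal n"
proof
  show "legs ` different_legs n \<subseteq> off_diagonal n"
    by (auto simp: off_diagonal_def elim!: different_legsE)
  show "off_diagonal n \<subseteq> legs ` different_legs n"
  proof
    fix e assume "e \<in> off_diagonal n"
    then obtain i j where e: "e = (i, j)" "i \<in> {1..n}" "j \<in> {1..n}" "i \<noteq> j"
      by (auto simp: off_diagonal_def)
    have "(star_point i 1, star_point j 1) \<in> different_legs n"
      using e by (intro different_legsI) auto
    then show "e \<in> legs ` different_legs n"
      by (rule rev_image_eqI) (simp add: e)
  qed
qed

text \<open>On \<open>second_outside\<close> the component is the leg of the second point, on
  \<open>first_outside\<close> that of the first. An edge \<open>(i, j)\<close> therefore has the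
  ends \<open>j\<close> and \<open>i\<close>, whence \<open>snd\<close> and \<open>fst\<close> as
  projections.\<close>

global_interpretation Conf: mayer_vietoris "Conf2 (star n)" "second_outside n" "first_outside n"
    "\<lambda>(x, y). leg y" "\<lambda>j. (\<lambda>_. 0, star_point j 1)"
    "\<lambda>(x, y). leg x" "\<lambda>i. (star_point i 1, \<lambda>_. 0)"
    legs "\<lambda>(i, j). (star_point i 1, star_point j 1)"
    snd fst
  for n
proof unfold_locales
  show "topspace (Conf2 (star n)) \<subseteq> second_outside n \<union> first_outside n"
    using configs_cover by simp
  show "contracts_to_discrete (subtopology (Conf2 (star n)) (second_outside n \<inter> first_outside n))
      legs (\<lambda>(i, j). (star_point i 1, star_point j 1))"
    using linear_contraction_contracts[OF linear_contraction_different_legs[of n]] subset_configs(3)[of n]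
    by (simp add: subtopology_Conf2_star flip: different_legs_def)
qed (use openin_configs subset_configs linear_contraction_contracts[OF linear_contraction_second_outside]
    linear_contraction_contracts[OF linear_contraction_first_outside] in
    \<open>auto simp: subtopology_Conf2_star\<close>)

text \<open>Read as matrices: \<open>push fst\<close> gives the row sums and \<open>push snd\<close>
  the column sums.\<close>

definition zero_sum_flows :: "nat \<Rightarrow> (nat \<times> nat \<Rightarrow>\<^sub>0 rat) set"
  where "zero_sum_flows n = {f. keys f \<subseteq> off_diagonal n \<and> push snd f = 0 \<and> push fst f = 0}"

lemma Conf_flows_eq: "Conf.flows n = zero_sum_flows n"
proof -
  have "configs n \<inter> second_outside n \<inter> first_outside n = different_legs n"
    using subset_configs by (auto simp: different_legs_def)
  then show ?thesis
    by (simp add: Conf.flows_def zero_sum_flows_def leg_image_different_legs)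
qed

section \<open>Induced maps of stars and the permutation action on the regions\<close>

lemma star_map_in_star_set:
  assumes "f \<in> FI_hom m n" "x \<in> star_set m"
  shows "star_map m f x \<in> star_set n"
proof (cases "x = (\<lambda>_. 0)")
  case False
  then obtain i t where "i \<in> {1..m}" "0 < t" "t \<le> 1" "x = star_point i t"
    using star_setE[OF assms(2)] by blast
  then show ?thesis
    using assms(1) by (auto simp: star_map_star_point FI_hom_def PiE_iff)
qed (simp add: star_map_zero)

lemma star_map_at:
  assumes "f \<in> FI_hom m n" "i \<in> {1..m}"
  shows "star_map m f x (f i) = x i"
proof -
  have "{k \<in> {1..m}. f k = f i} = {i}"
    using assms inj_on_eq_iff[of f "{1..m}"] by (auto simp: FI_hom_def simp del: atLeastAtMost_iff)
  then show ?thesis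
    by (simp add: star_map_def)
qed

lemma star_map_inj:
  assumes f: "f \<in> FI_hom m n" and x: "x \<in> star_set m" and y: "y \<in> star_set m"
    and eq: "star_map m f x = star_map m f y"
  shows "x = y"
proof
  fix i
  show "x i = y i"
  proof (cases "i \<in> {1..m}")
    case True
    then show ?thesis
      using star_map_at[OF f True, of x] star_map_at[OF f True, of y] eq by simp
  next
    case False
    then show ?thesis
      using x y by (auto simp: star_set_def star_point_def)
  qed
qed

lemma Conf2_map_in_configs:
  "\<lbrakk>f \<in> FI_hom m n; p \<in> configs m\<rbrakk> \<Longrightarrow> Conf2_map (star_map m f) p \<in> configs n"
  by (cases p) (auto simp: configs_def Conf2_map_def star_map_in_star_set dest: star_map_inj)

lemma continuous_map_Conf2_map:
  assumes "f \<in> FI_hom m n"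
  shows "continuous_map (Conf2 (star m)) (Conf2 (star n)) (Conf2_map (star_map m f))"
proof -
  have "continuous_on (configs m) (Conf2_map (star_map m f))"
    unfolding Conf2_map_def star_map_def map_prod_def case_prod_unfold
    by (intro continuous_on_Pair continuous_on_coordinatewise_then_product; intro continuous_intros)
  then show ?thesis
    using Conf2_map_in_configs[OF assms] by (simp add: Conf2_star continuous_map_in_subtopology image_subset_iff)
qed

lemma star_map_id:
  assumes "x \<in> star_set n"
  shows "star_map n (\<lambda>i\<in>{1..n}. i) x = x"
proof (cases "x = (\<lambda>_. 0)")
  case False
  then obtain i t where "i \<in> {1..n}" "0 < t" "t \<le> 1" "x = star_point i t"
    using star_setE[OF assms] by blast
  then show ?thesis
    using star_map_star_point[of i n "\<lambda>i\<in>{1..n}. i" t] by simp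
qed (simp add: star_map_zero)

lemma star_map_compose:
  assumes "f \<in> FI_hom l m" "x \<in> star_set l"
  shows "star_map l (compose {1..l} g f) x = star_map m g (star_map l f x)"
proof (cases "x = (\<lambda>_. 0)")
  case False
  then obtain i t where i: "i \<in> {1..l}" "0 < t" "t \<le> 1" "x = star_point i t"
    using star_setE[OF assms(2)] by blast
  moreover have "f i \<in> {1..m}"
    using assms(1) i(1) by (auto simp: FI_hom_def)
  ultimately show ?thesis
    using star_map_star_point[OF i(1), of "compose {1..l} g f" t] star_map_star_point[OF i(1), of f t]
      star_map_star_point[of "f i" m g t] by (simp add: compose_def)
qed (simp add: star_map_zero)

lemma restrict_permutes_FI_hom:
  assumes "\<sigma> permutes {1..n}"
  shows "restrict \<sigma> {1..n} \<in> FI_hom n n"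
  using permutes_in_image[OF assms] permutes_inj_on[OF assms]
  by (simp add: FI_hom_def restrict_PiE_iff inj_on_restrict_eq)

lemma star_map_permutes:
  "\<lbrakk>\<sigma> permutes {1..n}; i \<in> {1..n}\<rbrakk> \<Longrightarrow>
    star_map n (restrict \<sigma> {1..n}) (star_point i t) = star_point (\<sigma> i) t"
  using star_map_star_point[of i n "restrict \<sigma> {1..n}" t] by simp

context
  fixes n :: nat and \<sigma> :: "nat \<Rightarrow> nat"
  assumes \<sigma>: "\<sigma> permutes {1..n}"
begin

abbreviation "\<sigma>_map \<equiv> Conf2_map (star_map n (restrict \<sigma> {1..n}))"

lemma permutes_second_outside: "p \<in> second_outside n \<Longrightarrow> \<sigma>_map p \<in> second_outside n"
proof (cases p)
  fix x y assume p: "p \<in> second_outside n" "p = (x, y)"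
  then have "(x, y) \<in> second_outside n"
    by simp
  then show ?thesis
  proof (rule second_outsideE)
    fix i r j s
    assume *: "i \<in> {1..n}" "j \<in> {1..n}" "0 \<le> r" "r \<le> 1" "0 < s" "s \<le> 1"
      "i = j \<Longrightarrow> r < s" "x = star_point i r" "y = star_point j s"
    have "\<sigma> i \<in> {1..n}" "\<sigma> j \<in> {1..n}" "\<sigma> i = \<sigma> j \<Longrightarrow> i = j"
      using * permutes_in_image[OF \<sigma>] permutes_inj[OF \<sigma>, THEN injD] by blast+
    then have "(star_point (\<sigma> i) r, star_point (\<sigma> j) s) \<in> second_outside n"
      using * by (intro second_outsideI) auto
    then show ?thesis
      using * by (simp add: p(2) Conf2_map_def star_map_permutes[OF \<sigma>] del: One_nat_def)
  qed
qed

lemma \<sigma>_map_swap: "\<sigma>_map (prod.swap p) = prod.swap (\<sigma>_map p)"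
  by (cases p) (simp add: Conf2_map_def)

lemma permutes_first_outside: "p \<in> first_outside n \<Longrightarrow> \<sigma>_map p \<in> first_outside n"
  using permutes_second_outside[of "prod.swap p"] \<sigma>_map_swap[of p]
  by (metis swap_first_outside swap_second_outside)

lemma permutes_different_legs:
  "p \<in> different_legs n \<Longrightarrow> \<sigma>_map p \<in> different_legs n \<and>
    leg (fst (\<sigma>_map p)) = \<sigma> (leg (fst p)) \<and> leg (snd (\<sigma>_map p)) = \<sigma> (leg (snd p))"
proof (cases p)
  fix x y assume p: "p \<in> different_legs n" "p = (x, y)"
  then have "(x, y) \<in> different_legs n"
    by simp
  then obtain i r j s where *: "i \<in> {1..n}" "j \<in> {1..n}" "0 < r" "0 < s"
    "x = star_point i r" "y = star_point j s"
    by (rule different_legsE)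
  moreover have "\<sigma>_map p \<in> different_legs n"
    using p permutes_second_outside permutes_first_outside by (simp add: different_legs_def)
  ultimately show ?thesis
    using p by (simp add: Conf2_map_def star_map_permutes[OF \<sigma>] del: One_nat_def)
qed

lemma permutes_second_higher: "p \<in> second_higher n \<Longrightarrow> \<sigma>_map p \<in> second_higher n"
proof (erule second_higherE)
  fix i r j s
  assume *: "i \<in> {1..n}" "j \<in> {1..n}" "0 \<le> r" "r < s" "s \<le> (1::real)" and p: "p = (star_point i r, star_point j s)"
  then have "(star_point (\<sigma> i) r, star_point (\<sigma> j) s) \<in> second_higher n"
    using permutes_in_image[OF \<sigma>] by (intro second_higherI) auto
  then show ?thesis
    using * by (simp add: p Conf2_map_def star_map_permutes[OF \<sigma>] del: One_nat_def)
qed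

end

lemma Conf_flow_natural:
  assumes \<sigma>: "\<sigma> permutes {1..n}" and C: "C \<in> carrier (H1_Conf2_star n)"
  shows "Conf.flow n (H1_Conf2_star_map n n (restrict \<sigma> {1..n}) C) = push (map_prod \<sigma> \<sigma>) (Conf.flow n C)"
  unfolding H1_Conf2_star_map_def One_nat_def
proof (rule Conf.flow_natural)
  show "continuous_map (Conf2 (star n)) (Conf2 (star n)) (Conf2_map (star_map n (restrict \<sigma> {Suc 0..n})))"
    using continuous_map_Conf2_map[OF restrict_permutes_FI_hom[OF \<sigma>]] by simp
  show "C \<in> carrier (rat_homology (Suc 0) (Conf2 (star n)))"
    using C by (simp add: H1_Conf2_star_def)
next
  fix p assume "p \<in> second_outside n" "p \<in> first_outside n"
  then show "legs (Conf2_map (star_map n (restrict \<sigma> {Suc 0..n})) p) =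
      map_prod \<sigma> \<sigma> (legs p)"
    using permutes_different_legs[OF \<sigma>, of p] by (simp add: case_prod_unfold different_legs_def)
qed (use permutes_second_outside[OF \<sigma>] permutes_first_outside[OF \<sigma>] in auto)

lemma H1_Conf2_star_flow:
  "Conf.flow n \<in> linear_maps (H1_Conf2_star n) (subspace_of_free (zero_sum_flows n))"
  "bij_betw (Conf.flow n) (carrier (H1_Conf2_star n)) (zero_sum_flows n)"
  using Conf.flow_linear[of n] Conf.flow_bij[of n] by (simp_all add: H1_Conf2_star_def Conf_flows_eq)

lemma FI_module_H1_Conf2_star: "FI_module H1_Conf2_star H1_Conf2_star_map"
proof -
  have "FI_module (\<lambda>n. rat_homology 1 (Conf2 (star n)))
      (\<lambda>m n f. rat_homology_map 1 (Conf2 (star n)) (Conf2_map (star_map m f)))"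
  proof (rule FI_module_rat_homology)
    show "finite_dimensional (rat_homology 1 (Conf2 (star n)))" for n
    proof (rule finite_dimensional_if_inj[OF module_rat_homology])
      show "Conf.flow n \<in> linear_maps (rat_homology 1 (Conf2 (star n))) (subspace_of_free (zero_sum_flows n))"
        "inj_on (Conf.flow n) (carrier (rat_homology 1 (Conf2 (star n))))"
        using H1_Conf2_star_flow[of n] by (auto simp: H1_Conf2_star_def bij_betw_def)
      show "keys (Conf.flow n v) \<subseteq> off_diagonal n"
        if "v \<in> carrier (rat_homology 1 (Conf2 (star n)))" for v
        using that H1_Conf2_star_flow(2)[of n] bij_betwE
        by (fastforce simp: H1_Conf2_star_def zero_sum_flows_def)
    qed simp
    show "Conf2_map (star_map n (\<lambda>i\<in>{1..n}. i)) p = p" if "p \<in> topspace (Conf2 (star n))" for n p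
      using that by (cases p) (auto simp: Conf2_map_def configs_def star_map_id simp del: One_nat_def)
    show "Conf2_map (star_map l (compose {1..l} g f)) p = Conf2_map (star_map m g) (Conf2_map (star_map l f) p)"
      if "f \<in> FI_hom l m" "p \<in> topspace (Conf2 (star l))" for l m f g p
      using that by (cases p) (auto simp: Conf2_map_def configs_def star_map_compose simp del: One_nat_def)
  qed (rule continuous_map_Conf2_map)
  then show ?thesis
    by (simp add: H1_Conf2_star_def[abs_def] H1_Conf2_star_map_def[abs_def])
qed

subsection \<open>The homology of the unordered configuration space\<close>

lemma contracts_to_discrete_homeomorphic:
  assumes q: "homeomorphic_map Y Y' q" and Y: "contracts_to_discrete Y l b"
  shows "contracts_to_discrete Y' (l \<circ> inv_into (topspace Y) q) (q \<circ> b)"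
proof -
  define g where "g = inv_into (topspace Y) q"
  obtain h where h: "homeomorphic_maps Y Y' q h"
    using q homeomorphic_map_maps by blast
  have q_cont: "continuous_map Y Y' q" and hq: "\<And>y. y \<in> topspace Y \<Longrightarrow> h (q y) = y"
    and img: "q ` topspace Y = topspace Y'"
    using h homeomorphic_imp_surjective_map[OF q] by (auto simp: homeomorphic_maps_def)
  have gh: "g y = h y" "q (g y) = y" if y: "y \<in> topspace Y'" for y
  proof -
    obtain x where x: "x \<in> topspace Y" "y = q x"
      using y unfolding img[symmetric] by blast
    then have "g y = x"
      unfolding g_def x(2) using hq by (intro inv_into_f_f) (auto intro: inj_on_inverseI)
    then show "g y = h y" "q (g y) = y"
      using x hq by simp_all
  qed
  have "continuous_map Y' Y h"
    using h by (simp add: homeomorphic_maps_def)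
  then have g_cont: "continuous_map Y' Y g"
    by (rule continuous_map_eq) (simp add: gh)
  have hom: "homotopic_with (\<lambda>_. True) Y Y id (b \<circ> l)" and l: "continuous_map Y (discrete_topology UNIV) l"
    using Y by (auto simp: contracts_to_discrete_def)
  from hom have "homotopic_with (\<lambda>_. True) Y' Y (id \<circ> g) ((b \<circ> l) \<circ> g)"
    by (rule homotopic_with_compose_continuous_map_right[OF _ g_cont]) simp
  then have "homotopic_with (\<lambda>_. True) Y' Y' (q \<circ> (id \<circ> g)) (q \<circ> ((b \<circ> l) \<circ> g))"
    by (rule homotopic_with_compose_continuous_map_left[OF _ q_cont]) simp
  then have "homotopic_with (\<lambda>_. True) Y' Y' id ((q \<circ> b) \<circ> (l \<circ> g))"
    by (rule homotopic_with_eq) (simp_all add: gh(2))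
  then show ?thesis
    using continuous_map_compose[OF g_cont l] by (simp add: contracts_to_discrete_def g_def)
qed

lemma swap_orbit_eq_iff: "swap_orbit p = swap_orbit q \<longleftrightarrow> p = q \<or> p = prod.swap q"
  by (cases p; cases q) (auto simp: swap_orbit_def doubleton_eq_iff)

lemma swap_orbit_swap [simp]: "swap_orbit (prod.swap p) = swap_orbit p"
  by (simp add: swap_orbit_eq_iff)

lemma topspace_UConf2_star [simp]: "topspace (UConf2 (star n)) = swap_orbit ` configs n"
  by (simp add: UConf2_def topspace_quotient_topology)

lemma continuous_map_swap_configs: "continuous_map (Conf2 (star n)) (Conf2 (star n)) prod.swap"
  by (auto simp: Conf2_star continuous_map_in_subtopology continuous_on_swap Pi_iff
      simp del: swap_configs) (metis swap_configs swap_simp)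

text \<open>The full preimage of the image of \<open>D\<close> is \<open>D\<close> together with its
  mirror image, which is open because the swap is continuous.\<close>

lemma openin_swap_orbit_image:
  assumes "openin (Conf2 (star n)) D"
  shows "openin (UConf2 (star n)) (swap_orbit ` D)"
proof -
  have D: "D \<subseteq> configs n"
    using openin_subset[OF assms] by simp
  have eq: "{p \<in> topspace (Conf2 (star n)). swap_orbit p \<in> swap_orbit ` D} =
      D \<union> {p \<in> topspace (Conf2 (star n)). prod.swap p \<in> D}"
    using D by (auto simp: image_iff swap_orbit_eq_iff simp del: swap_configs)
      (metis swap_configs swap_simp subsetD)+
  have "openin (Conf2 (star n)) {p \<in> topspace (Conf2 (star n)). prod.swap p \<in> D}"
    by (rule openin_continuous_map_preimage[OF continuous_map_swap_configs assms])
  then show ?thesis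
    using D assms unfolding UConf2_def openin_quotient_topology eq by auto
qed

context
  fixes n :: nat and D :: "config set"
  assumes D_open: "openin (Conf2 (star n)) D" and D_swap: "\<And>p. p \<in> D \<Longrightarrow> prod.swap p \<notin> D"
begin

lemma half_subset: "D \<subseteq> configs n"
  using openin_subset[OF D_open] by simp

lemma inj_on_swap_orbit: "inj_on swap_orbit D"
  using D_swap by (auto simp: inj_on_def swap_orbit_eq_iff)

text \<open>The orbit map is continuous and open, and it is injective on \<open>D\<close> because
  \<open>D\<close> never contains both orderings of a pair.\<close>

lemma half_homeomorphic:
  "homeomorphic_map (subtopology (Conf2 (star n)) D) (subtopology (UConf2 (star n)) (swap_orbit ` D)) swap_orbit"
proof (rule bijective_open_imp_homeomorphic_map)
  have "continuous_map (Conf2 (star n)) (UConf2 (star n)) swap_orbit"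
    unfolding UConf2_def by (rule quotient_imp_continuous_map[OF quotient_map_quotient_topology])
  then show "continuous_map (subtopology (Conf2 (star n)) D) (subtopology (UConf2 (star n)) (swap_orbit ` D)) swap_orbit"
    by (auto simp: continuous_map_in_subtopology continuous_map_from_subtopology)
  show "open_map (subtopology (Conf2 (star n)) D) (subtopology (UConf2 (star n)) (swap_orbit ` D)) swap_orbit"
    unfolding open_map_def
    using openin_swap_orbit_image
    by (auto simp: openin_open_subtopology[OF D_open] openin_open_subtopology[OF openin_swap_orbit_image[OF D_open]])
  show "swap_orbit ` topspace (subtopology (Conf2 (star n)) D) =
      topspace (subtopology (UConf2 (star n)) (swap_orbit ` D))"
    using half_subset by auto
  show "inj_on swap_orbit (topspace (subtopology (Conf2 (star n)) D))"
    using inj_on_swap_orbit by (rule inj_on_subset) auto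
qed

text \<open>Carries the straight-line contractions over to the quotient, so that no homotopy has to
  be constructed there by hand.\<close>

lemma half_contracts:
  assumes "linear_contraction D l b"
  shows "contracts_to_discrete (subtopology (UConf2 (star n)) (swap_orbit ` D))
    (l \<circ> inv_into D swap_orbit) (swap_orbit \<circ> b)"
proof -
  have "contracts_to_discrete (subtopology (Conf2 (star n)) D) l b"
    using linear_contraction_contracts[OF assms] by (simp add: subtopology_Conf2_star half_subset)
  then show ?thesis
    using contracts_to_discrete_homeomorphic[OF half_homeomorphic] half_subset
    by (simp add: Int_absorb1)
qed

end

section \<open>Representatives of unordered configurations\<close>

text \<open>Selects one ordering of every pair of points on different legs. Permutations of the legs
  need not preserve this set, but they preserve its image in the orbit space, which is that of
  \<open>different_legs\<close>.\<close>

definition sorted_legs :: "nat \<Rightarrow> config set"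
  where "sorted_legs n = {(x, y) \<in> different_legs n. leg x < leg y}"

text \<open>The pair of legs is locally constant on \<open>different_legs\<close>, so every
  condition on it is open.\<close>

lemma openin_sorted_legs: "openin (Conf2 (star n)) (sorted_legs n)"
proof -
  have "openin (top_of_set (different_legs n))
      {p \<in> topspace (top_of_set (different_legs n)). legs p \<in> {(i, j). i < j}}"
    by (rule openin_continuous_map_preimage[OF
          linear_contraction_continuous_label[OF linear_contraction_different_legs]]) simp
  moreover have "{p \<in> topspace (top_of_set (different_legs n)). legs p \<in> {(i, j). i < j}} =
      sorted_legs n"
    by (auto simp: sorted_legs_def)
  ultimately have "openin (subtopology (Conf2 (star n)) (different_legs n)) (sorted_legs n)"
    by (simp add: subtopology_Conf2_star subset_configs)
  then show ?thesis
    using openin_configs(3) openin_trans_full by blast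
qed

lemma linear_contraction_sorted_legs:
  "linear_contraction (sorted_legs n) legs (\<lambda>(i, j). (star_point i 1, star_point j 1))"
  unfolding linear_contraction_def
proof (intro conjI ballI)
  fix p assume p: "p \<in> sorted_legs n"
  then have "p \<in> different_legs n"
    by (auto simp: sorted_legs_def)
  then obtain G where "open G" "p \<in> G" "\<forall>q\<in>different_legs n \<inter> G.
      legs q = legs p"
    using linear_contraction_different_legs[of n] unfolding linear_contraction_def by blast
  moreover have "sorted_legs n \<subseteq> different_legs n"
    by (auto simp: sorted_legs_def)
  ultimately show "\<exists>G. open G \<and> p \<in> G \<and> (\<forall>q\<in>sorted_legs n \<inter> G.
      legs q = legs p)"
    by (intro exI[of _ G]) blast
  fix t :: real assume t: "t \<in> {0..1}"
  obtain i r j s where p_eq: "p = (star_point i r, star_point j s)"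
    and *: "i \<in> {1..n}" "j \<in> {1..n}" "i \<noteq> j" "0 < r" "r \<le> 1" "0 < s" "s \<le> 1"
    using \<open>p \<in> different_legs n\<close> by (cases p) (blast elim: different_legsE)
  have pos: "0 < (1 - t) * r + t * 1" "0 < (1 - t) * s + t * 1"
    using * t convex_less[OF t, of 0 r 0 1] convex_less[OF t, of 0 s 0 1] by auto
  then have "(star_point i ((1 - t) * r + t * 1), star_point j ((1 - t) * s + t * 1)) \<in> different_legs n"
    using * t by (intro different_legsI convex_le_1) auto
  then have "segment_point t p (star_point i 1, star_point j 1) \<in> sorted_legs n"
    unfolding p_eq segment_point_star using p pos * by (auto simp: sorted_legs_def p_eq)
  then show "segment_point t p (case legs p of (i, j) \<Rightarrow> (star_point i 1, star_point j 1))
      \<in> sorted_legs n"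
    using * by (simp add: p_eq)
qed

lemma second_higher_swap: "p \<in> second_higher n \<Longrightarrow> prod.swap p \<notin> second_higher n"
  by (auto simp: second_higher_def)

lemma sorted_legs_swap: "p \<in> sorted_legs n \<Longrightarrow> prod.swap p \<notin> sorted_legs n"
  by (auto simp: sorted_legs_def)

lemma different_legs_neq:
  assumes "p \<in> different_legs n"
  shows "leg (fst p) \<noteq> leg (snd p)"
proof (cases p)
  case (Pair x y)
  then have "(x, y) \<in> different_legs n"
    using assms by simp
  then show ?thesis
    by (rule different_legsE) (simp add: Pair)
qed

lemma different_legs_sorted:
  assumes "p \<in> different_legs n"
  shows "p \<in> sorted_legs n \<or> prod.swap p \<in> sorted_legs n"
  using assms different_legs_neq[OF assms] swap_different_legs[of p n]
  by (cases p) (auto simp: sorted_legs_def)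

definition sort_pair :: "nat \<times> nat \<Rightarrow> nat \<times> nat"
  where "sort_pair = (\<lambda>(i, j). (min i j, max i j))"

lemma higher_orbit [simp]: "p \<in> second_higher n \<Longrightarrow> inv_into (second_higher n) swap_orbit (swap_orbit p) = p"
  by (intro inv_into_f_f inj_on_swap_orbit[where n = n] openin_configs second_higher_swap)

lemma higher_different_orbit:
  "\<lbrakk>p \<in> second_higher n; p \<in> different_legs n\<rbrakk> \<Longrightarrow>
    inv_into (second_higher n \<inter> different_legs n) swap_orbit (swap_orbit p) = p"
  by (intro inv_into_f_f inj_on_swap_orbit[where n = n] openin_Int openin_configs)
    (auto dest: second_higher_swap)

abbreviation "outer_leg n \<equiv> (\<lambda>(x, y). leg y) \<circ> inv_into (second_higher n) swap_orbit"
abbreviation "increasing_legs n \<equiv> legs \<circ> inv_into (sorted_legs n) swap_orbit"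
abbreviation "inner_outer_legs n \<equiv> legs \<circ> inv_into (second_higher n \<inter> different_legs n) swap_orbit"

lemma sorted_orbit:
  assumes "p \<in> different_legs n"
  shows "legs (inv_into (sorted_legs n) swap_orbit (swap_orbit p)) =
    sort_pair (leg (fst p), leg (snd p))"
proof -
  have *: "inv_into (sorted_legs n) swap_orbit (swap_orbit q) = q" if "q \<in> sorted_legs n" for q
    using that by (intro inv_into_f_f inj_on_swap_orbit[where n = n] openin_sorted_legs sorted_legs_swap)
  from different_legs_sorted[OF assms] show ?thesis
  proof
    assume "p \<in> sorted_legs n"
    then show ?thesis
      using * by (auto simp: sort_pair_def sorted_legs_def)
  next
    assume "prod.swap p \<in> sorted_legs n"
    then have "inv_into (sorted_legs n) swap_orbit (swap_orbit p) = prod.swap p" "leg (snd p) < leg (fst p)"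
      using *[of "prod.swap p"] by (simp, cases p, simp add: sorted_legs_def)
    then show ?thesis
      by (simp add: sort_pair_def case_prod_unfold)
  qed
qed

text \<open>The representatives of an orbit in the two pieces may be mirror images of each other.
  Since \<open>different_legs\<close> is symmetric, the one with the farther point second can always
  be used.\<close>

lemma orbit_Int: "swap_orbit ` second_higher n \<inter> swap_orbit ` sorted_legs n =
    swap_orbit ` (second_higher n \<inter> different_legs n)"
proof (intro equalityI subsetI)
  fix P assume "P \<in> swap_orbit ` second_higher n \<inter> swap_orbit ` sorted_legs n"
  then obtain p q where pq: "p \<in> second_higher n" "q \<in> sorted_legs n" "P = swap_orbit p" "swap_orbit p = swap_orbit q"
    by auto
  then have "p = q \<or> p = prod.swap q" "q \<in> different_legs n"
    by (auto simp: swap_orbit_eq_iff sorted_legs_def)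
  then have "p \<in> different_legs n"
    by auto
  then show "P \<in> swap_orbit ` (second_higher n \<inter> different_legs n)"
    using pq by blast
next
  fix P assume "P \<in> swap_orbit ` (second_higher n \<inter> different_legs n)"
  then obtain p where p: "p \<in> second_higher n" "p \<in> different_legs n" "P = swap_orbit p"
    by blast
  then have "P \<in> swap_orbit ` sorted_legs n"
    using different_legs_sorted[OF p(2)] swap_orbit_swap by (metis imageI)
  then show "P \<in> swap_orbit ` second_higher n \<inter> swap_orbit ` sorted_legs n"
    using p by blast
qed

text \<open>Two distinct points of equal height are both off the centre and must lie on different
  legs.\<close>

lemma orbits_cover:
  "swap_orbit ` configs n \<subseteq> swap_orbit ` second_higher n \<union> swap_orbit ` sorted_legs n"
proof
  fix P assume "P \<in> swap_orbit ` configs n"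
  then obtain p where p: "p \<in> configs n" "P = swap_orbit p"
    by blast
  consider "p \<in> second_higher n" | "prod.swap p \<in> second_higher n" | "p \<in> different_legs n"
  proof (cases "height n (fst p) = height n (snd p)")
    case False
    then have "p \<in> second_higher n \<or> prod.swap p \<in> second_higher n"
      using p by (cases p) (auto simp: second_higher_def configs_def)
    then show thesis
      using that by blast
  next
    case True
    obtain x y where xy: "p = (x, y)" "x \<in> star_set n" "y \<in> star_set n" "x \<noteq> y" "height n x = height n y"
      using p True by (cases p) (auto simp: configs_def)
    have zero: "z = (\<lambda>_. 0)" if z: "z \<in> star_set n" "height n z = 0" for z
    proof (rule ccontr)
      assume "z \<noteq> (\<lambda>_. 0)"
      then obtain i t where "i \<in> {1..n}" "0 < t" "z = star_point i t"
        using star_setE[OF z(1)] by blast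
      then show False
        using z(2) by simp
    qed
    have x0: "x \<noteq> (\<lambda>_. 0)"
      using zero[OF xy(3)] xy(4,5) height_zero by metis
    have y0: "y \<noteq> (\<lambda>_. 0)"
      using zero[OF xy(2)] xy(4,5) height_zero by metis
    obtain i r where ir: "i \<in> {1..n}" "0 < r" "r \<le> 1" "x = star_point i r"
      using star_setE[OF xy(2) x0] by blast
    obtain j s where js: "j \<in> {1..n}" "0 < s" "s \<le> 1" "y = star_point j s"
      using star_setE[OF xy(3) y0] by blast
    have "r = s"
      using xy(5) ir js by simp
    then have "i \<noteq> j"
      using xy(4) ir js by auto
    then have "p \<in> different_legs n"
      using different_legsI[of i n j r s] ir js xy(1) by simp
    then show thesis
      using that by blast
  qed
  then show "P \<in> swap_orbit ` second_higher n \<union> swap_orbit ` sorted_legs n"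
    using different_legs_sorted p(2) swap_orbit_swap by (metis UnCI imageI)
qed

text \<open>An edge here is a half-edge of the complete graph: the pair \<open>(i, j)\<close> of
  inner and outer leg joins the vertex \<open>j\<close> to the midpoint of the edge between
  \<open>i\<close> and \<open>j\<close>. The midpoint is named by the increasing pair, hence
  \<open>sort_pair\<close>.\<close>

global_interpretation UConf: mayer_vietoris "UConf2 (star n)" "swap_orbit ` second_higher n"
    "swap_orbit ` sorted_legs n"
    "outer_leg n"
    "swap_orbit \<circ> (\<lambda>j. (\<lambda>_. 0, star_point j 1))"
    "increasing_legs n"
    "swap_orbit \<circ> (\<lambda>(i, j). (star_point i 1, star_point j 1))"
    "inner_outer_legs n"
    "swap_orbit \<circ> (\<lambda>(i, j). (star_point i (1 / 2), star_point j 1))"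
    snd sort_pair
  for n
proof
  show "openin (UConf2 (star n)) (swap_orbit ` second_higher n)"
    "openin (UConf2 (star n)) (swap_orbit ` sorted_legs n)"
    by (intro openin_swap_orbit_image openin_configs openin_sorted_legs)+
  show "topspace (UConf2 (star n)) \<subseteq> swap_orbit ` second_higher n \<union> swap_orbit ` sorted_legs n"
    using orbits_cover by simp
  show "contracts_to_discrete (subtopology (UConf2 (star n)) (swap_orbit ` second_higher n))
      (outer_leg n) (swap_orbit \<circ> (\<lambda>j. (\<lambda>_. 0, star_point j 1)))"
    by (intro half_contracts openin_configs second_higher_swap linear_contraction_second_higher)
  show "contracts_to_discrete (subtopology (UConf2 (star n)) (swap_orbit ` sorted_legs n))
      (increasing_legs n)
      (swap_orbit \<circ> (\<lambda>(i, j). (star_point i 1, star_point j 1)))"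
    by (intro half_contracts openin_sorted_legs sorted_legs_swap linear_contraction_sorted_legs)
  show "contracts_to_discrete
      (subtopology (UConf2 (star n)) (swap_orbit ` second_higher n \<inter> swap_orbit ` sorted_legs n))
      (inner_outer_legs n)
      (swap_orbit \<circ> (\<lambda>(i, j). (star_point i (1 / 2), star_point j 1)))"
    unfolding orbit_Int
    by (intro half_contracts openin_Int openin_configs linear_contraction_second_higher_different_legs)
      (auto dest: second_higher_swap)
  fix P assume "P \<in> swap_orbit ` second_higher n" "P \<in> swap_orbit ` sorted_legs n"
  then have "P \<in> swap_orbit ` (second_higher n \<inter> different_legs n)"
    unfolding orbit_Int[symmetric] by simp
  then obtain p where p: "p \<in> second_higher n" "p \<in> different_legs n" "P = swap_orbit p"
    by blast
  show "outer_leg n P =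
      snd (inner_outer_legs n P) \<and>
      increasing_legs n P =
      sort_pair (inner_outer_legs n P)"
    using higher_different_orbit[OF p(1,2)] sorted_orbit[OF p(2)] p(1)
    by (simp add: p(3) case_prod_unfold)
qed

section \<open>Flows of the unordered case as antisymmetric matrices\<close>

lemma push_swap_push_swap [simp]: "push prod.swap (push prod.swap f) = f"
  unfolding push_compose by (rule push_id) simp

lemma poly_mapping_eq_neg_imp_0:
  fixes f :: "'a \<Rightarrow>\<^sub>0 rat"
  assumes "f = - f"
  shows "f = 0"
proof (rule poly_mapping_eqI)
  fix x
  have "lookup f x = - lookup f x"
    using arg_cong[OF assms, of "\<lambda>f. lookup f x"] by simp
  then show "lookup f x = lookup 0 x"
    by simp
qed

lemma lookup_push_swap: "lookup (push prod.swap f) (i, j) = lookup f (j, i)"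
proof -
  have "lookup (push prod.swap f) (i, j) =
      (\<Sum>x\<in>{x \<in> insert (j, i) (keys f). prod.swap x = (i, j)}. lookup f x)"
    by (rule lookup_push_superset) auto
  also have "{x \<in> insert (j, i) (keys f). prod.swap x = (i, j)} = {(j, i)}"
    by auto
  finally show ?thesis
    by simp
qed

text \<open>Only the two half-edges \<open>(i, j)\<close> and \<open>(j, i)\<close> meet at a
  midpoint, so balance there means opposite weights.\<close>

lemma push_sort_pair_eq_0_iff:
  assumes "keys f \<subseteq> off_diagonal n"
  shows "push sort_pair f = 0 \<longleftrightarrow> push prod.swap f = - f"
proof
  assume "push prod.swap f = - f"
  moreover have "push sort_pair (push prod.swap f) = push sort_pair f"
    unfolding push_compose by (rule push_cong) (auto simp: sort_pair_def)
  ultimately have "push sort_pair f = - push sort_pair f"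
    by (simp add: push.neg)
  then show "push sort_pair f = 0"
    by (rule poly_mapping_eq_neg_imp_0)
next
  assume 0: "push sort_pair f = 0"
  have *: "lookup f (i, j) + lookup f (j, i) = 0" if "i < j" for i j
  proof -
    have "0 = lookup (push sort_pair f) (i, j)"
      by (simp add: 0)
    also have "\<dots> = (\<Sum>x\<in>{x \<in> keys f \<union> {(i, j), (j, i)}. sort_pair x = (i, j)}. lookup f x)"
      by (rule lookup_push_superset) auto
    also have "{x \<in> keys f \<union> {(i, j), (j, i)}. sort_pair x = (i, j)} = {(i, j), (j, i)}"
      using that by (auto simp: sort_pair_def min_def max_def split: if_splits)
    finally show ?thesis
      using that by simp
  qed
  show "push prod.swap f = - f"
  proof (rule poly_mapping_eqI)
    fix x :: "nat \<times> nat"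
    obtain i j where x: "x = (i, j)"
      by (cases x)
    have "lookup f (j, i) = - lookup f (i, j)"
    proof (cases i j rule: linorder_cases)
      case equal
      then have "(i, j) \<notin> keys f"
        using assms by (auto simp: off_diagonal_def)
      then show ?thesis
        using equal by (simp add: in_keys_iff)
    qed (use *[of i j] *[of j i] in auto)
    then show "lookup (push prod.swap f) x = lookup (- f) x"
      by (simp add: x lookup_push_swap)
  qed
qed

text \<open>The symmetric matrices are the case \<epsilon> = 1, the antisymmetric ones the case
  \<epsilon> = -1; both are handled by one induction step.\<close>

definition signed_flows :: "rat \<Rightarrow> nat \<Rightarrow> (nat \<times> nat \<Rightarrow>\<^sub>0 rat) set"
  where "signed_flows \<epsilon> n = {f \<in> zero_sum_flows n. push prod.swap f = rat_scale \<epsilon> f}"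

lemma UConf_flows_eq: "UConf.flows n = signed_flows (- 1) n"
proof -
  have "topspace (UConf2 (star n)) \<inter> swap_orbit ` second_higher n \<inter> swap_orbit ` sorted_legs n =
      swap_orbit ` (second_higher n \<inter> different_legs n)"
    using subset_configs[of n] by (auto simp flip: orbit_Int)
  moreover have "inner_outer_legs n `
      swap_orbit ` (second_higher n \<inter> different_legs n) = off_diagonal n"
  proof -
    have "inner_outer_legs n `
        swap_orbit ` (second_higher n \<inter> different_legs n) =
        legs ` (second_higher n \<inter> different_legs n)"
      unfolding image_image by (rule image_cong) (auto simp: higher_different_orbit)
    also have "\<dots> = off_diagonal n"
    proof
      show "legs ` (second_higher n \<inter> different_legs n) \<subseteq> off_diagonal n"
        using leg_image_different_legs[of n] by blast
      show "off_diagonal n \<subseteq> legs ` (second_higher n \<inter> different_legs n)"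
      proof
        fix e assume "e \<in> off_diagonal n"
        then obtain i j where e: "e = (i, j)" "i \<in> {1..n}" "j \<in> {1..n}" "i \<noteq> j"
          by (auto simp: off_diagonal_def)
        have "(star_point i (1 / 2), star_point j 1) \<in> second_higher n \<inter> different_legs n"
          using e by (intro IntI different_legsI second_higherI) auto
        then show "e \<in> legs ` (second_higher n \<inter> different_legs n)"
          by (rule rev_image_eqI) (simp add: e)
      qed
    qed
    finally show ?thesis .
  qed
  ultimately have eq: "UConf.flows n =
      {f. keys f \<subseteq> off_diagonal n \<and> push snd f = 0 \<and> push sort_pair f = 0}"
    by (simp only: UConf.flows_def)
  \<comment> \<open>The outer-leg condition controls only the column sums; for the row sums
    antisymmetry is used.\<close>
  have "push fst f = 0" if "push snd f = 0" "push prod.swap f = - f" for f :: "nat \<times> nat \<Rightarrow>\<^sub>0 rat"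
  proof -
    have "push snd (push prod.swap f) = push fst f"
      unfolding push_compose by (rule push_cong) simp
    then show ?thesis
      using that by (simp add: push.neg)
  qed
  then show ?thesis
    by (auto simp: eq signed_flows_def zero_sum_flows_def push_sort_pair_eq_0_iff)
qed

lemma UConf2_map_swap_orbit: "UConf2_map g (swap_orbit p) = swap_orbit (Conf2_map g p)"
  by (cases p) (simp add: UConf2_map_def swap_orbit_def Conf2_map_def)

lemma continuous_map_UConf2_map:
  assumes "f \<in> FI_hom m n"
  shows "continuous_map (UConf2 (star m)) (UConf2 (star n)) (UConf2_map (star_map m f))"
  unfolding UConf2_def
proof (rule continuous_compose_quotient_map[OF quotient_map_quotient_topology])
  have "UConf2_map (star_map m f) \<circ> swap_orbit = swap_orbit \<circ> Conf2_map (star_map m f)"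
    by (auto simp: UConf2_map_swap_orbit)
  moreover have "continuous_map (Conf2 (star m)) (quotient_topology (Conf2 (star n)) swap_orbit)
      (swap_orbit \<circ> Conf2_map (star_map m f))"
    by (rule continuous_map_compose[OF continuous_map_Conf2_map[OF assms]
          quotient_imp_continuous_map[OF quotient_map_quotient_topology]])
  ultimately show "continuous_map (Conf2 (star m)) (quotient_topology (Conf2 (star n)) swap_orbit)
      (UConf2_map (star_map m f) \<circ> swap_orbit)"
    by simp
qed

lemma UConf_flow_natural:
  assumes \<sigma>: "\<sigma> permutes {1..n}" and C: "C \<in> carrier (H1_UConf2_star n)"
  shows "UConf.flow n (H1_UConf2_star_map n n (restrict \<sigma> {1..n}) C) = push (map_prod \<sigma> \<sigma>) (UConf.flow n C)"
  unfolding H1_UConf2_star_map_def One_nat_def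
proof (rule UConf.flow_natural)
  let ?g = "star_map n (restrict \<sigma> {1..n})"
  show "continuous_map (UConf2 (star n)) (UConf2 (star n)) (UConf2_map (star_map n (restrict \<sigma> {Suc 0..n})))"
    using continuous_map_UConf2_map[OF restrict_permutes_FI_hom[OF \<sigma>]] by simp
  show "C \<in> carrier (rat_homology (Suc 0) (UConf2 (star n)))"
    using C by (simp add: H1_UConf2_star_def)
  have "UConf2_map ?g P \<in> swap_orbit ` second_higher n" if "P \<in> swap_orbit ` second_higher n" for P
    using that permutes_second_higher[OF \<sigma>] by (auto simp: UConf2_map_swap_orbit simp del: One_nat_def)
  then show "UConf2_map (star_map n (restrict \<sigma> {Suc 0..n})) \<in> swap_orbit ` second_higher n \<rightarrow> swap_orbit ` second_higher n"
    by auto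
  \<comment> \<open>A permuted pair may be out of order, but one of its two orderings is
    sorted.\<close>
  have "UConf2_map ?g P \<in> swap_orbit ` sorted_legs n" if P: "P \<in> swap_orbit ` sorted_legs n" for P
  proof -
    obtain p where p: "p \<in> different_legs n" "P = swap_orbit p"
      using P by (auto simp: sorted_legs_def)
    then have "Conf2_map ?g p \<in> different_legs n"
      using permutes_different_legs[OF \<sigma>] by blast
    then show ?thesis
      using different_legs_sorted swap_orbit_swap p(2) by (metis UConf2_map_swap_orbit imageI)
  qed
  then show "UConf2_map (star_map n (restrict \<sigma> {Suc 0..n})) \<in> swap_orbit ` sorted_legs n \<rightarrow> swap_orbit ` sorted_legs n"
    by auto
next
  let ?g = "star_map n (restrict \<sigma> {1..n})"
  fix P assume "P \<in> swap_orbit ` second_higher n" "P \<in> swap_orbit ` sorted_legs n"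
  then have "P \<in> swap_orbit ` (second_higher n \<inter> different_legs n)"
    unfolding orbit_Int[symmetric] by simp
  then obtain p where p: "p \<in> second_higher n" "p \<in> different_legs n" "P = swap_orbit p"
    by blast
  have "Conf2_map ?g p \<in> second_higher n" "Conf2_map ?g p \<in> different_legs n"
    "leg (fst (Conf2_map ?g p)) = \<sigma> (leg (fst p))" "leg (snd (Conf2_map ?g p)) = \<sigma> (leg (snd p))"
    using permutes_second_higher[OF \<sigma> p(1)] permutes_different_legs[OF \<sigma> p(2)] by blast+
  then show "inner_outer_legs n
      (UConf2_map (star_map n (restrict \<sigma> {Suc 0..n})) P) =
    map_prod \<sigma> \<sigma> (inner_outer_legs n P)"
    using p by (simp add: UConf2_map_swap_orbit higher_different_orbit case_prod_unfold)
qed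

lemma H1_UConf2_star_flow:
  "UConf.flow n \<in> linear_maps (H1_UConf2_star n) (subspace_of_free (signed_flows (- 1) n))"
  "bij_betw (UConf.flow n) (carrier (H1_UConf2_star n)) (signed_flows (- 1) n)"
  using UConf.flow_linear[of n] UConf.flow_bij[of n] by (simp_all add: H1_UConf2_star_def UConf_flows_eq)

lemma FI_module_H1_UConf2_star: "FI_module H1_UConf2_star H1_UConf2_star_map"
proof -
  have "FI_module (\<lambda>n. rat_homology 1 (UConf2 (star n)))
      (\<lambda>m n f. rat_homology_map 1 (UConf2 (star n)) (UConf2_map (star_map m f)))"
  proof (rule FI_module_rat_homology)
    show "finite_dimensional (rat_homology 1 (UConf2 (star n)))" for n
    proof (rule finite_dimensional_if_inj[OF module_rat_homology])
      show "UConf.flow n \<in> linear_maps (rat_homology 1 (UConf2 (star n))) (subspace_of_free (signed_flows (- 1) n))"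
        "inj_on (UConf.flow n) (carrier (rat_homology 1 (UConf2 (star n))))"
        using H1_UConf2_star_flow[of n] by (auto simp: H1_UConf2_star_def bij_betw_def)
      show "keys (UConf.flow n v) \<subseteq> off_diagonal n"
        if "v \<in> carrier (rat_homology 1 (UConf2 (star n)))" for v
        using that H1_UConf2_star_flow(2)[of n] bij_betwE
        by (fastforce simp: H1_UConf2_star_def zero_sum_flows_def signed_flows_def)
    qed simp
    show "UConf2_map (star_map n (\<lambda>i\<in>{1..n}. i)) P = P" if "P \<in> topspace (UConf2 (star n))" for n P
      using that
      by (auto simp: UConf2_map_swap_orbit Conf2_map_def configs_def star_map_id simp del: One_nat_def)
    show "UConf2_map (star_map l (compose {1..l} g f)) P = UConf2_map (star_map m g) (UConf2_map (star_map l f) P)"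
      if "f \<in> FI_hom l m" "P \<in> topspace (UConf2 (star l))" for l m f g P
      using that
      by (auto simp: UConf2_map_swap_orbit Conf2_map_def configs_def star_map_compose simp del: One_nat_def)
  qed (rule continuous_map_UConf2_map)
  then show ?thesis
    by (simp add: H1_UConf2_star_def[abs_def] H1_UConf2_star_map_def[abs_def])
qed

subsection \<open>Flows on complete graphs\<close>

lemma lookup_sum_fst:
  assumes "keys f \<subseteq> off_diagonal n" "push fst f = (0 :: nat \<Rightarrow>\<^sub>0 rat)"
  shows "(\<Sum>j\<in>{1..n}. lookup f (i, j)) = 0"
proof (cases "i \<in> {1..n}")
  case True
  have "0 = lookup (push fst f) i"
    by (simp add: assms)
  also have "\<dots> = (\<Sum>x\<in>{x \<in> {1..n} \<times> {1..n}. fst x = i}. lookup f x)"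
    using assms(1) by (intro lookup_push_superset) (auto simp: off_diagonal_def)
  also have "{x \<in> {1..n} \<times> {1..n}. fst x = i} = Pair i ` {1..n}"
    using True by auto
  also have "(\<Sum>x\<in>Pair i ` {1..n}. lookup f x) = (\<Sum>j\<in>{1..n}. lookup f (i, j))"
    by (subst sum.reindex) (auto simp: inj_on_def)
  finally show ?thesis
    by simp
next
  case False
  then have "(i, j) \<notin> keys f" for j
    using assms(1) by (auto simp: off_diagonal_def)
  then show ?thesis
    by (simp add: in_keys_iff)
qed

lemma subspace_zero_sum_flows: "rat_free.subspace (zero_sum_flows n)"
proof -
  have "zero_sum_flows n = {f. keys f \<subseteq> off_diagonal n} \<inter> ({f. push snd f = 0} \<inter> {f. push fst f = 0})"
    by (auto simp: zero_sum_flows_def)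
  then show ?thesis
    by (simp add: rat_free.subspace_inter push.subspace_kernel subspace_keys)
qed

lemma subspace_signed_flows: "rat_free.subspace (signed_flows \<epsilon> n)"
  using subspace_zero_sum_flows[of n]
  by (auto simp: rat_free.subspace_def signed_flows_def push.add push.scale push.zero
      rat_free.scale_right_distrib rat_free.scale_left_commute)

lemma signed_flows_mono:
  assumes "m \<le> n"
  shows "signed_flows \<epsilon> m \<subseteq> signed_flows \<epsilon> n"
proof -
  have "off_diagonal m \<subseteq> off_diagonal n"
    using assms by (auto simp: off_diagonal_def)
  then show ?thesis
    by (auto simp: signed_flows_def zero_sum_flows_def)
qed

lemma lookup_signed_flow:
  assumes "f \<in> signed_flows \<epsilon> n"
  shows "lookup f (j, i) = \<epsilon> * lookup f (i, j)"
proof -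
  have "lookup (push prod.swap f) (i, j) = lookup (rat_scale \<epsilon> f) (i, j)"
    using assms by (simp add: signed_flows_def)
  then show ?thesis
    by (simp add: lookup_push_swap lookup_rat_scale)
qed

text \<open>Clearing the last row (and, by symmetry, the last column) of a flow.\<close>

lemma signed_flows_peel:
  assumes f: "f \<in> signed_flows \<epsilon> (Suc k)"
    and e: "\<And>i. i \<in> {2..k} \<Longrightarrow> e i \<in> signed_flows \<epsilon> (Suc k)"
    and row: "\<And>i j. \<lbrakk>i \<in> {2..k}; j \<in> {2..k}\<rbrakk> \<Longrightarrow>
      lookup (e i) (Suc k, j) = (if i = j then 1 else 0)"
  shows "f - (\<Sum>i\<in>{2..k}. rat_scale (lookup f (Suc k, i)) (e i)) \<in> signed_flows \<epsilon> k"
proof -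
  define g where "g = f - (\<Sum>i\<in>{2..k}. rat_scale (lookup f (Suc k, i)) (e i))"
  have g: "g \<in> signed_flows \<epsilon> (Suc k)"
    unfolding g_def using f e
    by (intro rat_free.subspace_diff rat_free.subspace_sum rat_free.subspace_scale subspace_signed_flows)
  then have keys: "keys g \<subseteq> off_diagonal (Suc k)" and zero_sum: "push fst g = 0"
    by (simp_all add: signed_flows_def zero_sum_flows_def)
  \<comment> \<open>In the columns \<open>{2..k}\<close> the last row of \<open>e i\<close> is the
    unit vector at \<open>i\<close>, so subtracting the multiples clears these entries.\<close>
  have row_g: "lookup g (Suc k, j) = 0" if "j \<in> {2..k}" for j
  proof -
    have "(\<Sum>i\<in>{2..k}. lookup f (Suc k, i) * lookup (e i) (Suc k, j)) =
        (\<Sum>i\<in>{2..k}. if i = j then lookup f (Suc k, i) else 0)"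
      using row that by (intro sum.cong) auto
    then show ?thesis
      using that by (simp add: g_def lookup_minus lookup_sum lookup_rat_scale)
  qed
  have last: "lookup g (Suc k, Suc k) = 0"
    using keys by (auto simp: off_diagonal_def in_keys_iff)
  have "lookup g (Suc k, j) = 0" for j
  proof (cases "j = 1 \<and> k \<ge> 1")
    case True
    \<comment> \<open>Column 1 was left free: its entry is all that remains of the last row, whose
      sum is zero. For \<open>k = 0\<close> this column is the diagonal one and falls under the
      other case.\<close>
    have "0 = (\<Sum>j\<in>{1..Suc k}. lookup g (Suc k, j))"
      using lookup_sum_fst[OF keys zero_sum] by simp
    also have "\<dots> = (\<Sum>j\<in>{1}. lookup g (Suc k, j))"
    proof (rule sum.mono_neutral_right)
      show "\<forall>i\<in>{1..Suc k} - {1}. lookup g (Suc k, i) = 0"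
      proof
        fix i assume "i \<in> {1..Suc k} - {1}"
        then have "i \<in> {2..k} \<or> i = Suc k"
          by auto
        then show "lookup g (Suc k, i) = 0"
          using row_g last by auto
      qed
    qed auto
    finally show ?thesis
      using True by simp
  next
    case False
    show ?thesis
    proof (cases "j \<in> {1..Suc k}")
      case True
      then have "j \<in> {2..k} \<or> j = Suc k"
        using False by auto
      then show ?thesis
        using row_g last by auto
    next
      case False
      then have "(Suc k, j) \<notin> keys g"
        using keys by (auto simp: off_diagonal_def)
      then show ?thesis
        by (simp add: in_keys_iff)
    qed
  qed
  then have "(Suc k, j) \<notin> keys g" "(j, Suc k) \<notin> keys g" for j
    using lookup_signed_flow[OF g, of j "Suc k"] by (simp_all add: in_keys_iff)
  then have "keys g \<subseteq> off_diagonal k"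
    using keys by (fastforce simp: off_diagonal_def le_Suc_eq)
  then show ?thesis
    using g by (simp add: signed_flows_def zero_sum_flows_def g_def)
qed

text \<open>Weight 1 along the cycle from \<open>a\<close> to \<open>b\<close> to \<open>c\<close>
  and back, and -1 along its reverse. Equivalently, the alternating sum of
  \<open>(\<sigma> b, \<sigma> c)\<close> over the permutations \<sigma> of \<open>a\<close>,
  \<open>b\<close>, \<open>c\<close>, which is how it appears in a polytabloid.\<close>

definition triangle_flow :: "nat \<Rightarrow> nat \<Rightarrow> nat \<Rightarrow> (nat \<times> nat \<Rightarrow>\<^sub>0 rat)"
  where "triangle_flow a b c =
    single (b, c) 1 - single (c, b) 1 +
    single (c, a) 1 - single (a, c) 1 +
    single (a, b) 1 - single (b, a) 1"

text \<open>The 4-cycle through \<open>a\<close>, \<open>b\<close>, \<open>c\<close>,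
  \<open>d\<close> with alternating signs, each edge entered in one direction only; adding the
  transpose makes it symmetric. It is the signed orbit sum of \<open>(c, d)\<close> under the
  exchanges of \<open>a\<close> with \<open>c\<close> and of \<open>b\<close> with
  \<open>d\<close>.\<close>

definition square_flow :: "nat \<Rightarrow> nat \<Rightarrow> nat \<Rightarrow> nat \<Rightarrow> (nat \<times> nat \<Rightarrow>\<^sub>0 rat)"
  where "square_flow a b c d =
    single (c, d) 1 - single (a, d) 1 -
    single (c, b) 1 + single (a, b) 1"

lemma subspace_keys_closed:
  "\<lbrakk>keys f \<subseteq> A; keys g \<subseteq> A\<rbrakk> \<Longrightarrow> keys (f + g) \<subseteq> A"
  "\<lbrakk>keys f \<subseteq> A; keys g \<subseteq> A\<rbrakk> \<Longrightarrow> keys (f - g :: 'a \<Rightarrow>\<^sub>0 rat) \<subseteq> A"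
  for f g :: "'a \<Rightarrow>\<^sub>0 rat"
  using rat_free.subspace_add[OF subspace_keys, of f A g] rat_free.subspace_diff[OF subspace_keys, of f A g]
  by auto

lemma triangle_flow_in_signed_flows:
  assumes "a \<in> {1..n}" "b \<in> {1..n}" "c \<in> {1..n}" "a \<noteq> b" "a \<noteq> c" "b \<noteq> c"
  shows "triangle_flow a b c \<in> signed_flows (- 1) n"
proof -
  have "keys (triangle_flow a b c) \<subseteq> off_diagonal n"
    unfolding triangle_flow_def using assms by (intro subspace_keys_closed) (auto simp: off_diagonal_def)
  then show ?thesis
    by (simp add: signed_flows_def zero_sum_flows_def triangle_flow_def push.add push.diff)
qed

lemma square_flow_in_signed_flows:
  assumes "a \<in> {1..n}" "b \<in> {1..n}" "c \<in> {1..n}" "d \<in> {1..n}"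
    "a \<noteq> b" "a \<noteq> d" "c \<noteq> b" "c \<noteq> d"
  shows "square_flow a b c d + push prod.swap (square_flow a b c d) \<in> signed_flows 1 n"
proof -
  have "keys (square_flow a b c d + push prod.swap (square_flow a b c d)) \<subseteq> off_diagonal n"
    unfolding square_flow_def push.add push.diff push_single
    using assms by (intro subspace_keys_closed) (auto simp: off_diagonal_def)
  then show ?thesis
    by (simp add: signed_flows_def zero_sum_flows_def square_flow_def push.add push.diff)
qed

definition triangle_flows :: "nat \<Rightarrow> (nat \<times> nat \<Rightarrow>\<^sub>0 rat) set"
  where "triangle_flows n = {triangle_flow a b c | a b c.
    a \<in> {1..n} \<and> b \<in> {1..n} \<and> c \<in> {1..n} \<and> distinct [a, b, c]}"

definition square_flows :: "nat \<Rightarrow> (nat \<times> nat \<Rightarrow>\<^sub>0 rat) set"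
  where "square_flows n = {square_flow a b c d | a b c d.
    a \<in> {1..n} \<and> b \<in> {1..n} \<and> c \<in> {1..n} \<and> d \<in> {1..n} \<and> distinct [a, b, c, d]}"

lemma signed_flows_span_step:
  assumes "f \<in> signed_flows \<epsilon> (Suc k)"
    and "\<And>i. i \<in> {2..k} \<Longrightarrow> e i \<in> signed_flows \<epsilon> (Suc k) \<inter> rat_free.span G"
    and "\<And>i j. \<lbrakk>i \<in> {2..k}; j \<in> {2..k}\<rbrakk> \<Longrightarrow>
      lookup (e i) (Suc k, j) = (if i = j then 1 else 0)"
    and "signed_flows \<epsilon> k \<subseteq> rat_free.span G"
  shows "f \<in> rat_free.span G"
proof -
  let ?s = "\<Sum>i\<in>{2..k}. rat_scale (lookup f (Suc k, i)) (e i)"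
  have "f - ?s \<in> rat_free.span G"
    using signed_flows_peel[of f \<epsilon> k e] assms by blast
  moreover have "?s \<in> rat_free.span G"
    using assms(2) by (intro rat_free.span_sum rat_free.span_scale) blast
  ultimately have "f - ?s + ?s \<in> rat_free.span G"
    by (rule rat_free.span_add)
  then show ?thesis
    by simp
qed

lemma antisymmetric_flows_span: "signed_flows (- 1) n = rat_free.span (triangle_flows n)"
proof
  have "triangle_flows n \<subseteq> signed_flows (- 1) n"
    unfolding triangle_flows_def by (auto intro!: triangle_flow_in_signed_flows)
  then show "rat_free.span (triangle_flows n) \<subseteq> signed_flows (- 1) n"
    by (rule rat_free.span_minimal[OF _ subspace_signed_flows])
  show "signed_flows (- 1) n \<subseteq> rat_free.span (triangle_flows n)"
  proof (induction n)
    case 0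
    have "f = 0" if "f \<in> signed_flows (- 1) 0" for f
      using that by (simp add: signed_flows_def zero_sum_flows_def off_diagonal_def)
    then show ?case
      using rat_free.span_zero by blast
  next
    case (Suc k)
    have "triangle_flows k \<subseteq> triangle_flows (Suc k)"
      unfolding triangle_flows_def by fastforce
    then have IH: "signed_flows (- 1) k \<subseteq> rat_free.span (triangle_flows (Suc k))"
      using Suc rat_free.span_mono by blast
    \<comment> \<open>The last row of this triangle is 1 in column \<open>i\<close>, -1 in column 1
      and zero elsewhere, as peeling demands.\<close>
    have mem: "triangle_flow 1 (Suc k) i \<in> signed_flows (- 1) (Suc k) \<inter> rat_free.span (triangle_flows (Suc k))"
      if "i \<in> {2..k}" for i
    proof
      have *: "1 \<in> {1..Suc k}" "Suc k \<in> {1..Suc k}" "i \<in> {1..Suc k}" "distinct [1, Suc k, i]"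
        using that by auto
      show "triangle_flow 1 (Suc k) i \<in> signed_flows (- 1) (Suc k)"
        using * by (intro triangle_flow_in_signed_flows) auto
      show "triangle_flow 1 (Suc k) i \<in> rat_free.span (triangle_flows (Suc k))"
        using * unfolding triangle_flows_def by (intro rat_free.span_base) blast
    qed
    show ?case
    proof
      fix f assume f: "f \<in> signed_flows (- 1) (Suc k)"
      show "f \<in> rat_free.span (triangle_flows (Suc k))"
        by (rule signed_flows_span_step[OF f mem _ IH])
          (auto simp: triangle_flow_def lookup_add lookup_minus lookup_single when_def)
    qed
  qed
qed

text \<open>The three entries above the diagonal have pairwise sums zero, so all vanish. This starts
  the induction for symmetric flows.\<close>

lemma signed_flows_1_3:
  assumes f: "f \<in> signed_flows 1 3"
  shows "f = 0"
proof -
  let ?l = "lookup f"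
  have keys: "keys f \<subseteq> off_diagonal 3" and zero_sum: "push fst f = 0"
    using f by (simp_all add: signed_flows_def zero_sum_flows_def)
  have sym: "?l (j, i) = ?l (i, j)" for i j
    using lookup_signed_flow[OF f] by simp
  have diag: "?l (i, i) = 0" for i
    using keys by (auto simp: off_diagonal_def in_keys_iff)
  have three: "{1..3} = {1, 2, 3 :: nat}"
    by auto
  then have "?l (i, 1) + ?l (i, 2) + ?l (i, 3) = 0" for i
    using lookup_sum_fst[OF keys zero_sum, of i] by simp
  from this[of 1] this[of 2] this[of 3]
  have zero: "?l (1, 2) = 0" "?l (1, 3) = 0" "?l (2, 3) = 0"
    using sym[of 1 2] sym[of 1 3] sym[of 2 3] diag by simp_all
  show ?thesis
  proof (rule poly_mapping_eqI)
    fix x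
    have "x \<notin> keys f"
    proof
      assume "x \<in> keys f"
      moreover from this have "x \<in> {(i, j). i \<in> {1, 2, 3} \<and> j \<in> {1, 2, 3} \<and> i \<noteq> j}"
        using keys unfolding off_diagonal_def three by blast
      ultimately show False
        using zero sym[of 1 2] sym[of 1 3] sym[of 2 3] by (auto simp: in_keys_iff)
    qed
    then show "?l x = lookup 0 x"
      by (simp add: in_keys_iff)
  qed
qed

lemma symmetric_flows_span:
  "signed_flows 1 n = rat_free.span ((\<lambda>f. f + push prod.swap f) ` square_flows n)"
    (is "_ = rat_free.span (?Q n)")
proof
  have "?Q n \<subseteq> signed_flows 1 n"
    unfolding square_flows_def by (auto intro!: square_flow_in_signed_flows)
  then show "rat_free.span (?Q n) \<subseteq> signed_flows 1 n"
    by (rule rat_free.span_minimal[OF _ subspace_signed_flows])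
  show "signed_flows 1 n \<subseteq> rat_free.span (?Q n)"
  proof (induction n)
    case 0
    have "f = 0" if "f \<in> signed_flows 1 0" for f
      using that signed_flows_mono[of 0 3 1] signed_flows_1_3 by auto
    then show ?case
      using rat_free.span_zero by blast
  next
    case (Suc k)
    show ?case
    proof (cases "k \<ge> 3")
      case False
      then have "f = 0" if "f \<in> signed_flows 1 (Suc k)" for f
        using that signed_flows_mono[of "Suc k" 3 1] signed_flows_1_3 by auto
      then show ?thesis
        using rat_free.span_zero by blast
    next
      case True
      have "square_flows k \<subseteq> square_flows (Suc k)"
        unfolding square_flows_def by fastforce
      then have "?Q k \<subseteq> ?Q (Suc k)"
        by (rule image_mono)
      then have IH: "signed_flows 1 k \<subseteq> rat_free.span (?Q (Suc k))"
        using Suc rat_free.span_mono by blast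
      \<comment> \<open>A 4-cycle through \<open>Suc k\<close>, \<open>i\<close> and 1 needs a
        fourth vertex in \<open>{2..k}\<close> other than \<open>i\<close>; with
        \<open>k \<ge> 3\<close>, one of 2 and 3 will do.\<close>
      define a where "a i = (if i = 2 then 3 else 2 :: nat)" for i :: nat
      define e where "e i = square_flow (a i) 1 (Suc k) i + push prod.swap (square_flow (a i) 1 (Suc k) i)" for i
      have a: "a i \<in> {1..k}" "distinct [a i, 1, Suc k, i]" if "i \<in> {2..k}" for i
        using that True by (auto simp: a_def)
      have mem: "e i \<in> signed_flows 1 (Suc k) \<inter> rat_free.span (?Q (Suc k))" if i: "i \<in> {2..k}" for i
      proof
        have *: "a i \<in> {1..Suc k}" "1 \<in> {1..Suc k}" "Suc k \<in> {1..Suc k}" "i \<in> {1..Suc k}"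
          using a(1)[OF i] i by auto
        show "e i \<in> signed_flows 1 (Suc k)"
          unfolding e_def using * a(2)[OF i] by (intro square_flow_in_signed_flows) auto
        have "square_flow (a i) 1 (Suc k) i \<in> square_flows (Suc k)"
          using * a(2)[OF i] unfolding square_flows_def by blast
        then show "e i \<in> rat_free.span (?Q (Suc k))"
          unfolding e_def by (intro rat_free.span_base imageI)
      qed
      have row: "lookup (e i) (Suc k, j) = (if i = j then 1 else 0)"
        if "i \<in> {2..k}" "j \<in> {2..k}" for i j
        using a[OF that(1)] that
        by (auto simp: e_def square_flow_def push.add push.diff lookup_add lookup_minus lookup_single when_def)
      show ?thesis
      proof
        fix f assume f: "f \<in> signed_flows 1 (Suc k)"
        show "f \<in> rat_free.span (?Q (Suc k))"
          by (rule signed_flows_span_step[OF f mem row IH])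
      qed
    qed
  qed
qed

subsection \<open>Specht modules of the shapes (n - 2, 1, 1) and (n - 2, 2)\<close>

text \<open>The remaining cells and numbers are equally many, so any bijection between them
  completes the filling. Thus every triangle or square of legs comes from a tableau.\<close>

lemma tableau_extending:
  assumes card: "finite (young_diagram \<mu>)" "card (young_diagram \<mu>) = sum_list \<mu>"
    and K: "K \<subseteq> young_diagram \<mu>" "inj_on g K" "g ` K \<subseteq> {1..sum_list \<mu>}"
  obtains t where "t \<in> tableaux \<mu>" "\<And>x. x \<in> K \<Longrightarrow> t x = g x"
proof -
  let ?D = "young_diagram \<mu>" and ?N = "{1..sum_list \<mu>}"
  have "finite K"
    using K card finite_subset by blast
  then have "card (?D - K) = card (?N - g ` K)"
    using K card by (simp add: card_Diff_subset card_image)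
  then obtain h where h: "bij_betw h (?D - K) (?N - g ` K)"
    using finite_same_card_bij[of "?D - K" "?N - g ` K"] card by auto
  define t where "t = restrict (\<lambda>x. if x \<in> K then g x else h x) ?D"
  have "bij_betw t K (g ` K)"
    using K by (intro bij_betw_imageI) (auto simp: t_def inj_on_def)
  moreover have "bij_betw t (?D - K) (?N - g ` K)"
    using h by (rule bij_betw_cong[THEN iffD1, rotated]) (simp add: t_def)
  ultimately have "bij_betw t (K \<union> (?D - K)) (g ` K \<union> (?N - g ` K))"
    by (rule bij_betw_combine) auto
  moreover have "K \<union> (?D - K) = ?D" "g ` K \<union> (?N - g ` K) = ?N"
    using K by auto
  ultimately have "t \<in> tableaux \<mu>"
    by (simp add: tableaux_def t_def)
  then show thesis
    by (rule that) (use K in \<open>auto simp: t_def\<close>)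
qed

lemma mem_young_diagram_hook:
  "(i, j) \<in> young_diagram [m, 1, 1] \<longleftrightarrow> i = 0 \<and> j < m \<or> i = 1 \<and> j = 0 \<or> i = 2 \<and> j = 0"
  by (auto simp: young_diagram_def less_Suc_eq numeral_2_eq_2)

lemma mem_young_diagram_two_rows:
  "(i, j) \<in> young_diagram [m, 2] \<longleftrightarrow> i = 0 \<and> j < m \<or> i = 1 \<and> j < 2"
  by (auto simp: young_diagram_def less_Suc_eq)

lemma card_young_diagram:
  "finite (young_diagram [m, 1, 1])" "card (young_diagram [m, 1, 1]) = m + 2"
  "finite (young_diagram [m, 2])" "card (young_diagram [m, 2]) = m + 2"
proof -
  have hook: "young_diagram [m, 1, 1] = Pair 0 ` {..<m} \<union> {(1, 0), (2, 0)}"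
    by (auto simp: set_eq_iff mem_young_diagram_hook simp del: One_nat_def)
  have two: "young_diagram [m, 2] = Pair 0 ` {..<m} \<union> Pair 1 ` {..<2}"
    by (auto simp: set_eq_iff mem_young_diagram_two_rows simp del: One_nat_def)
  show "finite (young_diagram [m, 1, 1])" "finite (young_diagram [m, 2])"
    unfolding hook two by simp_all
  show "card (young_diagram [m, 1, 1]) = m + 2"
    unfolding hook by (subst card_Un_disjoint) (auto simp: card_image inj_on_def)
  show "card (young_diagram [m, 2]) = m + 2"
    unfolding two by (subst card_Un_disjoint) (auto simp: card_image inj_on_def)
qed

text \<open>A tabloid of shape \<open>(n - 2, 1, 1)\<close> is determined by the ordered pair of
  entries of its lower rows, one of shape \<open>(n - 2, 2)\<close> by an unordered pair. Pushing
  forward along these maps turns matrices into combinations of tabloids.\<close>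

definition hook_tabloid :: "nat \<Rightarrow> nat \<times> nat \<Rightarrow> tabloid"
  where "hook_tabloid n = (\<lambda>(i, j) r.
    if r = 0 then {1..n} - {i, j} else if r = 1 then {i} else if r = 2 then {j} else {})"

definition two_row_tabloid :: "nat \<Rightarrow> nat \<times> nat \<Rightarrow> tabloid"
  where "two_row_tabloid n = (\<lambda>(i, j) r.
    if r = 0 then {1..n} - {i, j} else if r = 1 then {i, j} else {})"

lemma permute_tabloids:
  assumes "\<sigma> permutes {1..n}"
  shows "permute_tabloid \<sigma> (hook_tabloid n p) = hook_tabloid n (map_prod \<sigma> \<sigma> p)"
    and "permute_tabloid \<sigma> (two_row_tabloid n p) = two_row_tabloid n (map_prod \<sigma> \<sigma> p)"
proof -
  have "\<sigma> ` ({1..n} - {i, j}) = {1..n} - {\<sigma> i, \<sigma> j}" for i j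
    using image_set_diff[OF permutes_inj[OF assms], of "{1..n}" "{i, j}"] permutes_image[OF assms] by simp
  then show "permute_tabloid \<sigma> (hook_tabloid n p) = hook_tabloid n (map_prod \<sigma> \<sigma> p)"
    "permute_tabloid \<sigma> (two_row_tabloid n p) = two_row_tabloid n (map_prod \<sigma> \<sigma> p)"
    by (auto simp: permute_tabloid_def hook_tabloid_def two_row_tabloid_def fun_eq_iff
        split: prod.split simp del: One_nat_def)
qed

lemma inj_hook_tabloid: "inj (hook_tabloid n)"
proof (rule injI)
  fix p q assume *: "hook_tabloid n p = hook_tabloid n q"
  show "p = q"
    using fun_cong[OF *, of 1] fun_cong[OF *, of 2]
    by (cases p; cases q) (simp add: hook_tabloid_def)
qed

lemma two_row_tabloid_eq_iff: "two_row_tabloid n p = two_row_tabloid n q \<longleftrightarrow> p = q \<or> p = prod.swap q"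
proof
  assume *: "two_row_tabloid n p = two_row_tabloid n q"
  show "p = q \<or> p = prod.swap q"
    using fun_cong[OF *, of 1] by (cases p; cases q) (auto simp: two_row_tabloid_def doubleton_eq_iff)
qed (cases p; cases q; auto simp: two_row_tabloid_def fun_eq_iff)

section \<open>Polytabloids of the two shapes\<close>

abbreviation "swap_elems \<equiv> Transposition.transpose"

lemma sum_permutes_3:
  fixes F :: "('a \<Rightarrow> 'a) \<Rightarrow> 'b :: comm_monoid_add"
  assumes "a \<noteq> b" "a \<noteq> c" "b \<noteq> c"
  shows "(\<Sum>\<sigma> | \<sigma> permutes {a, b, c}. F \<sigma>) =
    F id + F (swap_elems b c) + (F (swap_elems a b) + F (swap_elems a b \<circ> swap_elems b c)) +
    (F (swap_elems a c) + F (swap_elems a c \<circ> swap_elems b c))"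
  using assms by (simp add: sum_over_permutations_insert add.assoc)

context
  fixes n :: nat and \<mu> t
  assumes t: "t \<in> tableaux \<mu>" and sum: "sum_list \<mu> = n"
begin

lemma tableau_bij: "bij_betw t (young_diagram \<mu>) {1..n}"
  using t sum by (simp add: tableaux_def)

lemma tableau_mem: "x \<in> young_diagram \<mu> \<Longrightarrow> t x \<in> {1..n}"
  using tableau_bij by (auto simp: bij_betw_def)

lemma tableau_eq_iff: "\<lbrakk>x \<in> young_diagram \<mu>; y \<in> young_diagram \<mu>\<rbrakk> \<Longrightarrow> t x = t y \<longleftrightarrow> x = y"
  using tableau_bij by (auto simp: bij_betw_def inj_on_eq_iff)

lemma tableau_cases:
  assumes "x \<in> {1..n}"
  obtains i j where "(i, j) \<in> young_diagram \<mu>" "x = t (i, j)"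
  using tableau_bij assms by (auto simp: bij_betw_def image_iff) (metis atLeastAtMost_iff imageE old.prod.exhaust)

lemma column_stabilizer_fixes:
  assumes "\<sigma> \<in> column_stabilizer \<mu> t" "column \<mu> t j = {x}"
  shows "\<sigma> x = x"
proof -
  have "\<sigma> ` column \<mu> t j = column \<mu> t j"
    using assms(1) by (simp add: column_stabilizer_def)
  then show ?thesis
    using assms(2) by simp
qed

end

text \<open>Only the first column has more than one cell, so the column stabilizer is the full
  symmetric group on its three entries.\<close>

lemma polytabloid_hook:
  assumes t: "t \<in> tableaux [m, 1, 1]" and m: "m \<ge> 1"
  shows "polytabloid [m, 1, 1] t = push (hook_tabloid (m + 2)) (triangle_flow (t (0, 0)) (t (1, 0)) (t (2, 0)))"
proof -
  let ?\<mu> = "[m, 1, 1]" and ?n = "m + 2"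
  have sum: "sum_list ?\<mu> = ?n"
    by simp
  note D = mem_young_diagram_hook mem_young_diagram_hook[unfolded One_nat_def]
  define a b c where "a = t (0, 0)" "b = t (1, 0)" "c = t (2, 0)"
  note abc = this
  have mem: "a \<in> {1..?n}" "b \<in> {1..?n}" "c \<in> {1..?n}"
    unfolding abc by (rule tableau_mem[OF t sum], use m in \<open>simp add: D\<close>)+
  have dist: "a \<noteq> b" "a \<noteq> c" "b \<noteq> c"
    unfolding abc using m by (simp_all add: tableau_eq_iff[OF t sum] D)
  have row0: "{t (0, j) | j. j < m} = {1..?n} - {b, c}"
  proof (intro equalityI subsetI)
    fix x assume "x \<in> {t (0, j) | j. j < m}"
    then show "x \<in> {1..?n} - {b, c}"
      unfolding abc using tableau_mem[OF t sum]
      by (auto simp: tableau_eq_iff[OF t sum] D simp del: atLeastAtMost_iff)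
  next
    fix x assume x: "x \<in> {1..?n} - {b, c}"
    then obtain i j where "(i, j) \<in> young_diagram ?\<mu>" "x = t (i, j)"
      using tableau_cases[OF t sum] by blast
    then show "x \<in> {t (0, j) | j. j < m}"
      using x by (auto simp: D abc)
  qed
  have "tabloid_of ?\<mu> t r = hook_tabloid ?n (b, c) r" for r
  proof -
    consider "r = 0" | "r = 1" | "r = 2" | "r > 2"
      by linarith
    then show ?thesis
      by cases (use row0 in \<open>simp_all add: tabloid_of_def hook_tabloid_def D abc\<close>)
  qed
  then have tabloid: "tabloid_of ?\<mu> t = hook_tabloid ?n (b, c)"
    by (rule ext)
  have column: "column ?\<mu> t 0 = {a, b, c}" "0 < j \<Longrightarrow> j < m \<Longrightarrow> column ?\<mu> t j = {t (0, j)}"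
    "j \<ge> m \<Longrightarrow> column ?\<mu> t j = {}" for j
    using m by (auto simp: column_def D abc simp del: One_nat_def)
  have stab: "column_stabilizer ?\<mu> t = {\<sigma>. \<sigma> permutes {a, b, c}}"
  proof (intro equalityI subsetI CollectI)
    fix \<sigma> assume \<sigma>: "\<sigma> \<in> column_stabilizer ?\<mu> t"
    then have "\<sigma> permutes {1..?n}"
      by (simp add: column_stabilizer_def)
    moreover have "\<sigma> x = x" if x: "x \<in> {1..?n} - {a, b, c}" for x
    proof -
      obtain j where "x = t (0, j)" "0 < j" "j < m"
        using tableau_cases[OF t sum, of x] x by (auto simp: D abc simp del: One_nat_def)
      then show ?thesis
        using column_stabilizer_fixes[OF t sum \<sigma>] column(2) by blast
    qed
    ultimately show "\<sigma> permutes {a, b, c}"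
      by (rule permutes_superset) blast
  next
    fix \<sigma> assume "\<sigma> \<in> {\<sigma>. \<sigma> permutes {a, b, c}}"
    then have \<sigma>: "\<sigma> permutes {a, b, c}"
      by simp
    then have "\<sigma> permutes {1..?n}"
      by (rule permutes_subset) (use mem in blast)
    moreover have "\<sigma> ` column ?\<mu> t j = column ?\<mu> t j" for j
    proof -
      consider "j = 0" | "0 < j" "j < m" | "j \<ge> m"
        by linarith
      then show ?thesis
      proof cases
        case 1
        then show ?thesis
          by (simp only: column(1) permutes_image[OF \<sigma>])
      next
        case 2
        then have "t (0, j) \<notin> {a, b, c}"
          unfolding abc by (simp add: tableau_eq_iff[OF t sum] D)
        then show ?thesis
          using 2 permutes_not_in[OF \<sigma>] column(2) by simp
      qed (simp add: column(3) del: One_nat_def)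
    qed
    ultimately show "\<sigma> \<in> column_stabilizer ?\<mu> t"
      by (simp add: column_stabilizer_def)
  qed
  have perm: "\<sigma> permutes {1..?n}" if "\<sigma> permutes {a, b, c}" for \<sigma>
    using that by (rule permutes_subset) (use mem in blast)
  have "polytabloid ?\<mu> t =
      (\<Sum>\<sigma> | \<sigma> permutes {a, b, c}. single (hook_tabloid ?n (\<sigma> b, \<sigma> c)) (of_int (sign \<sigma>)))"
    unfolding polytabloid_def stab tabloid
    by (rule sum.cong[OF refl]) (simp only: mem_Collect_eq permute_tabloids(1)[OF perm] map_prod_simp)
  also have "\<dots> = push (hook_tabloid ?n) (triangle_flow a b c)"
    using dist
    by (simp add: sum_permutes_3 triangle_flow_def push.add push.diff sign_compose sign_swap_id
        permutation_swap_id Transposition.transpose_def single_uminus algebra_simps)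
  finally show ?thesis
    by (simp add: abc)
qed

text \<open>Only the first two columns have two cells, so the column stabilizer is generated by the
  two exchanges within them and has order four.\<close>

lemma polytabloid_two_rows:
  assumes t: "t \<in> tableaux [m, 2]" and m: "m \<ge> 2"
  shows "polytabloid [m, 2] t =
    push (two_row_tabloid (m + 2)) (square_flow (t (0, 0)) (t (0, 1)) (t (1, 0)) (t (1, 1)))"
proof -
  let ?\<mu> = "[m, 2]" and ?n = "m + 2"
  have sum: "sum_list ?\<mu> = ?n"
    by simp
  note D = mem_young_diagram_two_rows
  define a b c d where "a = t (0, 0)" "b = t (0, 1)" "c = t (1, 0)" "d = t (1, 1)"
  note abcd = this
  have mem: "a \<in> {1..?n}" "b \<in> {1..?n}" "c \<in> {1..?n}" "d \<in> {1..?n}"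
    unfolding abcd by (rule tableau_mem[OF t sum], use m in \<open>simp add: D\<close>)+
  have dist: "a \<noteq> b" "a \<noteq> c" "a \<noteq> d" "b \<noteq> c" "b \<noteq> d" "c \<noteq> d"
    unfolding abcd using m by (simp_all add: tableau_eq_iff[OF t sum] D)
  have less2: "j < 2 \<longleftrightarrow> j = 0 \<or> j = 1" for j :: nat
    by auto
  have row0: "{t (0, j) | j. j < m} = {1..?n} - {c, d}"
  proof (intro equalityI subsetI)
    fix x assume "x \<in> {t (0, j) | j. j < m}"
    then show "x \<in> {1..?n} - {c, d}"
      unfolding abcd using tableau_mem[OF t sum]
      by (auto simp: tableau_eq_iff[OF t sum] D simp del: atLeastAtMost_iff)
  next
    fix x assume x: "x \<in> {1..?n} - {c, d}"
    then obtain i j where "(i, j) \<in> young_diagram ?\<mu>" "x = t (i, j)"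
      using tableau_cases[OF t sum] by blast
    then show "x \<in> {t (0, j) | j. j < m}"
      using x by (auto simp: D abcd less2)
  qed
  have row1: "{t (1, j) | j. j < 2} = {c, d}"
    by (auto simp: less2 abcd)
  have "tabloid_of ?\<mu> t r = two_row_tabloid ?n (c, d) r" for r
  proof -
    consider "r = 0" | "r = 1" | "r > 1"
      by linarith
    then show ?thesis
      by cases (use row0 row1 in \<open>simp_all add: tabloid_of_def two_row_tabloid_def D\<close>)
  qed
  then have tabloid: "tabloid_of ?\<mu> t = two_row_tabloid ?n (c, d)"
    by (rule ext)
  have column: "column ?\<mu> t 0 = {a, c}" "column ?\<mu> t 1 = {b, d}"
    "2 \<le> j \<Longrightarrow> j < m \<Longrightarrow> column ?\<mu> t j = {t (0, j)}" "j \<ge> m \<Longrightarrow> column ?\<mu> t j = {}" for j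
    using m by (auto simp: column_def D abcd simp del: One_nat_def)
  let ?S = "{id, swap_elems a c, swap_elems b d, swap_elems a c \<circ> swap_elems b d}"
  have perm: "\<sigma> permutes {1..?n}" if "\<sigma> \<in> ?S" for \<sigma>
    using that mem by (auto intro!: permutes_swap_id permutes_compose permutes_id simp del: atLeastAtMost_iff)
  have stab: "column_stabilizer ?\<mu> t = ?S"
  proof (intro equalityI subsetI)
    fix \<sigma> assume \<sigma>: "\<sigma> \<in> column_stabilizer ?\<mu> t"
    then have perm_\<sigma>: "\<sigma> permutes {1..?n}"
      by (simp add: column_stabilizer_def)
    have fix_out: "\<sigma> x = x" if x: "x \<notin> {a, b, c, d}" for x
    proof (cases "x \<in> {1..?n}")
      case True
      then obtain i j where ij: "(i, j) \<in> young_diagram ?\<mu>" "x = t (i, j)"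
        by (rule tableau_cases[OF t sum])
      have "(i, j) \<notin> {(0, 0), (0, 1), (1, 0), (1, 1)}"
      proof -
        have "t ` {(0, 0), (0, 1), (1, 0), (1, 1)} = {a, b, c, d}"
          by (simp add: abcd)
        then show ?thesis
          using x ij(2) by (metis imageI)
      qed
      moreover have "i = 0 \<and> j < m \<or> i = 1 \<and> (j = 0 \<or> j = 1)"
        using ij(1) by (simp only: D less2)
      ultimately have "i = 0" "\<not> j < 2" "j < m"
        unfolding less2 by (auto simp del: One_nat_def)
      then have "i = 0" "2 \<le> j" "j < m"
        by simp_all
      then show ?thesis
        using column_stabilizer_fixes[OF t sum \<sigma>] column(3) ij(2) by blast
    next
      case False
      then show ?thesis
        using perm_\<sigma> by (rule permutes_not_in[rotated])
    qed
    have "\<sigma> ` {a, c} = {a, c}" "\<sigma> ` {b, d} = {b, d}"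
      using \<sigma> unfolding column_stabilizer_def column(1,2)[symmetric] by blast+
    then have "(\<sigma> a = a \<and> \<sigma> c = c) \<or> (\<sigma> a = c \<and> \<sigma> c = a)" "(\<sigma> b = b \<and> \<sigma> d = d) \<or> (\<sigma> b = d \<and> \<sigma> d = b)"
      by (auto simp: doubleton_eq_iff)
    then consider "\<sigma> a = a" "\<sigma> c = c" "\<sigma> b = b" "\<sigma> d = d" | "\<sigma> a = c" "\<sigma> c = a" "\<sigma> b = b" "\<sigma> d = d"
      | "\<sigma> a = a" "\<sigma> c = c" "\<sigma> b = d" "\<sigma> d = b" | "\<sigma> a = c" "\<sigma> c = a" "\<sigma> b = d" "\<sigma> d = b"
      by blast
    then show "\<sigma> \<in> ?S"
    proof cases
      case 1
      then have "\<sigma> x = id x" for x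
        using fix_out[of x] by auto
      then have "\<sigma> = id"
        by (rule ext)
      then show ?thesis by simp
    next
      case 2
      then have "\<sigma> x = (swap_elems a c) x" for x
        using fix_out[of x] dist by (auto simp: Transposition.transpose_def)
      then have "\<sigma> = swap_elems a c"
        by (rule ext)
      then show ?thesis by simp
    next
      case 3
      then have "\<sigma> x = (swap_elems b d) x" for x
        using fix_out[of x] dist by (auto simp: Transposition.transpose_def)
      then have "\<sigma> = swap_elems b d"
        by (rule ext)
      then show ?thesis by simp
    next
      case 4
      then have "\<sigma> x = (swap_elems a c \<circ> swap_elems b d) x" for x
        using fix_out[of x] dist by (auto simp: Transposition.transpose_def)
      then have "\<sigma> = swap_elems a c \<circ> swap_elems b d"
        by (rule ext)
      then show ?thesis by simp
    qed
  next
    fix \<sigma> assume \<sigma>: "\<sigma> \<in> ?S"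
    have "\<sigma> ` column ?\<mu> t j = column ?\<mu> t j" for j
    proof -
      consider "j = 0" | "j = 1" | "2 \<le> j" "j < m" | "j \<ge> m"
        by linarith
      then show ?thesis
      proof cases
        case 3
        then have "t (0, j) \<notin> {a, b, c, d}"
          unfolding abcd by (auto simp: tableau_eq_iff[OF t sum] D)
        then have "\<sigma> (t (0, j)) = t (0, j)"
          using \<sigma> by (auto simp: Transposition.transpose_def)
        then show ?thesis
          using 3 column(3) by simp
      qed (use \<sigma> dist in \<open>auto simp: column Transposition.transpose_def simp del: One_nat_def\<close>)
    qed
    then show "\<sigma> \<in> column_stabilizer ?\<mu> t"
      using perm[OF \<sigma>] by (simp add: column_stabilizer_def)
  qed
  \<comment> \<open>The four elements are distinct, so the sum over the set \<open>?S\<close> really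
    has four terms.\<close>
  have ne: "id \<noteq> swap_elems a c" "id \<noteq> swap_elems b d" "id \<noteq> swap_elems a c \<circ> swap_elems b d"
    "swap_elems a c \<noteq> swap_elems b d" "swap_elems a c \<noteq> swap_elems a c \<circ> swap_elems b d"
    "swap_elems b d \<noteq> swap_elems a c \<circ> swap_elems b d"
    using dist by (auto simp: fun_eq_iff Transposition.transpose_def dest!: spec[of _ a] spec[of _ b])
  have "polytabloid ?\<mu> t =
      (\<Sum>\<sigma>\<in>?S. single (two_row_tabloid ?n (\<sigma> c, \<sigma> d)) (of_int (sign \<sigma>)))"
    unfolding polytabloid_def stab tabloid
    by (rule sum.cong[OF refl]) (simp only: permute_tabloids(2)[OF perm] map_prod_simp)
  also have "\<dots> = push (two_row_tabloid ?n) (square_flow a b c d)"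
    using dist ne
    by (simp add: square_flow_def push.add push.diff sign_compose sign_swap_id
        permutation_swap_id Transposition.transpose_def single_uminus algebra_simps)
  finally show ?thesis
    by (simp add: abcd)
qed

section \<open>Specht modules as images of spaces of flows\<close>

lemma carrier_Specht: "carrier (Specht \<mu>) = rat_free.span (polytabloid \<mu> ` tableaux \<mu>)"
  by (simp add: Specht_def)

text \<open>The polytabloids are exactly the images of the triangles, and \<open>push\<close>
  commutes with spans.\<close>

lemma carrier_Specht_hook:
  assumes "n \<ge> 3"
  shows "carrier (Specht (padded_partition n [1, 1])) = push (hook_tabloid n) ` signed_flows (- 1) n"
proof -
  let ?\<mu> = "[n - 2, 1, 1]"
  have sum: "sum_list ?\<mu> = n" and m: "n - 2 \<ge> 1" "n - 2 + 2 = n"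
    using assms by simp_all
  note D = mem_young_diagram_hook mem_young_diagram_hook[unfolded One_nat_def]
  have "polytabloid ?\<mu> ` tableaux ?\<mu> = push (hook_tabloid n) ` triangle_flows n"
  proof (intro equalityI subsetI)
    fix v assume "v \<in> polytabloid ?\<mu> ` tableaux ?\<mu>"
    then obtain t where t: "t \<in> tableaux ?\<mu>" "v = push (hook_tabloid n) (triangle_flow (t (0, 0)) (t (1, 0)) (t (2, 0)))"
      using polytabloid_hook[OF _ m(1)] m(2) by auto
    have "t (0, 0) \<in> {1..n}" "t (1, 0) \<in> {1..n}" "t (2, 0) \<in> {1..n}"
      by (rule tableau_mem[OF t(1) sum], use m in \<open>simp add: D\<close>)+
    moreover have "distinct [t (0, 0), t (1, 0), t (2, 0)]"
      using m by (simp add: tableau_eq_iff[OF t(1) sum] D)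
    ultimately show "v \<in> push (hook_tabloid n) ` triangle_flows n"
      unfolding t(2) triangle_flows_def by blast
  next
    fix v assume "v \<in> push (hook_tabloid n) ` triangle_flows n"
    then obtain a b c where abc: "a \<in> {1..n}" "b \<in> {1..n}" "c \<in> {1..n}" "distinct [a, b, c]"
      "v = push (hook_tabloid n) (triangle_flow a b c)"
      by (auto simp: triangle_flows_def)
    define g :: "nat \<times> nat \<Rightarrow> nat" where "g = (\<lambda>(i, j). if i = 0 then a else if i = 1 then b else c)"
    obtain t where t: "t \<in> tableaux ?\<mu>" "\<And>x. x \<in> {(0, 0), (1, 0), (2, 0)} \<Longrightarrow> t x = g x"
    proof (rule tableau_extending[of ?\<mu> "{(0, 0), (1, 0), (2, 0)}" g])
      show "card (young_diagram ?\<mu>) = sum_list ?\<mu>"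
        unfolding card_young_diagram by simp
      show "{(0, 0), (1, 0), (2, 0)} \<subseteq> young_diagram ?\<mu>"
        using m by (simp add: D)
      show "g ` {(0, 0), (1, 0), (2, 0)} \<subseteq> {1..sum_list ?\<mu>}"
        unfolding sum using abc by (simp add: g_def)
      show "inj_on g {(0, 0), (1, 0), (2, 0)}"
        using abc(4) by (simp add: g_def)
      show "finite (young_diagram ?\<mu>)"
        by (rule card_young_diagram)
    qed (use that in blast)
    have "polytabloid ?\<mu> t = v"
      using polytabloid_hook[OF t(1) m(1)] t(2) m(2) by (simp add: abc(5) g_def)
    then show "v \<in> polytabloid ?\<mu> ` tableaux ?\<mu>"
      using t(1) by blast
  qed
  then show ?thesis
    by (simp add: padded_partition_def carrier_Specht push.span_image antisymmetric_flows_span numeral_2_eq_2)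
qed

lemma push_two_row_swap: "push (two_row_tabloid n) (push prod.swap f) = push (two_row_tabloid n) f"
  unfolding push_compose by (rule push_cong) (simp add: two_row_tabloid_eq_iff)

lemma zero_sum_flows_symmetrize:
  assumes "f \<in> zero_sum_flows n"
  shows "push prod.swap f \<in> zero_sum_flows n"
    "f + push prod.swap f \<in> signed_flows 1 n" "f - push prod.swap f \<in> signed_flows (- 1) n"
proof -
  have "push snd (push prod.swap f) = push fst f" "push fst (push prod.swap f) = push snd f"
    unfolding push_compose by (rule push_cong, simp)+
  moreover have "prod.swap ` off_diagonal n \<subseteq> off_diagonal n" "keys f \<subseteq> off_diagonal n"
    using assms by (auto simp: off_diagonal_def zero_sum_flows_def)
  then have "keys (push prod.swap f) \<subseteq> off_diagonal n"
    by (intro order_trans[OF keys_push]) blast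
  ultimately show *: "push prod.swap f \<in> zero_sum_flows n"
    using assms by (simp add: zero_sum_flows_def)
  show "f + push prod.swap f \<in> signed_flows 1 n" "f - push prod.swap f \<in> signed_flows (- 1) n"
    using assms * rat_free.subspace_add[OF subspace_zero_sum_flows] rat_free.subspace_diff[OF subspace_zero_sum_flows]
    by (simp_all add: signed_flows_def push.add push.diff add.commute)
qed

text \<open>The polytabloids are the images of the unsymmetrized squares. Two-row tabloids cannot
  tell a matrix from its transpose, so up to the factor 2 only the symmetrization matters, and
  symmetrized squares span the symmetric flows.\<close>

lemma carrier_Specht_two_rows:
  assumes "n \<ge> 4"
  shows "carrier (Specht (padded_partition n [2])) = push (two_row_tabloid n) ` zero_sum_flows n"
proof -
  let ?\<mu> = "[n - 2, 2]"
  have sum: "sum_list ?\<mu> = n" and m: "n - 2 \<ge> 2" "n - 2 + 2 = n"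
    using assms by simp_all
  note D = mem_young_diagram_two_rows
  have "polytabloid ?\<mu> ` tableaux ?\<mu> = push (two_row_tabloid n) ` square_flows n"
  proof (intro equalityI subsetI)
    fix v assume "v \<in> polytabloid ?\<mu> ` tableaux ?\<mu>"
    then obtain t where t: "t \<in> tableaux ?\<mu>"
      "v = push (two_row_tabloid n) (square_flow (t (0, 0)) (t (0, 1)) (t (1, 0)) (t (1, 1)))"
      using polytabloid_two_rows[OF _ m(1)] m(2) by auto
    have "t (0, 0) \<in> {1..n}" "t (0, 1) \<in> {1..n}" "t (1, 0) \<in> {1..n}" "t (1, 1) \<in> {1..n}"
      by (rule tableau_mem[OF t(1) sum], use m in \<open>simp add: D\<close>)+
    moreover have "distinct [t (0, 0), t (0, 1), t (1, 0), t (1, 1)]"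
      using m by (simp add: tableau_eq_iff[OF t(1) sum] D)
    ultimately show "v \<in> push (two_row_tabloid n) ` square_flows n"
      unfolding t(2) square_flows_def by blast
  next
    fix v assume "v \<in> push (two_row_tabloid n) ` square_flows n"
    then obtain a b c d where abcd: "a \<in> {1..n}" "b \<in> {1..n}" "c \<in> {1..n}" "d \<in> {1..n}" "distinct [a, b, c, d]"
      "v = push (two_row_tabloid n) (square_flow a b c d)"
      by (auto simp: square_flows_def)
    define g :: "nat \<times> nat \<Rightarrow> nat"
      where "g = (\<lambda>(i, j). if i = 0 then if j = 0 then a else b else if j = 0 then c else d)"
    obtain t where t: "t \<in> tableaux ?\<mu>" "\<And>x. x \<in> {(0, 0), (0, 1), (1, 0), (1, 1)} \<Longrightarrow> t x = g x"
    proof (rule tableau_extending[of ?\<mu> "{(0, 0), (0, 1), (1, 0), (1, 1)}" g])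
      show "card (young_diagram ?\<mu>) = sum_list ?\<mu>"
        unfolding card_young_diagram by simp
      show "{(0, 0), (0, 1), (1, 0), (1, 1)} \<subseteq> young_diagram ?\<mu>"
        using m by (simp add: D)
      show "g ` {(0, 0), (0, 1), (1, 0), (1, 1)} \<subseteq> {1..sum_list ?\<mu>}"
        unfolding sum using abcd by (simp add: g_def)
      show "inj_on g {(0, 0), (0, 1), (1, 0), (1, 1)}"
        using abcd(5) by (simp add: g_def)
      show "finite (young_diagram ?\<mu>)"
        by (rule card_young_diagram)
    qed (use that in blast)
    have "polytabloid ?\<mu> t = v"
      using polytabloid_two_rows[OF t(1) m(1)] t(2) m(2) by (simp add: abcd(6) g_def)
    then show "v \<in> polytabloid ?\<mu> ` tableaux ?\<mu>"
      using t(1) by blast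
  qed
  then have carrier: "carrier (Specht (padded_partition n [2])) =
      push (two_row_tabloid n) ` rat_free.span (square_flows n)"
    by (simp add: padded_partition_def carrier_Specht push.span_image)
  define L where "L f = f + push prod.swap f" for f :: "nat \<times> nat \<Rightarrow>\<^sub>0 rat"
  interpret L: Vector_Spaces.linear rat_scale rat_scale L
    by unfold_locales (simp_all add: L_def push.add push.scale rat_free.scale_right_distrib algebra_simps)
  have "L = (\<lambda>f. f + push prod.swap f)"
    by (rule ext) (rule L_def)
  then have "signed_flows 1 n = rat_free.span (L ` square_flows n)"
    using symmetric_flows_span by (simp only:)
  also have "\<dots> = L ` rat_free.span (square_flows n)"
    by (rule L.span_image)
  finally have span: "signed_flows 1 n = L ` rat_free.span (square_flows n)" .
  have push_L: "push (two_row_tabloid n) (L f) = rat_scale 2 (push (two_row_tabloid n) f)" for f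
    using rat_free.scale_left_distrib[of 1 1 "push (two_row_tabloid n) f"]
    by (simp add: L_def push.add push_two_row_swap)
  show ?thesis
    unfolding carrier
  proof (intro equalityI subsetI)
    fix v assume "v \<in> push (two_row_tabloid n) ` rat_free.span (square_flows n)"
    then obtain f where f: "f \<in> rat_free.span (square_flows n)" "v = push (two_row_tabloid n) f"
      by blast
    then have "L f \<in> zero_sum_flows n"
      using span by (auto simp: signed_flows_def)
    then have "rat_scale (1 / 2) (L f) \<in> zero_sum_flows n"
      by (rule rat_free.subspace_scale[OF subspace_zero_sum_flows])
    moreover have "push (two_row_tabloid n) (rat_scale (1 / 2) (L f)) = v"
      by (simp add: push.scale push_L f(2))
    ultimately show "v \<in> push (two_row_tabloid n) ` zero_sum_flows n"
      by blast
  next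
    fix v assume "v \<in> push (two_row_tabloid n) ` zero_sum_flows n"
    then obtain f where f: "f \<in> zero_sum_flows n" "v = push (two_row_tabloid n) f"
      by blast
    then have "L f \<in> signed_flows 1 n"
      using zero_sum_flows_symmetrize(2) by (simp add: L_def)
    then obtain g where g: "g \<in> rat_free.span (square_flows n)" "L f = L g"
      using span by blast
    have "rat_scale 2 (push (two_row_tabloid n) f) = rat_scale 2 (push (two_row_tabloid n) g)"
      using g(2) push_L by metis
    then have "v = push (two_row_tabloid n) g"
      by (simp add: f(2))
    then show "v \<in> push (two_row_tabloid n) ` rat_free.span (square_flows n)"
      using g(1) by blast
  qed
qed

subsection \<open>Decomposition into Specht modules\<close>

lemma Specht_simps:
  "x \<oplus>\<^bsub>Specht \<mu>\<^esub> y = x + y" "c \<odot>\<^bsub>Specht \<mu>\<^esub> x = rat_scale c x"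
  by (simp_all add: Specht_def)

lemma Specht_action_eq_push: "Specht_action \<sigma> = push (permute_tabloid \<sigma>)"
  by (simp add: Specht_action_def push_def)

text \<open>Composes the passage \<phi> from homology to matrices, on which permutations relabel
  both indices, with equivariant maps \<open>\<psi> i\<close> to the individual summands.\<close>

lemma isomorphic_reps_Specht_sum:
  assumes \<phi>: "\<phi> \<in> linear_maps V (subspace_of_free K)" "bij_betw \<phi> (carrier V) K"
    and \<phi>_equivariant: "\<And>\<sigma> v. \<lbrakk>\<sigma> permutes {1..n}; v \<in> carrier V\<rbrakk> \<Longrightarrow> \<phi> (\<rho> \<sigma> v) = push (map_prod \<sigma> \<sigma>) (\<phi> v)"
    and \<psi>_linear: "\<And>i. i \<in> copies \<Lambda> m \<Longrightarrow> Vector_Spaces.linear rat_scale rat_scale (\<psi> i)"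
    and \<psi>_equivariant: "\<And>i \<sigma> f. \<lbrakk>i \<in> copies \<Lambda> m; \<sigma> permutes {1..n}\<rbrakk> \<Longrightarrow>
      \<psi> i (push (map_prod \<sigma> \<sigma>) f) = Specht_action \<sigma> (\<psi> i f)"
    and \<psi>_bij: "bij_betw (\<lambda>f. \<lambda>i\<in>copies \<Lambda> m. \<psi> i f) K
      (\<Pi>\<^sub>E i\<in>copies \<Lambda> m. carrier (Specht (padded_partition n (fst i))))"
  shows "isomorphic_reps n V \<rho> (Specht_sum n \<Lambda> m) (Specht_sum_action \<Lambda> m)"
proof -
  let ?I = "copies \<Lambda> m"
  define h where "h = (\<lambda>v. \<lambda>i\<in>?I. \<psi> i (\<phi> v))"
  have carrier: "carrier (Specht_sum n \<Lambda> m) = (\<Pi>\<^sub>E i\<in>?I. carrier (Specht (padded_partition n (fst i))))"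
    by (simp add: Specht_sum_def finite_direct_sum_def case_prod_unfold)
  have bij: "bij_betw h (carrier V) (carrier (Specht_sum n \<Lambda> m))"
    using bij_betw_trans[OF \<phi>(2) \<psi>_bij] by (simp add: carrier h_def comp_def)
  note lin = linear_mapsD[OF \<phi>(1), simplified]
  have add: "\<psi> i (x + y) = \<psi> i x + \<psi> i y" and scale: "\<psi> i (rat_scale c x) = rat_scale c (\<psi> i x)"
    if "i \<in> ?I" for i x y c
  proof -
    interpret Vector_Spaces.linear rat_scale rat_scale "\<psi> i"
      by (rule \<psi>_linear[OF that])
    show "\<psi> i (x + y) = \<psi> i x + \<psi> i y" "\<psi> i (rat_scale c x) = rat_scale c (\<psi> i x)"
      by (rule add, rule scale)
  qed
  have "h \<in> linear_maps V (Specht_sum n \<Lambda> m)"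
    unfolding linear_maps_def
  proof (intro CollectI conjI ballI allI)
    show "h \<in> carrier V \<rightarrow> carrier (Specht_sum n \<Lambda> m)"
      using bij by (auto simp: bij_betw_def)
    show "h (x \<oplus>\<^bsub>V\<^esub> y) = h x \<oplus>\<^bsub>Specht_sum n \<Lambda> m\<^esub> h y" if "x \<in> carrier V" "y \<in> carrier V" for x y
      using that
      by (auto simp: h_def Specht_sum_def finite_direct_sum_def case_prod_unfold Specht_simps lin add fun_eq_iff)
    show "h (c \<odot>\<^bsub>V\<^esub> x) = c \<odot>\<^bsub>Specht_sum n \<Lambda> m\<^esub> h x" if "x \<in> carrier V" for c x
      using that
      by (auto simp: h_def Specht_sum_def finite_direct_sum_def case_prod_unfold Specht_simps lin scale fun_eq_iff)
  qed
  moreover have "h (\<rho> \<sigma> v) = Specht_sum_action \<Lambda> m \<sigma> (h v)" if "\<sigma> permutes {1..n}" "v \<in> carrier V" for \<sigma> v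
    using that by (auto simp: h_def Specht_sum_action_def \<phi>_equivariant \<psi>_equivariant fun_eq_iff)
  ultimately show ?thesis
    unfolding isomorphic_reps_def using bij by blast
qed

lemma push_tabloid_equivariant:
  assumes "\<sigma> permutes {1..n}"
  shows "push (hook_tabloid n) (push (map_prod \<sigma> \<sigma>) f) = Specht_action \<sigma> (push (hook_tabloid n) f)"
    and "push (two_row_tabloid n) (push (map_prod \<sigma> \<sigma>) f) = Specht_action \<sigma> (push (two_row_tabloid n) f)"
  by (simp_all add: Specht_action_eq_push push_compose comp_def permute_tabloids[OF assms])

lemma push_hook_inj: "push (hook_tabloid n) f = push (hook_tabloid n) g \<Longrightarrow> f = g"
  by (rule push_inj_on[OF inj_hook_tabloid]) auto

lemma bij_betw_antisymmetric_flows: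
  assumes "n \<ge> 3"
  shows "bij_betw (push (hook_tabloid n)) (signed_flows (- 1) n) (carrier (Specht (padded_partition n [1, 1])))"
  unfolding carrier_Specht_hook[OF assms] by (intro bij_betw_imageI) (auto simp: inj_on_def dest: push_hook_inj)

text \<open>Off the diagonal, exactly \<open>(i, j)\<close> and \<open>(j, i)\<close> share a
  two-row tabloid.\<close>

lemma push_two_row_eq_0D:
  assumes "push (two_row_tabloid n) f = 0" "keys f \<subseteq> off_diagonal n"
  shows "f + push prod.swap f = 0"
proof (rule poly_mapping_eqI)
  fix x :: "nat \<times> nat"
  obtain i j where x: "x = (i, j)"
    by (cases x)
  show "lookup (f + push prod.swap f) x = lookup 0 x"
  proof (cases "i = j")
    case True
    then have "(i, j) \<notin> keys f"
      using assms(2) by (auto simp: off_diagonal_def)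
    then show ?thesis
      using True by (simp add: x lookup_add lookup_push_swap in_keys_iff)
  next
    case False
    have "0 = lookup (push (two_row_tabloid n) f) (two_row_tabloid n (i, j))"
      by (simp add: assms)
    also have "\<dots> = (\<Sum>y\<in>{y \<in> keys f \<union> {(i, j), (j, i)}.
        two_row_tabloid n y = two_row_tabloid n (i, j)}. lookup f y)"
      by (rule lookup_push_superset) auto
    also have "{y \<in> keys f \<union> {(i, j), (j, i)}. two_row_tabloid n y = two_row_tabloid n (i, j)} =
        {(i, j), (j, i)}"
      by (auto simp: two_row_tabloid_eq_iff)
    finally show ?thesis
      using False by (simp add: x lookup_add lookup_push_swap)
  qed
qed

text \<open>A zero-sum flow is the sum of its symmetric part, which the two-row tabloids see, and its
  antisymmetric part, which the hook tabloids see.\<close>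

lemma bij_betw_zero_sum_flows:
  assumes n: "n \<ge> 4"
  shows "bij_betw (\<lambda>f. (push (two_row_tabloid n) f, push (hook_tabloid n) (f - push prod.swap f)))
    (zero_sum_flows n)
    (carrier (Specht (padded_partition n [2])) \<times> carrier (Specht (padded_partition n [1, 1])))"
    (is "bij_betw ?h _ (?S \<times> ?A)")
proof (rule bij_betw_imageI)
  show "inj_on ?h (zero_sum_flows n)"
  proof (rule inj_onI)
    fix f g assume fg: "f \<in> zero_sum_flows n" "g \<in> zero_sum_flows n" "?h f = ?h g"
    define d where "d = f - g"
    have "d \<in> zero_sum_flows n"
      unfolding d_def by (rule rat_free.subspace_diff[OF subspace_zero_sum_flows fg(1,2)])
    moreover have "push (two_row_tabloid n) d = 0"
      using fg(3) by (simp add: d_def push.diff)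
    ultimately have "d + push prod.swap d = 0"
      by (intro push_two_row_eq_0D) (auto simp: zero_sum_flows_def)
    moreover have "f - push prod.swap f = g - push prod.swap g"
      using fg(3) by (intro push_hook_inj[of n]) simp
    then have "d = push prod.swap d"
      by (simp add: d_def push.diff algebra_simps)
    ultimately have "d = - d"
      by (metis eq_neg_iff_add_eq_0)
    then show "f = g"
      using poly_mapping_eq_neg_imp_0[of d] by (simp add: d_def)
  qed
  show "?h ` zero_sum_flows n = ?S \<times> ?A"
  proof (intro equalityI subsetI)
    fix p assume "p \<in> ?h ` zero_sum_flows n"
    then show "p \<in> ?S \<times> ?A"
      using n zero_sum_flows_symmetrize(3) by (auto simp: carrier_Specht_two_rows carrier_Specht_hook simp del: One_nat_def)
  next
    fix p assume "p \<in> ?S \<times> ?A"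
    then obtain g a where g: "g \<in> zero_sum_flows n" and a: "a \<in> signed_flows (- 1) n"
      and p: "p = (push (two_row_tabloid n) g, push (hook_tabloid n) a)"
      using n by (auto simp: carrier_Specht_two_rows carrier_Specht_hook simp del: One_nat_def)
    \<comment> \<open>The symmetric part of \<open>g\<close> has the same two-row image as
      \<open>g\<close>, while \<open>a\<close> has none. The factor 1/2 at \<open>a\<close>
      compensates for \<open>f - push prod.swap f\<close> doubling the antisymmetric part.\<close>
    define f where "f = rat_scale (1 / 2) (g + push prod.swap g) + rat_scale (1 / 2) a"
    have swap_a: "push prod.swap a = - a" and "a \<in> zero_sum_flows n"
      using a by (simp_all add: signed_flows_def)
    then have "f \<in> zero_sum_flows n"
      unfolding f_def using g zero_sum_flows_symmetrize(1)[OF g]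
      by (intro rat_free.subspace_add rat_free.subspace_scale subspace_zero_sum_flows)
    have half: "rat_scale (1 / 2) (v + v) = v" for v :: "'b \<Rightarrow>\<^sub>0 rat"
      using rat_free.scale_left_distrib[of "1 / 2" "1 / 2" v] by (simp add: rat_free.scale_right_distrib)
    have "push (two_row_tabloid n) a = - push (two_row_tabloid n) a"
      using push_two_row_swap[of n a] by (simp add: swap_a push.neg)
    then have "push (two_row_tabloid n) a = 0"
      by (rule poly_mapping_eq_neg_imp_0)
    then have "push (two_row_tabloid n) f = push (two_row_tabloid n) g"
      by (simp add: f_def push.add push.scale push_two_row_swap half)
    moreover have "f - push prod.swap f = a"
      by (rule poly_mapping_eqI)
        (simp only: f_def push.add push.scale swap_a push_swap_push_swap lookup_add lookup_minus
          lookup_rat_scale lookup_uminus, simp add: field_simps)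
    ultimately have "?h f = p"
      by (simp add: p)
    then show "p \<in> ?h ` zero_sum_flows n"
      using \<open>f \<in> zero_sum_flows n\<close> by blast
  qed
qed

lemma bij_betw_PiE_singleton: "bij_betw (\<lambda>v. \<lambda>i\<in>{p}. v) A (\<Pi>\<^sub>E i\<in>{p}. A)"
proof (rule bij_betw_byWitness[where f' = "\<lambda>x. x p"])
  show "\<forall>x\<in>\<Pi>\<^sub>E i\<in>{p}. A. (\<lambda>i\<in>{p}. x p) = x"
  proof
    fix x assume "x \<in> (\<Pi>\<^sub>E i\<in>{p}. A)"
    then show "(\<lambda>i\<in>{p}. x p) = x"
      by (intro extensionalityI[of _ "{p}"]) (auto simp: PiE_iff)
  qed
  show "(\<lambda>v. \<lambda>i\<in>{p}. v) ` A \<subseteq> (\<Pi>\<^sub>E i\<in>{p}. A)"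
    by (rule image_subsetI) (simp only: restrict_PiE_iff, simp)
qed auto

lemma bij_betw_PiE_pair:
  assumes "p \<noteq> q"
  shows "bij_betw (\<lambda>(v, w). \<lambda>i\<in>{p, q}. if i = p then v else w) (C p \<times> C q) (\<Pi>\<^sub>E i\<in>{p, q}. C i)"
proof (rule bij_betw_byWitness[where f' = "\<lambda>x. (x p, x q)"])
  show "\<forall>x\<in>\<Pi>\<^sub>E i\<in>{p, q}. C i. (case (x p, x q) of (v, w) \<Rightarrow> \<lambda>i\<in>{p, q}. if i = p then v else w) = x"
  proof
    fix x assume "x \<in> (\<Pi>\<^sub>E i\<in>{p, q}. C i)"
    then show "(case (x p, x q) of (v, w) \<Rightarrow> \<lambda>i\<in>{p, q}. if i = p then v else w) = x"
      by (intro extensionalityI[of _ "{p, q}"]) (auto simp: PiE_iff)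
  qed
  show "(\<lambda>(v, w). \<lambda>i\<in>{p, q}. if i = p then v else w) ` (C p \<times> C q) \<subseteq> (\<Pi>\<^sub>E i\<in>{p, q}. C i)"
  proof (rule image_subsetI)
    fix vw assume "vw \<in> C p \<times> C q"
    then show "(case vw of (v, w) \<Rightarrow> \<lambda>i\<in>{p, q}. if i = p then v else w) \<in> (\<Pi>\<^sub>E i\<in>{p, q}. C i)"
      using assms by (cases vw) (simp only: restrict_PiE_iff prod.case, auto)
  qed
  show "\<forall>vw\<in>C p \<times> C q. ((case vw of (v, w) \<Rightarrow> \<lambda>i\<in>{p, q}. if i = p then v else w) p,
      (case vw of (v, w) \<Rightarrow> \<lambda>i\<in>{p, q}. if i = p then v else w) q) = vw"
    using assms by auto
qed auto

lemma multiplicity_stable_UConf2: "multiplicity_stable_from H1_UConf2_star H1_UConf2_star_map 4"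
  unfolding multiplicity_stable_from_def
proof (intro exI conjI allI impI)
  let ?\<Lambda> = "{[1, 1]} :: nat list set" and ?m = "\<lambda>_ :: nat list. 1 :: nat"
  show "finite ?\<Lambda>" "\<forall>\<nu>\<in>?\<Lambda>. is_partition \<nu>"
    by (simp_all add: is_partition_def)
  fix n :: nat assume n: "n \<ge> 4"
  show "\<forall>\<nu>\<in>?\<Lambda>. paddable n \<nu>"
    using n by (simp add: paddable_def)
  have I: "copies ?\<Lambda> ?m = {([1, 1], 0)}"
    by (auto simp: copies_def)
  show "isomorphic_reps n (H1_UConf2_star n) (\<lambda>\<sigma>. H1_UConf2_star_map n n (restrict \<sigma> {1..n}))
      (Specht_sum n ?\<Lambda> ?m) (Specht_sum_action ?\<Lambda> ?m)"
  proof (rule isomorphic_reps_Specht_sum[OF H1_UConf2_star_flow,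
        where \<rho> = "\<lambda>\<sigma>. H1_UConf2_star_map n n (restrict \<sigma> {1..n})" and \<psi> = "\<lambda>_. push (hook_tabloid n)"])
    let ?A = "carrier (Specht (padded_partition n [1, 1]))"
    have "bij_betw (push (hook_tabloid n)) (signed_flows (- 1) n) ?A"
      using n by (intro bij_betw_antisymmetric_flows) simp
    moreover have "bij_betw (\<lambda>v. \<lambda>i\<in>{([1, 1], 0)}. v) ?A (\<Pi>\<^sub>E i\<in>{([1, 1] :: nat list, 0 :: nat)}. ?A)"
      by (rule bij_betw_PiE_singleton)
    ultimately have "bij_betw ((\<lambda>v. \<lambda>i\<in>{([1, 1], 0)}. v) \<circ> push (hook_tabloid n)) (signed_flows (- 1) n)
        (\<Pi>\<^sub>E i\<in>{([1, 1] :: nat list, 0 :: nat)}. ?A)"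
      by (rule bij_betw_trans)
    moreover have "(\<Pi>\<^sub>E i\<in>{([1, 1] :: nat list, 0 :: nat)}. ?A) =
        (\<Pi>\<^sub>E i\<in>copies ?\<Lambda> ?m. carrier (Specht (padded_partition n (fst i))))"
      unfolding I by (rule PiE_cong) simp
    ultimately show "bij_betw (\<lambda>f. \<lambda>i\<in>copies ?\<Lambda> ?m. push (hook_tabloid n) f) (signed_flows (- 1) n)
        (\<Pi>\<^sub>E i\<in>copies ?\<Lambda> ?m. carrier (Specht (padded_partition n (fst i))))"
      by (simp add: I comp_def del: One_nat_def)
  qed (simp_all add: push_tabloid_equivariant push.linear_axioms UConf_flow_natural del: One_nat_def)
qed

text \<open>Both multiplicities are one; \<open>paddable n [2]\<close> amounts to
  \<open>4 \<le> n\<close>.\<close>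

lemma multiplicity_stable_Conf2: "multiplicity_stable_from H1_Conf2_star H1_Conf2_star_map 4"
  unfolding multiplicity_stable_from_def
proof (intro exI conjI allI impI)
  let ?\<Lambda> = "{[2], [1, 1]} :: nat list set" and ?m = "\<lambda>_ :: nat list. 1 :: nat"
  show "finite ?\<Lambda>" "\<forall>\<nu>\<in>?\<Lambda>. is_partition \<nu>"
    by (simp_all add: is_partition_def)
  fix n :: nat assume n: "n \<ge> 4"
  show "\<forall>\<nu>\<in>?\<Lambda>. paddable n \<nu>"
    using n by (simp add: paddable_def)
  let ?i = "([2], 0) :: nat list \<times> nat" and ?j = "([1, 1], 0) :: nat list \<times> nat"
  have I: "copies ?\<Lambda> ?m = {?i, ?j}"
    by (auto simp: copies_def)
  have swap_equivariant: "push prod.swap (push (map_prod \<sigma> \<sigma>) f) = push (map_prod \<sigma> \<sigma>) (push prod.swap f)"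
    for \<sigma> and f :: "nat \<times> nat \<Rightarrow>\<^sub>0 rat"
    unfolding push_compose by (rule push_cong) auto
  \<comment> \<open>The second component is twice the antisymmetric part; the nonzero factor does
    not affect bijectivity.\<close>
  define \<psi> where "\<psi> i f = (if i = ?i then push (two_row_tabloid n) f
    else push (hook_tabloid n) (f - push prod.swap f))" for i and f :: "nat \<times> nat \<Rightarrow>\<^sub>0 rat"
  show "isomorphic_reps n (H1_Conf2_star n) (\<lambda>\<sigma>. H1_Conf2_star_map n n (restrict \<sigma> {1..n}))
      (Specht_sum n ?\<Lambda> ?m) (Specht_sum_action ?\<Lambda> ?m)"
  proof (rule isomorphic_reps_Specht_sum[OF H1_Conf2_star_flow,
        where \<rho> = "\<lambda>\<sigma>. H1_Conf2_star_map n n (restrict \<sigma> {1..n})" and \<psi> = \<psi>])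
    show "rat_linear (\<psi> i)" for i
      by unfold_locales (simp_all add: \<psi>_def push.add push.diff push.scale rat_free.scale_right_diff_distrib)
    show "\<psi> i (push (map_prod \<sigma> \<sigma>) f) = Specht_action \<sigma> (\<psi> i f)" if "\<sigma> permutes {1..n}" for i \<sigma> f
      using push_tabloid_equivariant[OF that]
      by (simp add: \<psi>_def swap_equivariant flip: push.diff)
    let ?S = "carrier (Specht (padded_partition n [2]))" and ?A = "carrier (Specht (padded_partition n [1, 1]))"
    let ?C = "\<lambda>i. carrier (Specht (padded_partition n (fst i)))"
    have "bij_betw (\<lambda>(v, w). \<lambda>i\<in>{?i, ?j}. if i = ?i then v else w) (?S \<times> ?A) (\<Pi>\<^sub>E i\<in>{?i, ?j}. ?C i)"
      using bij_betw_PiE_pair[of ?i ?j ?C] by simp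
    with bij_betw_zero_sum_flows[OF n]
    have "bij_betw ((\<lambda>(v, w). \<lambda>i\<in>{?i, ?j}. if i = ?i then v else w) \<circ>
        (\<lambda>f. (push (two_row_tabloid n) f, push (hook_tabloid n) (f - push prod.swap f))))
        (zero_sum_flows n) (\<Pi>\<^sub>E i\<in>{?i, ?j}. ?C i)"
      by (rule bij_betw_trans)
    then show "bij_betw (\<lambda>f. \<lambda>i\<in>copies ?\<Lambda> ?m. \<psi> i f) (zero_sum_flows n) (\<Pi>\<^sub>E i\<in>copies ?\<Lambda> ?m. ?C i)"
      unfolding I by (simp add: \<psi>_def comp_def del: One_nat_def)
  qed (simp add: Conf_flow_natural del: One_nat_def)
qed

theorem theorem3p2:
  shows "FI_module H1_Conf2_star H1_Conf2_star_map \<and>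
         multiplicity_stable_from H1_Conf2_star H1_Conf2_star_map 4 \<and>
         FI_module H1_UConf2_star H1_UConf2_star_map \<and>
         multiplicity_stable_from H1_UConf2_star H1_UConf2_star_map 4"
  using FI_module_H1_Conf2_star multiplicity_stable_Conf2
    FI_module_H1_UConf2_star multiplicity_stable_UConf2 by blast

end
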